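(* A fullerene $F$ is a leapfrog fullerene if and only if, for every master edge of $F$ with Coxeter coordinates $(a',b')$, one has $a'\equiv b' \pmod 3$.
   Context: A fullerene is a 3-regular plane graph all of whose faces are pentagons or hexagons; there are exactly 12 pentagons. Its dual is a plane triangulation, which can be unfolded locally onto the Eisenstein plane. This is the complex plane with the triangular lattice $\{a+b\omega : a,b\in\mathbb{Z}\}$, where $\omega=e^{i\pi/3}$, so that $\omega^2=\omega-1$. The master polyhedron of the fullerene is the triangulated polyhedron whose vertices are the 12 pentagons. Its edges, the master edges, join pentagon centers in the unfolded lattice. A master edge is the lattice vector $a+b\omega$, and its Coxeter coordinates are $(a,b)$ with $a,b\ge0$. The Goldberg–Coxeter transformation $(k,l)$ multiplies every master edge vector $a+b\omega$ by $k+l\omega$, so that $(a,b)\mapsto(ka-lb,\; la+(k+l)b)$. Geometrically, it replaces each triangle of the dual by the graphene patch spanned by $k+l\omega$. The leapfrog transformation is the Goldberg–Coxeter transformation $(1,1)$. A leapfrog fullerene is a fullerene obtained from some fullerene by the leapfrog transformation. *)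

theory Defs
  imports "HOL-Analysis.Analysis" "HOL-Combinatorics.Orbits" "HOL-Number_Theory.Cong"
begin

section \<open>Plane graphs as combinatorial maps\<close>

text \<open>
  A graph embedded in an oriented closed surface is given by its darts (directed edges), the
  reversal \<open>opp\<close> of darts and the permutation \<open>rot\<close> that sends a dart to the next dart,
  counterclockwise, with the same origin. Vertices, edges and faces are orbits.
\<close>

record 'd cmap =
  darts :: "'d set"
  opp :: "'d \<Rightarrow> 'd"
  rot :: "'d \<Rightarrow> 'd"

definition combinatorial_map :: "'d cmap \<Rightarrow> bool" where
  "combinatorial_map G \<longleftrightarrow>
     finite (darts G) \<and> darts G \<noteq> {} \<and>
     opp G permutes darts G \<and> rot G permutes darts G \<and>
     (\<forall>d\<in>darts G. opp G (opp G d) = d \<and> opp G d \<noteq> d)"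

text \<open>The next dart on the boundary of the face to the left of \<open>d\<close>, traversed counterclockwise.\<close>

definition face :: "'d cmap \<Rightarrow> 'd \<Rightarrow> 'd" where
  "face G d = inv (rot G) (opp G d)"

definition connected_map :: "'d cmap \<Rightarrow> bool" where
  "connected_map G \<longleftrightarrow>
     (\<forall>d\<in>darts G. \<forall>d'\<in>darts G.
        (d, d') \<in> {(x, y). x \<in> darts G \<and> (y = opp G x \<or> y = rot G x)}\<^sup>*)"

definition vertices :: "'d cmap \<Rightarrow> 'd set set" where
  "vertices G = orbit (rot G) ` darts G"

definition edges :: "'d cmap \<Rightarrow> 'd set set" where
  "edges G = (\<lambda>d. {d, opp G d}) ` darts G"

definition faces :: "'d cmap \<Rightarrow> 'd set set" where
  "faces G = orbit (face G) ` darts G"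

definition simple_map :: "'d cmap \<Rightarrow> bool" where
  "simple_map G \<longleftrightarrow>
     (\<forall>d\<in>darts G. opp G d \<notin> orbit (rot G) d) \<and>
     (\<forall>d\<in>darts G. \<forall>d'\<in>darts G.
        d' \<in> orbit (rot G) d \<and> opp G d' \<in> orbit (rot G) (opp G d) \<longrightarrow> d' = d)"

text \<open>For a connected map, Euler's formula says that the surface is the sphere.\<close>

definition plane_graph :: "'d cmap \<Rightarrow> bool" where
  "plane_graph G \<longleftrightarrow>
     combinatorial_map G \<and> connected_map G \<and> simple_map G \<and>
     card (vertices G) + card (faces G) = card (edges G) + 2"

definition fullerene :: "'d cmap \<Rightarrow> bool" where
  "fullerene F \<longleftrightarrow>
     plane_graph F \<and> (\<forall>v\<in>vertices F. card v = 3) \<and> (\<forall>f\<in>faces F. card f = 5 \<or> card f = 6)"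

text \<open>
  The dual uses the same darts: the dual of \<open>d\<close> crosses \<open>d\<close> from the face on its left to the face
  on its right.
\<close>

definition dual :: "'d cmap \<Rightarrow> 'd cmap" where
  "dual G = \<lparr>darts = darts G, opp = opp G, rot = face G\<rparr>"


section \<open>The Eisenstein plane\<close>

definition omega :: complex where
  "omega = cis (pi / 3)"

definition eisenstein :: "complex set" where
  "eisenstein = {of_int a + of_int b * omega | a b. True}"

definition eisenstein_units :: "complex set" where
  "eisenstein_units = {omega ^ j | j. j < 6}"

lemma omega_square: "omega\<^sup>2 = omega - 1"
proof -
  have *: "omega = Complex (1/2) (sqrt 3 / 2)"
    by (simp add: omega_def complex_eq_iff cos_60 sin_60)
  show ?thesis
    unfolding * by (simp add: power2_eq_square complex_eq_iff)
qed

lemma eisenstein_mult: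
  "(of_int k + of_int l * omega) * (of_int a + of_int b * omega) =
   of_int (k * a - l * b) + of_int (l * a + (k + l) * b) * omega"
proof -
  have "omega * omega = omega - 1"
    using omega_square by (simp add: power2_eq_square)
  then have "of_int l * of_int b * (omega * omega) = of_int l * of_int b * (omega - 1)"
    by simp
  then show ?thesis
    by (simp add: algebra_simps)
qed

text \<open>A lattice dart \<open>(p, u)\<close> runs from \<open>p\<close> to \<open>p + u\<close>.\<close>

type_synonym ldart = "complex \<times> complex"

definition ldarts :: "ldart set" where
  "ldarts = eisenstein \<times> eisenstein_units"

fun lopp :: "ldart \<Rightarrow> ldart" where
  "lopp (p, u) = (p + u, - u)"

fun lface :: "ldart \<Rightarrow> ldart" where
  "lface (p, u) = (p + u, omega\<^sup>2 * u)"

text \<open>The open edge of a lattice dart, and the open lattice triangle to its left.\<close>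

fun ledge :: "ldart \<Rightarrow> complex set" where
  "ledge (p, u) = open_segment p (p + u)"

fun ltri :: "ldart \<Rightarrow> complex set" where
  "ltri (p, u) = interior (convex hull {p, p + u, p + omega * u})"

text \<open>The rigid motion \<open>z \<mapsto> c z + t\<close> on lattice darts.\<close>

fun move :: "complex \<Rightarrow> complex \<Rightarrow> ldart \<Rightarrow> ldart" where
  "move c t (p, u) = (c * p + t, c * u)"

text \<open>
  The point of the left triangle of a lattice dart that corresponds to the point \<open>w\<close> of the
  standard triangle \<open>0, 1, omega\<close>.
\<close>

fun place :: "ldart \<Rightarrow> complex \<Rightarrow> complex" where
  "place (p, u) w = p + u * w"


section \<open>Unfolding a triangulation onto the Eisenstein plane\<close>

text \<open>
  Let \<open>T\<close> be a triangulation; its surface consists of unit equilateral triangles, one for each face.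
  A chart \<open>\<psi>\<close> unfolds a part of this surface onto the open convex region \<open>R\<close> of the Eisenstein plane:
  each lattice triangle that meets \<open>R\<close> is labelled by a triangle of \<open>T\<close> (dart by dart), and lattice
  triangles that are adjacent across an edge meeting \<open>R\<close> are labelled by triangles of \<open>T\<close> that are
  adjacent across the corresponding edge. Values of \<open>\<psi>\<close> at other lattice darts are irrelevant.
\<close>

definition unfolds :: "'d cmap \<Rightarrow> complex set \<Rightarrow> (ldart \<Rightarrow> 'd) \<Rightarrow> bool" where
  "unfolds T R \<psi> \<longleftrightarrow>
     (\<forall>\<delta>\<in>ldarts. ltri \<delta> \<inter> R \<noteq> {} \<longrightarrow>
        \<psi> \<delta> \<in> darts T \<and>
        \<psi> (lface \<delta>) = face T (\<psi> \<delta>) \<and>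
        (ledge \<delta> \<inter> R \<noteq> {} \<longrightarrow> \<psi> (lopp \<delta>) = opp T (\<psi> \<delta>)))"


section \<open>Master polyhedra\<close>

text \<open>
  A tile is a lattice triangle with corners \<open>x\<close>, \<open>y\<close>, \<open>z\<close>, together with a chart on its interior.
\<close>

record 'd tile =
  corners :: "complex \<times> complex \<times> complex"
  chart :: "ldart \<Rightarrow> 'd"

fun triangle :: "complex \<times> complex \<times> complex \<Rightarrow> complex set" where
  "triangle (x, y, z) = convex hull {x, y, z}"

fun corner_set :: "complex \<times> complex \<times> complex \<Rightarrow> complex set" where
  "corner_set (x, y, z) = {x, y, z}"

fun side_vectors :: "complex \<times> complex \<times> complex \<Rightarrow> complex set" where
  "side_vectors (x, y, z) = {y - x, z - y, x - z}"

text \<open>The lattice darts at which the chart of a tile is meaningful.\<close>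

definition tile_darts :: "'d tile \<Rightarrow> ldart set" where
  "tile_darts \<tau> = {\<delta> \<in> ldarts. ltri \<delta> \<inter> interior (triangle (corners \<tau>)) \<noteq> {}}"

text \<open>
  In the dual of a fullerene the vertices of degree 5 are the pentagons. The last condition says
  that the corners of a tile are pentagons, and that a tile contains no pentagon apart from its
  corners.
\<close>

definition master_tile :: "'d cmap \<Rightarrow> 'd tile \<Rightarrow> bool" where
  "master_tile T \<tau> \<longleftrightarrow>
     corner_set (corners \<tau>) \<subseteq> eisenstein \<and>
     \<not> collinear (corner_set (corners \<tau>)) \<and>
     unfolds T (interior (triangle (corners \<tau>))) (chart \<tau>) \<and>
     (\<forall>\<delta>\<in>tile_darts \<tau>. fst \<delta> \<in> triangle (corners \<tau>) \<longrightarrow>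
        (card (orbit (rot T) (chart \<tau> \<delta>)) = 5 \<longleftrightarrow> fst \<delta> \<in> corner_set (corners \<tau>)))"

text \<open>
  The tiles form a geodesic triangulation of the surface of \<open>T\<close>: they cover it and their interiors
  are disjoint. Points of the surface are given by a dart \<open>d\<close> and a point \<open>w\<close> of the standard
  triangle, which is identified with the triangle of \<open>T\<close> to the left of \<open>d\<close>. Since pentagons lie
  only at corners of tiles, every pentagon is a vertex, and tiles meet edge to edge.
\<close>

definition tiles_cover :: "'d cmap \<Rightarrow> 'd tile set \<Rightarrow> bool" where
  "tiles_cover T M \<longleftrightarrow>
     (\<forall>d\<in>darts T. \<forall>w\<in>ltri (0, 1). \<exists>\<tau>\<in>M. \<exists>\<delta>\<in>tile_darts \<tau>.
        chart \<tau> \<delta> = d \<and> place \<delta> w \<in> triangle (corners \<tau>))"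

definition tiles_disjoint :: "'d tile set \<Rightarrow> bool" where
  "tiles_disjoint M \<longleftrightarrow>
     (\<forall>\<tau>\<in>M. \<forall>\<tau>'\<in>M. \<forall>\<delta>\<in>tile_darts \<tau>. \<forall>\<delta>'\<in>tile_darts \<tau>'. \<forall>w\<in>ltri (0, 1).
        chart \<tau> \<delta> = chart \<tau>' \<delta>' \<and>
        place \<delta> w \<in> interior (triangle (corners \<tau>)) \<and>
        place \<delta>' w \<in> interior (triangle (corners \<tau>')) \<longrightarrow> \<tau> = \<tau>' \<and> \<delta> = \<delta>')"

definition master_polyhedron :: "'d cmap \<Rightarrow> 'd tile set \<Rightarrow> bool" where
  "master_polyhedron F M \<longleftrightarrow>
     finite M \<and> (\<forall>\<tau>\<in>M. master_tile (dual F) \<tau>) \<and>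
     tiles_cover (dual F) M \<and> tiles_disjoint M"

text \<open>
  A master edge is represented by its lattice vector in the charts of the two tiles containing it;
  these vectors differ by a unit.
\<close>

definition master_edges :: "'d tile set \<Rightarrow> complex set" where
  "master_edges M = (\<Union>\<tau>\<in>M. side_vectors (corners \<tau>))"

text \<open>
  Since charts are determined only up to rotation, Coxeter coordinates are read off after rotating
  the vector into the sector between \<open>1\<close> and \<open>omega\<close>. A vector along a lattice line has both
  \<open>(a, 0)\<close> and \<open>(0, a)\<close> as coordinates.
\<close>

definition coxeter_coordinates :: "complex \<Rightarrow> nat \<Rightarrow> nat \<Rightarrow> bool" where
  "coxeter_coordinates v a b \<longleftrightarrow>
     (\<exists>u\<in>eisenstein_units. v = u * (of_nat a + of_nat b * omega))"


section \<open>Goldberg--Coxeter transformations\<close>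

text \<open>
  Let \<open>s = k + l omega\<close>. The dual of \<open>F\<close> arises from the dual of \<open>G\<close> by replacing each triangle by
  the lattice triangle \<open>0, s, omega s\<close>. For each dart \<open>d\<close> of the dual of \<open>G\<close>, the chart \<open>\<Psi> d\<close> shows the
  patch to the left of \<open>d\<close> together with the patch to its right, i.e. the rhombus
  \<open>0, s / omega, s, omega s\<close>, with \<open>d\<close> running from \<open>0\<close> to \<open>s\<close>. The charts of \<open>d\<close> and of its reversal
  show the same rhombus, and the three darts of a triangle share the patch to their left. So the
  patches are glued as the triangles of the dual of \<open>G\<close>, and this yields a locally isometric map onto
  the surface of the dual of \<open>F\<close>; by the condition on the number of darts (equality of areas)
  it is one-to-one.
\<close>

definition goldberg_coxeter :: "nat \<Rightarrow> nat \<Rightarrow> 'd cmap \<Rightarrow> 'd cmap \<Rightarrow> bool" where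
  "goldberg_coxeter k l G F \<longleftrightarrow>
     (let s = of_nat k + of_nat l * omega;
          rhombus = interior (convex hull {0, s / omega, s, omega * s});
          patch = interior (convex hull {0, s, omega * s})
      in (k, l) \<noteq> (0, 0) \<and>
         card (darts F) = (k\<^sup>2 + k * l + l\<^sup>2) * card (darts G) \<and>
         (\<exists>\<Psi>. \<forall>d\<in>darts (dual G).
            unfolds (dual F) rhombus (\<Psi> d) \<and>
            (\<forall>\<delta>\<in>ldarts. ltri \<delta> \<inter> rhombus \<noteq> {} \<longrightarrow>
               \<Psi> (opp (dual G) d) (move (-1) s \<delta>) = \<Psi> d \<delta>) \<and>
            (\<forall>\<delta>\<in>ldarts. ltri \<delta> \<inter> patch \<noteq> {} \<longrightarrow>
               \<Psi> (face (dual G) d) (move (1 / omega\<^sup>2) (- s / omega\<^sup>2) \<delta>) = \<Psi> d \<delta>)))"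

text \<open>
  Taking \<open>G\<close> over the same type of darts is no restriction, since \<open>G\<close> has fewer darts than \<open>F\<close>.
\<close>

definition leapfrog_fullerene :: "'d cmap \<Rightarrow> bool" where
  "leapfrog_fullerene F \<longleftrightarrow>
     fullerene F \<and> (\<exists>G. fullerene G \<and> goldberg_coxeter 1 1 G F)"

end

theory Submission
  imports Defs
begin

text \<open>
  Modulo \<open>1 + \<omega>\<close> the Eisenstein integers are the field with three elements. \<open>F\<close> is a leapfrog fullerene
  iff the vertices of the dual triangulation admit a distinguished subset meeting every triangle in
  exactly one vertex: the vertices of the triangulation that was subdivided. Around a vertex of odd
  degree such a subset can only contain the vertex itself, so it contains all pentagons. On an unfolded
  tile it is a residue class modulo \<open>1 + \<omega>\<close>; hence the corners of a tile are congruent. Conversely, if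
  the corners of every tile are congruent, each tile determines a class on the triangles that it meets.
  Two tiles with a common boundary point lie on opposite sides of a common line through it; following
  this line, the two charts agree until the first corner of one of the tiles is reached, which is a
  pentagon and therefore a corner of both. So the classes fit together. That the preimage of \<open>F\<close> is a
  fullerene follows by counting, except for its simplicity: two parallel edges not bounding a digon would
  force, by the sizes of the faces, all faces to be hexagons, against Euler's formula.
\<close>

section \<open>Lattice coordinates\<close>

text \<open>The data do not tell how two tiles meet: charts live on open interiors, and
  \<open>master_polyhedron\<close> only asks for covering and disjointness. Adjacency has to be
  recovered by developing \<open>T\<close> in the lattice, and the obstacle is holonomy: around a
  pentagon the developed label depends on the path. Development is therefore a relation,
  \<open>link\<close>, confined to the triangles at one point; it is single-valued off the lattice
  and at vertices of degree 6. Comparisons of tiles start at a point off the lattice, an inner point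
  of a small triangle or the midpoint of a small edge. This is enough because every condition on a
  colouring concerns one triangle or one edge. For the preimage nothing has to be glued:
  \<open>G\<close> is the dual triangulation with the distinguished vertices deleted, on a subset of
  the same darts, and the charts required by the Goldberg-Coxeter relation are developments around
  the two hexagons at the centres of the patches.\<close>

definition xc :: "complex \<Rightarrow> real" where "xc z = Re z - Im z / sqrt 3"
definition yc :: "complex \<Rightarrow> real" where "yc z = 2 * Im z / sqrt 3"

lemma omega_eq: "omega = Complex (1/2) (sqrt 3 / 2)"
  by (simp add: omega_def complex_eq_iff cos_60 sin_60)

lemma omega_mult_self: "omega * omega = omega - 1" "omega * (omega * z) = omega * z - z"
proof -
  show "omega * omega = omega - 1" using omega_square by (simp add: power2_eq_square)
  then show "omega * (omega * z) = omega * z - z"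
    by (metis left_diff_distrib mult.assoc mult.left_neutral)
qed

lemma omega_neq_0 [simp]: "omega \<noteq> 0"
  by (simp add: omega_def)

lemma norm_omega [simp]: "norm omega = 1"
  by (simp add: omega_def)

lemma xc_simps [simp]:
  "xc 0 = 0" "xc 1 = 1" "xc omega = 0" "xc (a + b) = xc a + xc b" "xc (a - b) = xc a - xc b"
  "xc (- a) = - xc a" "xc (of_real r) = r" "xc (of_int i) = i" "xc (of_nat n) = n"
  "xc (r *\<^sub>R a) = r * xc a" "xc (of_real r * a) = r * xc a" "xc (a * of_real r) = xc a * r"
  "xc (of_int i * a) = of_int i * xc a" "xc (of_nat n * a) = of_nat n * xc a"
  "xc (numeral k) = numeral k" "xc (numeral k * a) = numeral k * xc a" 
  by (simp_all add: xc_def omega_eq field_simps)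

lemma yc_simps [simp]:
  "yc 0 = 0" "yc 1 = 0" "yc omega = 1" "yc (a + b) = yc a + yc b" "yc (a - b) = yc a - yc b"
  "yc (- a) = - yc a" "yc (of_real r) = 0" "yc (of_int i) = 0" "yc (of_nat n) = 0"
  "yc (r *\<^sub>R a) = r * yc a" "yc (of_real r * a) = r * yc a" "yc (a * of_real r) = yc a * r"
  "yc (of_int i * a) = of_int i * yc a" "yc (of_nat n * a) = of_nat n * yc a"
  "yc (numeral k) = 0" "yc (numeral k * a) = numeral k * yc a" 
  by (simp_all add: yc_def omega_eq field_simps)

lemma xc_omega [simp]: "xc (omega * a) = - yc a" "xc (a * omega) = - yc a"
  and yc_omega [simp]: "yc (omega * a) = xc a + yc a" "yc (a * omega) = xc a + yc a"
  by (simp_all add: xc_def yc_def omega_eq field_simps)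

lemma coord_eq: "z = of_real (xc z) + of_real (yc z) * omega"
  by (simp add: complex_eq_iff omega_eq xc_def yc_def)

lemma coord_eqI: "xc z = xc w \<Longrightarrow> yc z = yc w \<Longrightarrow> z = w"
  by (metis coord_eq)

lemma coord_eq_iff: "z = w \<longleftrightarrow> xc z = xc w \<and> yc z = yc w"
  using coord_eqI by blast

text \<open>Inner products with fixed vectors, so that the library facts on interiors of half-spaces
  apply to the half-planes that bound a lattice triangle.\<close>

lemma xc_inner: "xc z = Complex 1 (- 1 / sqrt 3) \<bullet> z"
  and yc_inner: "yc z = Complex 0 (2 / sqrt 3) \<bullet> z"
  and xyc_inner: "xc z + yc z = Complex 1 (1 / sqrt 3) \<bullet> z"
  by (simp_all add: xc_def yc_def inner_complex_def)

lemma continuous_xc [continuous_intros]: "continuous_on S f \<Longrightarrow> continuous_on S (\<lambda>t. xc (f t))"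
  and continuous_yc [continuous_intros]: "continuous_on S f \<Longrightarrow> continuous_on S (\<lambda>t. yc (f t))"
  by (auto simp: xc_def yc_def intro!: continuous_intros)

text \<open>A crude constant is enough: the bounds serve local finiteness of the tiling and
  finiteness of the lattice points in a disc.\<close>

lemma abs_xc_le: "\<bar>xc z\<bar> \<le> 2 * norm z" and abs_yc_le: "\<bar>yc z\<bar> \<le> 2 * norm z"
  and abs_xyc_le: "\<bar>xc z + yc z\<bar> \<le> 2 * norm z"
proof -
  have s: "sqrt 3 \<ge> 1" by simp
  have "\<bar>Im z / sqrt 3\<bar> \<le> \<bar>Im z\<bar>"
    using s by (simp add: abs_divide divide_le_eq mult_le_cancel_left1)
  moreover have "\<bar>Re z\<bar> \<le> norm z" "\<bar>Im z\<bar> \<le> norm z"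
    by (auto intro: abs_Re_le_cmod abs_Im_le_cmod)
  moreover have "xc z = Re z - Im z / sqrt 3" "yc z = 2 * (Im z / sqrt 3)"
    by (simp_all add: xc_def yc_def)
  ultimately show "\<bar>xc z\<bar> \<le> 2 * norm z" "\<bar>yc z\<bar> \<le> 2 * norm z" "\<bar>xc z + yc z\<bar> \<le> 2 * norm z"
    by linarith+
qed

definition lat :: "int \<Rightarrow> int \<Rightarrow> complex" where "lat m n = of_int m + of_int n * omega"

lemma lat_coord [simp]: "xc (lat m n) = m" "yc (lat m n) = n"
  by (simp_all add: lat_def)

lemma eisenstein_lat: "eisenstein = {lat m n | m n. True}"
  by (simp add: eisenstein_def lat_def)

lemma eisenstein_iff: "z \<in> eisenstein \<longleftrightarrow> xc z \<in> \<int> \<and> yc z \<in> \<int>"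
proof
  assume "xc z \<in> \<int> \<and> yc z \<in> \<int>"
  then obtain m n where "xc z = of_int m" "yc z = of_int n" by (auto elim!: Ints_cases)
  then have "z = lat m n" by (simp add: coord_eq_iff)
  then show "z \<in> eisenstein" by (auto simp: eisenstein_lat)
qed (auto simp: eisenstein_lat)

lemma eisenstein_closed [simp, intro]:
  "0 \<in> eisenstein" "1 \<in> eisenstein" "omega \<in> eisenstein"
  "a \<in> eisenstein \<Longrightarrow> b \<in> eisenstein \<Longrightarrow> a + b \<in> eisenstein"
  "a \<in> eisenstein \<Longrightarrow> b \<in> eisenstein \<Longrightarrow> a - b \<in> eisenstein"
  "a \<in> eisenstein \<Longrightarrow> - a \<in> eisenstein"
  by (auto simp: eisenstein_iff)

lemma eisenstein_mult_closed [simp, intro]: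
  assumes "a \<in> eisenstein" "b \<in> eisenstein" shows "a * b \<in> eisenstein"
proof -
  obtain k l m n where "a = of_int k + of_int l * omega" "b = of_int m + of_int n * omega"
    using assms by (auto simp: eisenstein_def)
  then have "a * b = lat (k * m - l * n) (l * m + (k + l) * n)"
    by (simp only: eisenstein_mult lat_def)
  then show ?thesis by (auto simp: eisenstein_lat)
qed

lemma countable_eisenstein: "countable eisenstein"
proof -
  have "eisenstein \<subseteq> (\<lambda>(m, n). lat m n) ` UNIV" by (auto simp: eisenstein_lat)
  then show ?thesis by (rule countable_subset) simp
qed

section \<open>Powers of \<open>omega\<close> and the six units\<close>

lemma omega_powers:
  "omega ^ 2 = omega - 1" "omega ^ 3 = - 1" "omega ^ 4 = - omega" "omega ^ 5 = 1 - omega" "omega ^ 6 = 1"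
proof -
  show 2: "omega ^ 2 = omega - 1" by (rule omega_square)
  show 3: "omega ^ 3 = - 1"
    by (simp add: numeral_eq_Suc omega_mult_self algebra_simps)
  show 4: "omega ^ 4 = - omega" "omega ^ 5 = 1 - omega" "omega ^ 6 = 1"
    by (simp_all add: numeral_eq_Suc omega_mult_self algebra_simps)
qed

lemma units_eq: "eisenstein_units = {1, omega, omega - 1, - 1, - omega, 1 - omega}"
proof -
  have "{j::nat. j < 6} = {0, 1, 2, 3, 4, 5}" by auto
  moreover have "eisenstein_units = (\<lambda>j. omega ^ j) ` {j::nat. j < 6}"
    by (auto simp: eisenstein_units_def)
  ultimately show ?thesis by (simp add: omega_powers)
qed

lemma units_closed [simp, intro]:
  "1 \<in> eisenstein_units" "omega \<in> eisenstein_units"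
  "u \<in> eisenstein_units \<Longrightarrow> - u \<in> eisenstein_units"
  "u \<in> eisenstein_units \<Longrightarrow> omega * u \<in> eisenstein_units"
  "u \<in> eisenstein_units \<Longrightarrow> omega\<^sup>2 * u \<in> eisenstein_units"
proof -
  show "1 \<in> eisenstein_units" "omega \<in> eisenstein_units" by (simp_all add: units_eq)
  show "- u \<in> eisenstein_units" if "u \<in> eisenstein_units" for u
    using that by (auto simp: units_eq)
  show *: "omega * u \<in> eisenstein_units" if "u \<in> eisenstein_units" for u
    using that unfolding units_eq by (elim insertE emptyE; hypsubst) (simp_all add: omega_mult_self algebra_simps)
  show "omega\<^sup>2 * u \<in> eisenstein_units" if "u \<in> eisenstein_units" for u
    using *[OF *[OF that]] by (simp add: power2_eq_square mult.assoc)
qed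

lemma units_mult [simp, intro]:
  "u \<in> eisenstein_units \<Longrightarrow> v \<in> eisenstein_units \<Longrightarrow> u * v \<in> eisenstein_units"
  by (simp only: units_eq) (elim insertE emptyE; hypsubst; simp add: omega_mult_self algebra_simps)

lemma units_inverse [simp, intro]:
  assumes "u \<in> eisenstein_units" shows "inverse u \<in> eisenstein_units"
proof -
  obtain j where j: "j < 6" "u = omega ^ j" using assms by (auto simp: eisenstein_units_def)
  have "omega ^ j * omega ^ (6 - j) = 1"
    using j by (simp flip: power_add add: omega_powers)
  then have "inverse u = omega ^ (6 - j)" using j inverse_unique by metis
  moreover have "omega ^ k \<in> eisenstein_units" for k
    by (induction k) auto
  ultimately show ?thesis by simp
qed

lemma units_divide [simp, intro]:
  "u \<in> eisenstein_units \<Longrightarrow> v \<in> eisenstein_units \<Longrightarrow> u / v \<in> eisenstein_units"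
  by (simp add: divide_inverse)

lemma units_norm: "u \<in> eisenstein_units \<Longrightarrow> norm u = 1"
  by (auto simp: eisenstein_units_def norm_power)

lemma units_neq_0: "u \<in> eisenstein_units \<Longrightarrow> u \<noteq> 0"
  using units_norm by fastforce

lemma units_eisenstein [simp, intro]: "u \<in> eisenstein_units \<Longrightarrow> u \<in> eisenstein"
  by (auto simp: units_eq)

section \<open>Lattice triangles\<close>

lemma ldarts_iff [simp]: "(p, u) \<in> ldarts \<longleftrightarrow> p \<in> eisenstein \<and> u \<in> eisenstein_units"
  by (simp add: ldarts_def)

lemma lface_ldarts [simp, intro]: "\<delta> \<in> ldarts \<Longrightarrow> lface \<delta> \<in> ldarts"
  and lopp_ldarts [simp, intro]: "\<delta> \<in> ldarts \<Longrightarrow> lopp \<delta> \<in> ldarts"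
  by (cases \<delta>; simp; fail)+

declare lface.simps [simp del]

lemma lopp_lopp [simp]: "lopp (lopp \<delta>) = \<delta>"
  by (cases \<delta>) simp

lemma lface_2: "lface (lface (p, u)) = (p + omega * u, - omega * u)"
  by (simp add: lface.simps omega_square omega_mult_self algebra_simps)

lemma lface_3 [simp]: "lface (lface (lface \<delta>)) = \<delta>"
  by (cases \<delta>) (simp add: lface.simps omega_square omega_mult_self algebra_simps)

fun ctri :: "ldart \<Rightarrow> complex set" where
  "ctri (p, u) = convex hull {p, p + u, p + omega * u}"

lemma ltri_eq: "ltri \<delta> = interior (ctri \<delta>)"
  by (cases \<delta>) simp

lemma convex_ctri: "convex (ctri \<delta>)" and convex_ltri: "convex (ltri \<delta>)"
  and open_ltri: "open (ltri \<delta>)" and ltri_subset: "ltri \<delta> \<subseteq> ctri \<delta>"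
  and compact_ctri: "compact (ctri \<delta>)"
  by (cases \<delta>; simp add: convex_interior interior_subset finite_imp_compact_convex_hull; fail)+

lemma ctri_lface [simp]: "ctri (lface \<delta>) = ctri \<delta>"
proof (cases \<delta>)
  case (Pair p u)
  have "{p + u, p + u + omega\<^sup>2 * u, p + u + omega * (omega\<^sup>2 * u)} = {p, p + u, p + omega * u}"
    by (auto simp: omega_square omega_mult_self algebra_simps)
  then show ?thesis by (simp add: Pair lface.simps)
qed

lemma ltri_lface [simp]: "ltri (lface \<delta>) = ltri \<delta>"
  by (simp add: ltri_eq)

lemma ctri_std: "z \<in> ctri (p, u) \<longleftrightarrow>
    (\<exists>a b. 0 \<le> a \<and> 0 \<le> b \<and> a + b \<le> 1 \<and> z = p + of_real a * u + of_real b * (omega * u))"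
  by (auto simp: ctri.simps convex_hull_3_alt scaleR_conv_of_real)

declare ltri.simps [simp del] ctri.simps [simp del]

text \<open>The lines on which \<open>xc\<close>, \<open>yc\<close> or \<open>xc + yc\<close> is an
  integer cut the plane into the lattice triangles. An upward triangle is given by one bound from
  each family, and a downward one by the reversed bounds.\<close>

lemma ctri_up: "z \<in> ctri (p, 1) \<longleftrightarrow> xc p \<le> xc z \<and> yc p \<le> yc z \<and> xc z + yc z \<le> xc p + yc p + 1"
proof
  assume *: "xc p \<le> xc z \<and> yc p \<le> yc z \<and> xc z + yc z \<le> xc p + yc p + 1"
  show "z \<in> ctri (p, 1)"
    unfolding ctri_std
    by (rule exI[of _ "xc z - xc p"], rule exI[of _ "yc z - yc p"]) (use * in \<open>auto simp: coord_eq_iff\<close>)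
qed (auto simp: ctri_std)

lemma ctri_down: "z \<in> ctri (p, -1) \<longleftrightarrow> xc z \<le> xc p \<and> yc z \<le> yc p \<and> xc p + yc p - 1 \<le> xc z + yc z"
proof
  assume *: "xc z \<le> xc p \<and> yc z \<le> yc p \<and> xc p + yc p - 1 \<le> xc z + yc z"
  show "z \<in> ctri (p, -1)"
    unfolding ctri_std
    by (rule exI[of _ "xc p - xc z"], rule exI[of _ "yc p - yc z"]) (use * in \<open>auto simp: coord_eq_iff\<close>)
qed (auto simp: ctri_std)

lemma interior_coord_ge:
  "interior {z. c \<le> xc z} = {z. c < xc z}" "interior {z. c \<le> yc z} = {z. c < yc z}"
  "interior {z. c \<le> xc z + yc z} = {z. c < xc z + yc z}"
  "interior {z. xc z \<le> c} = {z. xc z < c}" "interior {z. yc z \<le> c} = {z. yc z < c}"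
  "interior {z. xc z + yc z \<le> c} = {z. xc z + yc z < c}"
  unfolding xyc_inner
  unfolding xc_inner yc_inner
  by (simp_all add: interior_halfspace_ge[simplified] interior_halfspace_le[simplified] complex_eq_iff)

lemma ltri_up: "z \<in> ltri (p, 1) \<longleftrightarrow> xc p < xc z \<and> yc p < yc z \<and> xc z + yc z < xc p + yc p + 1"
proof -
  have "ctri (p, 1) = {z. xc p \<le> xc z} \<inter> {z. yc p \<le> yc z} \<inter> {z. xc z + yc z \<le> xc p + yc p + 1}"
    using ctri_up by blast
  then show ?thesis unfolding ltri_eq by (simp only: interior_Int interior_coord_ge) auto
qed

lemma ltri_down: "z \<in> ltri (p, -1) \<longleftrightarrow> xc z < xc p \<and> yc z < yc p \<and> xc p + yc p - 1 < xc z + yc z"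
proof -
  have "ctri (p, -1) = {z. xc z \<le> xc p} \<inter> {z. yc z \<le> yc p} \<inter> {z. xc p + yc p - 1 \<le> xc z + yc z}"
    using ctri_down by blast
  then show ?thesis unfolding ltri_eq by (simp only: interior_Int interior_coord_ge) auto
qed

text \<open>\<open>lface\<close> multiplies the direction by a primitive cube root of unity. So
  every dart shares its triangle with a dart of direction 1 or of direction -1, depending on the
  coset of the cube roots of unity in which its direction lies.\<close>

lemma ldarts_cases:
  assumes "\<delta> \<in> ldarts"
  obtains (up) m n where "\<delta> \<in> {(lat m n, 1), lface (lat m n, 1), lface (lface (lat m n, 1))}"
    | (down) m n where "\<delta> \<in> {(lat m n, -1), lface (lat m n, -1), lface (lface (lat m n, -1))}"
proof -
  obtain p u where d: "\<delta> = (p, u)" by (cases \<delta>)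
  have p: "p \<in> eisenstein" and u: "u \<in> eisenstein_units" using assms d by auto
  have *: "\<exists>m n. q = lat m n" if "q \<in> eisenstein" for q using that by (auto simp: eisenstein_lat)
  from u consider "u = 1" | "u = omega" | "u = omega - 1" | "u = -1" | "u = - omega" | "u = 1 - omega"
    by (auto simp: units_eq)
  then show ?thesis
  proof cases
    case 1
    then show ?thesis using up *[OF p] d by auto
  next
    case 2
    have "\<delta> = lface (lface (p + omega, -1))"
      using d 2 by (simp add: lface.simps omega_square omega_mult_self algebra_simps)
    moreover obtain m n where "p + omega = lat m n" using *[of "p + omega"] p by auto
    ultimately show ?thesis using down[of m n] by simp
  next
    case 3
    have "\<delta> = lface (p - 1, 1)"
      using d 3 by (simp add: lface.simps omega_square omega_mult_self algebra_simps)
    moreover obtain m n where "p - 1 = lat m n" using *[of "p - 1"] p by auto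
    ultimately show ?thesis using up[of m n] by simp
  next
    case 4
    then show ?thesis using down *[OF p] d by auto
  next
    case 5
    have "\<delta> = lface (lface (p - omega, 1))"
      using d 5 by (simp add: lface.simps omega_square omega_mult_self algebra_simps)
    moreover obtain m n where "p - omega = lat m n" using *[of "p - omega"] p by auto
    ultimately show ?thesis using up[of m n] by simp
  next
    case 6
    have "\<delta> = lface (p + 1, -1)"
      using d 6 by (simp add: lface.simps omega_square omega_mult_self algebra_simps)
    moreover obtain m n where "p + 1 = lat m n" using *[of "p + 1"] p by auto
    ultimately show ?thesis using down[of m n] by simp
  qed
qed

lemma ltri_no_lattice:
  assumes "\<delta> \<in> ldarts" "z \<in> ltri \<delta>" shows "z \<notin> eisenstein"
  using assms(1)
proof (cases rule: ldarts_cases)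
  case (up m n)
  then have "z \<in> ltri (lat m n, 1)" using assms by auto
  then show ?thesis by (auto simp: ltri_up eisenstein_iff elim!: Ints_cases; linarith)
next
  case (down m n)
  then have "z \<in> ltri (lat m n, -1)" using assms by auto
  then show ?thesis by (auto simp: ltri_down eisenstein_iff elim!: Ints_cases; linarith)
qed

lemma ltri_nonempty: assumes "\<delta> \<in> ldarts" shows "ltri \<delta> \<noteq> {}"
  using assms
proof (cases rule: ldarts_cases)
  case (up m n)
  have "lat m n + of_real (1/3) + of_real (1/3) * omega \<in> ltri (lat m n, 1)" by (simp add: ltri_up del: of_real_divide)
  then show ?thesis using up by auto
next
  case (down m n)
  have "lat m n - of_real (1/3) - of_real (1/3) * omega \<in> ltri (lat m n, -1)" by (simp add: ltri_down del: of_real_divide)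
  then show ?thesis using down by auto
qed

lemma closure_ltri: assumes "\<delta> \<in> ldarts" shows "closure (ltri \<delta>) = ctri \<delta>"
proof -
  have "closure (ctri \<delta>) = ctri \<delta>" by (simp add: compact_ctri compact_imp_closed)
  then show ?thesis
    using convex_closure_interior[OF convex_ctri[of \<delta>]] ltri_nonempty[OF assms] by (simp add: ltri_eq)
qed

lemma ltri_meets:
  assumes "\<delta> \<in> ldarts" "open R" "z \<in> ctri \<delta>" "z \<in> R" shows "ltri \<delta> \<inter> R \<noteq> {}"
  using open_Int_closure_eq_empty[OF assms(2), of "ltri \<delta>"] closure_ltri[OF assms(1)] assms by auto

section \<open>Covering and local finiteness of the closed triangles\<close>

lemma ctri_cover: "\<exists>\<delta>\<in>ldarts. z \<in> ctri \<delta>"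
proof (cases "xc z + yc z \<le> of_int (\<lfloor>xc z\<rfloor> + \<lfloor>yc z\<rfloor>) + 1")
  case True
  have "z \<in> ctri (lat \<lfloor>xc z\<rfloor> \<lfloor>yc z\<rfloor>, 1)" using True by (simp add: ctri_up)
  then show ?thesis by (rule bexI) (auto simp: eisenstein_lat)
next
  case False
  have "z \<in> ctri (lat (\<lfloor>xc z\<rfloor> + 1) (\<lfloor>yc z\<rfloor> + 1), -1)"
    using False by (auto simp: ctri_down; linarith)
  then show ?thesis by (rule bexI) (auto simp: eisenstein_lat)
qed

text \<open>\<open>e\<close> is the smaller of the distances to the next integer strictly above and
  strictly below, so it is positive even if \<open>x\<close> is an integer. A smaller change of
  \<open>x\<close> cannot turn a false nonstrict bound by an integer into a true one.\<close>

lemma near_integers: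
  fixes x :: real
  obtains e where "e > 0"
    "\<And>x' m. \<bar>x' - x\<bar> < e \<Longrightarrow> of_int m \<le> x' \<Longrightarrow> of_int m \<le> x"
    "\<And>x' m. \<bar>x' - x\<bar> < e \<Longrightarrow> x' \<le> of_int m \<Longrightarrow> x \<le> of_int m"
proof -
  define e where "e = min (of_int \<lfloor>x\<rfloor> + 1 - x) (x - (of_int \<lceil>x\<rceil> - 1))"
  have "e > 0" unfolding e_def by (simp add: min_def) linarith
  moreover have "of_int m \<le> x" if "\<bar>x' - x\<bar> < e" "of_int m \<le> x'" for x' m
  proof -
    have "of_int m < of_int \<lfloor>x\<rfloor> + (1::real)" using that unfolding e_def by linarith
    then have "m \<le> \<lfloor>x\<rfloor>" by linarith
    then show ?thesis by linarith
  qed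
  moreover have "x \<le> of_int m" if "\<bar>x' - x\<bar> < e" "x' \<le> of_int m" for x' m
  proof -
    have "of_int \<lceil>x\<rceil> - (1::real) < of_int m" using that unfolding e_def by linarith
    then have "\<lceil>x\<rceil> \<le> m" by linarith
    then show ?thesis by linarith
  qed
  ultimately show ?thesis using that by blast
qed

text \<open>Closed triangles are cut out by nonstrict integer bounds on \<open>xc\<close>,
  \<open>yc\<close> and \<open>xc + yc\<close>, so \<open>near_integers\<close> is applied to each
  of the three.\<close>

lemma ctri_locally_finite:
  obtains e where "e > 0" "\<And>\<delta> w. \<delta> \<in> ldarts \<Longrightarrow> w \<in> ctri \<delta> \<Longrightarrow> w \<in> ball z e \<Longrightarrow> z \<in> ctri \<delta>"
proof -
  obtain e1 where e1: "e1 > 0"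
    "\<And>x' m. \<bar>x' - xc z\<bar> < e1 \<Longrightarrow> of_int m \<le> x' \<Longrightarrow> of_int m \<le> xc z"
    "\<And>x' m. \<bar>x' - xc z\<bar> < e1 \<Longrightarrow> x' \<le> of_int m \<Longrightarrow> xc z \<le> of_int m"
    using near_integers by metis
  obtain e2 where e2: "e2 > 0"
    "\<And>x' m. \<bar>x' - yc z\<bar> < e2 \<Longrightarrow> of_int m \<le> x' \<Longrightarrow> of_int m \<le> yc z"
    "\<And>x' m. \<bar>x' - yc z\<bar> < e2 \<Longrightarrow> x' \<le> of_int m \<Longrightarrow> yc z \<le> of_int m"
    using near_integers by metis
  obtain e3 where e3: "e3 > 0"
    "\<And>x' m. \<bar>x' - (xc z + yc z)\<bar> < e3 \<Longrightarrow> of_int m \<le> x' \<Longrightarrow> of_int m \<le> xc z + yc z"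
    "\<And>x' m. \<bar>x' - (xc z + yc z)\<bar> < e3 \<Longrightarrow> x' \<le> of_int m \<Longrightarrow> xc z + yc z \<le> of_int m"
    using near_integers by metis
  \<comment> \<open>Halving pays for the factor 2 in \<open>abs_xc_le\<close> and its
    companions.\<close>
  define e where "e = min e1 (min e2 e3) / 2"
  have "e > 0" using e1 e2 e3 by (simp add: e_def)
  moreover have "z \<in> ctri \<delta>" if "\<delta> \<in> ldarts" "w \<in> ctri \<delta>" "w \<in> ball z e" for \<delta> w
  proof -
    have "norm (w - z) < e" using that by (simp add: dist_norm norm_minus_commute)
    then have d: "\<bar>xc w - xc z\<bar> < e1" "\<bar>yc w - yc z\<bar> < e2" "\<bar>(xc w + yc w) - (xc z + yc z)\<bar> < e3"
      using abs_xc_le[of "w - z"] abs_yc_le[of "w - z"] abs_xyc_le[of "w - z"] unfolding e_def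
      by (simp_all add: algebra_simps)
    from that(1) show ?thesis
    proof (cases rule: ldarts_cases)
      case (up m n)
      then have w: "w \<in> ctri (lat m n, 1)" and eq: "ctri \<delta> = ctri (lat m n, 1)" using that by auto
      show ?thesis unfolding eq using w e1(2)[OF d(1), of m] e2(2)[OF d(2), of n] e3(3)[OF d(3), of "m + n + 1"]
        by (simp add: ctri_up)
    next
      case (down m n)
      then have w: "w \<in> ctri (lat m n, -1)" and eq: "ctri \<delta> = ctri (lat m n, -1)" using that by auto
      show ?thesis unfolding eq using w e1(3)[OF d(1), of m] e2(3)[OF d(2), of n] e3(2)[OF d(3), of "m + n - 1"]
        by (simp add: ctri_down)
    qed
  qed
  ultimately show ?thesis using that by blast
qed

lemma ledge_iff: "z \<in> ledge (p, u) \<longleftrightarrow> u \<noteq> 0 \<and> (\<exists>t. 0 < t \<and> t < 1 \<and> z = p + of_real t * u)"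
  by (auto simp: in_segment scaleR_conv_of_real algebra_simps)

lemma ledge_lopp [simp]: "ledge (lopp \<delta>) = ledge \<delta>"
  by (cases \<delta>) (simp add: open_segment_commute)

lemma ledge_subset_ctri: "ledge \<delta> \<subseteq> ctri \<delta>" "ledge \<delta> \<subseteq> ctri (lopp \<delta>)"
proof -
  have *: "ledge \<epsilon> \<subseteq> ctri \<epsilon>" for \<epsilon>
  proof
    fix z assume z: "z \<in> ledge \<epsilon>"
    obtain p u where e: "\<epsilon> = (p, u)" by (cases \<epsilon>)
    from z obtain t where "0 < t" "t < 1" "z = p + of_real t * u" unfolding e ledge_iff by blast
    then show "z \<in> ctri \<epsilon>" unfolding e ctri_std by (intro exI[of _ t] exI[of _ 0]) auto
  qed
  then show "ledge \<delta> \<subseteq> ctri \<delta>" "ledge \<delta> \<subseteq> ctri (lopp \<delta>)" using *[of "lopp \<delta>"] by auto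
qed

section \<open>Connecting lattice triangles\<close>

text \<open>It is the open edge that must meet \<open>R\<close>, so no step passes through a lattice
  point. With \<open>R = {z}\<close> only edges through \<open>z\<close> are crossed.\<close>

definition adj :: "complex set \<Rightarrow> (ldart \<times> ldart) set" where
  "adj R = {(a, b). a \<in> ldarts \<and> (b = lface a \<or> (b = lopp a \<and> ledge a \<inter> R \<noteq> {}))}"

lemma adj_mono: "R \<subseteq> S \<Longrightarrow> (adj R)\<^sup>* \<subseteq> (adj S)\<^sup>*"
  by (rule rtrancl_mono) (auto simp: adj_def)

lemma adj_lface: "a \<in> ldarts \<Longrightarrow> (a, lface a) \<in> (adj R)\<^sup>*" "a \<in> ldarts \<Longrightarrow> (lface a, a) \<in> (adj R)\<^sup>*"
proof -
  assume a: "a \<in> ldarts"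
  have s: "(x, lface x) \<in> adj R" if "x \<in> ldarts" for x using that by (simp add: adj_def)
  show "(a, lface a) \<in> (adj R)\<^sup>*" using s[OF a] by blast
  show "(lface a, a) \<in> (adj R)\<^sup>*"
    using s[of "lface a"] s[of "lface (lface a)"] a by (metis lface_3 lface_ldarts converse_rtrancl_into_rtrancl rtrancl.rtrancl_refl)
qed

lemma adj_lopp: "a \<in> ldarts \<Longrightarrow> z \<in> ledge a \<Longrightarrow> z \<in> R \<Longrightarrow> (a, lopp a) \<in> (adj R)\<^sup>*"
  by (rule r_into_rtrancl) (auto simp: adj_def)

lemma adj_sym: "(a, b) \<in> (adj R)\<^sup>* \<Longrightarrow> (b, a) \<in> (adj R)\<^sup>*"
proof (induction rule: rtrancl_induct)
  case (step y z)
  have y: "y \<in> ldarts" using step by (auto simp: adj_def)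
  have "(z, y) \<in> (adj R)\<^sup>*"
  proof (cases "z = lface y")
    case True then show ?thesis using adj_lface y by simp
  next
    case False
    then have "z = lopp y" "ledge y \<inter> R \<noteq> {}" using step by (auto simp: adj_def)
    then have "(z, y) \<in> adj R" using y by (auto simp: adj_def)
    then show ?thesis by blast
  qed
  then show ?case using step by (meson rtrancl_trans)
qed simp

lemma adj_rep:
  assumes "p \<in> eisenstein" "u \<in> eisenstein_units" "\<delta> \<in> {(p, u), lface (p, u), lface (lface (p, u))}"
  shows "((p, u), \<delta>) \<in> (adj R)\<^sup>*" "(\<delta>, (p, u)) \<in> (adj R)\<^sup>*"
proof -
  have d: "(p, u) \<in> ldarts" using assms by simp
  have 1: "((p, u), lface (p, u)) \<in> (adj R)\<^sup>*" by (rule adj_lface[OF d])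
  have 2: "((p, u), lface (lface (p, u))) \<in> (adj R)\<^sup>*"
    by (rule rtrancl_trans[OF 1 adj_lface(1)]) (use d lface_ldarts in blast)
  show *: "((p, u), \<delta>) \<in> (adj R)\<^sup>*" using assms(3) 1 2 by blast
  show "(\<delta>, (p, u)) \<in> (adj R)\<^sup>*" by (rule adj_sym[OF *])
qed

lemma up_down_adj:
  assumes z: "z \<notin> eisenstein" "z \<in> ctri (lat m n, 1)" "z \<in> ctri (lat m' n', -1)"
  shows "((lat m n, 1), (lat m' n', -1)) \<in> (adj {z})\<^sup>*"
proof -
  define p where "p = lat m n"
  have p: "p \<in> eisenstein" by (auto simp: p_def eisenstein_lat)
  have xp: "xc p = m" "yc p = n" by (simp_all add: p_def)
  have c: "of_int m \<le> xc z" "of_int n \<le> yc z" "xc z + yc z \<le> of_int m + of_int n + 1"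
    "xc z \<le> of_int m'" "yc z \<le> of_int n'" "of_int m' + of_int n' - 1 \<le> xc z + yc z"
    using z(2,3) by (auto simp: ctri_up ctri_down)
  have nz: "xc z = of_int i \<Longrightarrow> yc z = of_int j \<Longrightarrow> False" for i j
    using z(1) by (simp add: eisenstein_iff)
  have "of_int m \<le> (of_int m'::real)" "of_int n \<le> (of_int n'::real)"
    "of_int m' + of_int n' \<le> (of_int m + of_int n + 2 :: real)" using c by linarith+
  then have "m \<le> m'" "n \<le> n'" "m' + n' \<le> m + n + 2" by linarith+
  \<comment> \<open>Six relative positions satisfy the bounds. In three of them the triangles share
    only a vertex, which would have to be \<open>z\<close>; in the other three they share an
    edge.\<close>
  then have "(m', n') \<in> {(m,n),(m,n+1),(m,n+2),(m+1,n),(m+1,n+1),(m+2,n)}" by simp presburger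
  moreover have "(m', n') \<noteq> (m,n)" using nz[of m n] c by auto
  moreover have "(m', n') \<noteq> (m,n+2)" using nz[of m "n+1"] c by auto
  moreover have "(m', n') \<noteq> (m+2,n)" using nz[of "m+1" n] c by auto
  ultimately consider "m' = m" "n' = n + 1" | "m' = m + 1" "n' = n" | "m' = m + 1" "n' = n + 1" by auto
  then show ?thesis
  proof cases
    case 1
    have x: "xc z = of_int m" using c 1 by auto
    have y: "of_int n < yc z" "yc z < of_int n + 1" using nz[of m n] nz[of m "n+1"] c x 1 by fastforce+
    have q: "(lat m' n', -1) = (p + omega, -1)" using 1 by (simp add: p_def lat_def algebra_simps)
    have "z \<in> ledge (p, omega)"
      unfolding ledge_iff by (intro conjI exI[of _ "yc z - of_int n"]) (use x y in \<open>auto simp: coord_eq_iff xp\<close>)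
    then have "(lopp (p, omega), (p, omega)) \<in> (adj {z})\<^sup>*" using adj_lopp[of "(p, omega)" z "{z}"] adj_sym p by auto
    moreover have "lopp (p, omega) = lface (lface (p, 1))" by (simp add: lface_2)
    moreover have "lface (lface (p + omega, -1)) = (p, omega)" by (simp add: lface_2)
    moreover have "((p, 1), lface (lface (p, 1))) \<in> (adj {z})\<^sup>*" using adj_rep(1) p by blast
    moreover have "(lface (lface (p + omega, -1)), (p + omega, -1)) \<in> (adj {z})\<^sup>*"
      using adj_rep(2)[of "p + omega" "-1" "lface (lface (p + omega, -1))"] p by blast
    ultimately show ?thesis unfolding q p_def[symmetric] by (metis rtrancl_trans)
  next
    case 2
    have y: "yc z = of_int n" using c 2 by auto
    have x: "of_int m < xc z" "xc z < of_int m + 1" using nz[of m n] nz[of "m+1" n] c y 2 by fastforce+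
    have q: "(lat m' n', -1) = lopp (p, 1)" using 2 by (simp add: p_def lat_def algebra_simps)
    have "z \<in> ledge (p, 1)"
      unfolding ledge_iff by (intro conjI exI[of _ "xc z - of_int m"]) (use x y in \<open>auto simp: coord_eq_iff xp\<close>)
    then show ?thesis unfolding q p_def[symmetric] using adj_lopp[of "(p, 1)" z "{z}"] p by auto
  next
    case 3
    have y: "xc z + yc z = of_int m + of_int n + 1" using c 3 by auto
    have "yc z \<noteq> of_int n" using nz[of "m+1" n] y by auto
    moreover have "yc z \<noteq> of_int n + 1" using nz[of m "n+1"] y by auto
    ultimately have x: "of_int n < yc z" "yc z < of_int n + 1" using c 3 by auto
    have q: "(lat m' n', -1) = (p + 1 + omega, -1)" using 3 by (simp add: p_def lat_def algebra_simps)
    have om: "omega - 1 \<noteq> 0" using units_neq_0[of "omega - 1"] by (simp add: units_eq)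
    have "z \<in> ledge (p + 1, omega - 1)"
      unfolding ledge_iff using om by (intro conjI exI[of _ "yc z - of_int n"]) (use x y in \<open>auto simp: coord_eq_iff xp algebra_simps\<close>)
    then have "z \<in> ledge (lface (p, 1))" by (simp add: lface.simps omega_square)
    then have "(lface (p, 1), lopp (lface (p, 1))) \<in> (adj {z})\<^sup>*"
      using adj_lopp[of "lface (p, 1)" z "{z}"] p by simp
    moreover have "lopp (lface (p, 1)) = lface (p + 1 + omega, -1)" by (simp add: lface.simps omega_square)
    moreover have "((p, 1), lface (p, 1)) \<in> (adj {z})\<^sup>*" using adj_rep(1) p by blast
    moreover have "(lface (p + 1 + omega, -1), (p + 1 + omega, -1)) \<in> (adj {z})\<^sup>*"
      using adj_rep(2)[of "p + 1 + omega" "-1" "lface (p + 1 + omega, -1)"] p by blast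
    ultimately show ?thesis unfolding q p_def[symmetric] by (metis rtrancl_trans)
  qed
qed

text \<open>Distinct triangles of the same orientation meet at most in a lattice point. The
  formulation with real numbers lets downward triangles be treated by a change of sign.\<close>

lemma cell_unique:
  fixes m n m' n' :: int and x y :: real
  assumes c: "of_int m \<le> x" "of_int n \<le> y" "x + y \<le> of_int m + of_int n + 1"
    "of_int m' \<le> x" "of_int n' \<le> y" "x + y \<le> of_int m' + of_int n' + 1"
    and nz: "\<And>i j. x = of_int i \<Longrightarrow> y = of_int j \<Longrightarrow> False"
  shows "m = m' \<and> n = n'"
proof -
  have *: "\<not> i < i' \<and> \<not> j < j'"
    if h: "of_int i \<le> x" "of_int j \<le> y" "x + y \<le> of_int i + of_int j + 1" "of_int i' \<le> x" "of_int j' \<le> y"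
    for i j i' j' :: int
  proof (intro conjI notI)
    assume "i < i'"
    then have "of_int i + 1 \<le> (of_int i' :: real)" by linarith
    then have "x = of_int i'" "y = of_int j" using h by linarith+
    then show False by (rule nz)
  next
    assume "j < j'"
    then have "of_int j + 1 \<le> (of_int j' :: real)" by linarith
    then have "x = of_int i" "y = of_int j'" using h by linarith+
    then show False by (rule nz)
  qed
  show ?thesis using *[of m n m' n'] *[of m' n' m n] c by linarith
qed

lemma nonlattice_adj:
  assumes z: "z \<notin> eisenstein" "z \<in> ctri \<delta>" "z \<in> ctri \<delta>'" and d: "\<delta> \<in> ldarts" "\<delta>' \<in> ldarts"
  shows "(\<delta>, \<delta>') \<in> (adj {z})\<^sup>*"
proof -
  have nz: "xc z = of_int i \<Longrightarrow> yc z = of_int j \<Longrightarrow> False" for i j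
    using z(1) by (simp add: eisenstein_iff)
  have rep: "\<exists>m n. \<exists>u\<in>{1, - 1}. z \<in> ctri (lat m n, u) \<and>
      (\<epsilon>, (lat m n, u)) \<in> (adj {z})\<^sup>* \<and> ((lat m n, u), \<epsilon>) \<in> (adj {z})\<^sup>*"
    if e: "\<epsilon> \<in> ldarts" "z \<in> ctri \<epsilon>" for \<epsilon>
  proof -
    obtain m n and u :: complex where mn: "u \<in> {1, - 1}" "\<epsilon> \<in> {(lat m n, u), lface (lat m n, u), lface (lface (lat m n, u))}"
      using ldarts_cases[OF e(1)] by (metis insertI1 insertI2)
    have "lat m n \<in> eisenstein" "u \<in> eisenstein_units" "z \<in> ctri (lat m n, u)"
      using mn e(2) by (auto simp: eisenstein_lat)
    then show ?thesis using adj_rep[OF _ _ mn(2)] mn(1) by blast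
  qed
  obtain m n u where 1: "u \<in> {1, - 1}" "z \<in> ctri (lat m n, u)" "(\<delta>, (lat m n, u)) \<in> (adj {z})\<^sup>*"
    using rep[OF d(1) z(2)] by blast
  obtain m' n' u' where 2: "u' \<in> {1, - 1}" "z \<in> ctri (lat m' n', u')" "((lat m' n', u'), \<delta>') \<in> (adj {z})\<^sup>*"
    using rep[OF d(2) z(3)] by blast
  consider "u = 1" "u' = 1" | "u = 1" "u' = - 1" | "u = - 1" "u' = 1" | "u = - 1" "u' = - 1" using 1 2 by auto
  then have "((lat m n, u), (lat m' n', u')) \<in> (adj {z})\<^sup>*"
  proof cases
    case 1
    have "m = m' \<and> n = n'"
      by (rule cell_unique[of m "xc z" n "yc z"])
        (use nz \<open>z \<in> ctri (lat m n, u)\<close> 2(2) 1 in \<open>auto simp: ctri_up\<close>)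
    then show ?thesis using 1 by simp
  next
    case 2
    then show ?thesis using up_down_adj[OF z(1)] 1(2) \<open>z \<in> ctri (lat m' n', u')\<close> by simp
  next
    case 3
    then show ?thesis using adj_sym[OF up_down_adj[OF z(1)]] 1(2) 2(2) by simp
  next
    case 4
    have nz': "- xc z = of_int i \<Longrightarrow> - yc z = of_int j \<Longrightarrow> False" for i j using nz[of "- i" "- j"] by auto
    have "- m = - m' \<and> - n = - n'"
      by (rule cell_unique[of "- m" "- xc z" "- n" "- yc z"])
        (use nz' 1(2) 2(2) 4 in \<open>auto simp: ctri_down\<close>)
    then show ?thesis using 4 by simp
  qed
  then show ?thesis using 1(3) 2(3) by (meson rtrancl_trans)
qed

text \<open>Removing the countable lattice leaves a connected open set of the plane connected. On
  what remains, lying in a triangle reachable from \<open>\<delta>\<close> is locally constant, by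
  \<open>ctri_locally_finite\<close> and \<open>nonlattice_adj\<close>, so it passes from
  \<open>a\<close> to \<open>b\<close>.\<close>

lemma adj_convex:
  assumes R: "open R" "convex R" and d: "\<delta> \<in> ldarts" "\<delta>' \<in> ldarts"
    and meet: "ltri \<delta> \<inter> R \<noteq> {}" "ltri \<delta>' \<inter> R \<noteq> {}"
  shows "(\<delta>, \<delta>') \<in> (adj R)\<^sup>*"
proof -
  obtain a where a: "a \<in> ltri \<delta>" "a \<in> R" using meet by auto
  obtain b where b: "b \<in> ltri \<delta>'" "b \<in> R" using meet by auto
  have ab: "a \<notin> eisenstein" "b \<notin> eisenstein" using ltri_no_lattice a b d by auto
  define P where "P z \<longleftrightarrow> (\<exists>\<epsilon>\<in>ldarts. z \<in> ctri \<epsilon> \<and> (\<delta>, \<epsilon>) \<in> (adj R)\<^sup>*)" for z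
  have all: "(\<delta>, \<epsilon>) \<in> (adj R)\<^sup>*"
    if z: "z \<in> R" "z \<notin> eisenstein" "P z" and e: "\<epsilon> \<in> ldarts" "z \<in> ctri \<epsilon>" for z \<epsilon>
  proof -
    obtain \<epsilon>' where e': "\<epsilon>' \<in> ldarts" "z \<in> ctri \<epsilon>'" "(\<delta>, \<epsilon>') \<in> (adj R)\<^sup>*" using z(3) P_def by auto
    have "(\<epsilon>', \<epsilon>) \<in> (adj {z})\<^sup>*" using nonlattice_adj[OF z(2) e'(2) e(2) e'(1) e(1)] .
    moreover have "(adj {z})\<^sup>* \<subseteq> (adj R)\<^sup>*" using z by (intro adj_mono) auto
    ultimately show ?thesis using e' by (meson rtrancl_trans subsetD)
  qed
  have "connected (R - eisenstein)"
    using path_connected_open_diff_countable[of R eisenstein] R countable_eisenstein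
    by (auto simp: convex_connected path_connected_imp_connected)
  moreover have "a \<in> R - eisenstein" "b \<in> R - eisenstein" using a b ab by auto
  moreover have "P a" unfolding P_def using a d ltri_subset by blast
  ultimately have "P b"
  proof (rule connected_induction_simple)
    fix z assume z: "z \<in> R - eisenstein"
    obtain e where e: "e > 0" "\<And>\<epsilon> w. \<epsilon> \<in> ldarts \<Longrightarrow> w \<in> ctri \<epsilon> \<Longrightarrow> w \<in> ball z e \<Longrightarrow> z \<in> ctri \<epsilon>"
      using ctri_locally_finite by blast
    define U where "U = (R - eisenstein) \<inter> ball z e"
    have Pz: "P w \<longleftrightarrow> P z" if w: "w \<in> U" for w
    proof
      assume "P w"
      then show "P z" using e(2) w unfolding P_def U_def by blast
    next
      assume pz: "P z"
      obtain \<epsilon> where eps: "\<epsilon> \<in> ldarts" "w \<in> ctri \<epsilon>" using ctri_cover by blast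
      then have "z \<in> ctri \<epsilon>" using e(2) w U_def by blast
      then have "(\<delta>, \<epsilon>) \<in> (adj R)\<^sup>*" using all[of z \<epsilon>] z pz eps by blast
      then show "P w" using eps P_def by blast
    qed
    have "openin (top_of_set (R - eisenstein)) U" unfolding U_def by (simp add: openin_open_Int)
    moreover have "z \<in> U" using z e by (simp add: U_def)
    ultimately show "\<exists>T. openin (top_of_set (R - eisenstein)) T \<and> z \<in> T \<and> (\<forall>x\<in>T. \<forall>y\<in>T. P x \<longrightarrow> P y)"
      using Pz by blast
  qed
  then show ?thesis using all[of b \<delta>'] b ab d ltri_subset by blast
qed

lemma adj_meets:
  assumes "(a, b) \<in> adj R" "open R" "ltri a \<inter> R \<noteq> {}"
  shows "b \<in> ldarts" "ltri b \<inter> R \<noteq> {}"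
proof -
  have "a \<in> ldarts" using assms by (simp add: adj_def)
  then show "b \<in> ldarts" using assms by (auto simp: adj_def)
  show "ltri b \<inter> R \<noteq> {}"
  proof (cases "b = lface a")
    case True then show ?thesis using assms by simp
  next
    case False
    then obtain z where "b = lopp a" "z \<in> ledge a" "z \<in> R" using assms by (auto simp: adj_def)
    then show ?thesis using ltri_meets[of b R z] \<open>b \<in> ldarts\<close> assms ledge_subset_ctri by blast
  qed
qed

section \<open>Orbits of permutations\<close>

lemma permutes_in_orbit:
  assumes "p permutes A" "finite A" shows "x \<in> orbit p x"
proof -
  have "permutation p" using assms unfolding permutation_permutes by blast
  then show ?thesis by (rule permutation_self_in_orbit)
qed

lemma permutes_orbit_eq:
  assumes "p permutes A" "finite A" "y \<in> orbit p x" shows "orbit p y = orbit p x"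
proof (rule orbit_cyclic_eq3[OF _ assms(3)])
  show "cyclic_on p (orbit p x)"
    using permutes_in_orbit[OF assms(1,2)] by (auto simp: cyclic_on_def)
qed

lemma orbit_card_funpow:
  assumes "p permutes A" "finite A"
  shows "(p ^^ card (orbit p x)) x = x" "0 < j \<Longrightarrow> j < card (orbit p x) \<Longrightarrow> (p ^^ j) x \<noteq> x" "card (orbit p x) > 0"
proof -
  have x: "x \<in> orbit p x" using permutes_in_orbit assms by metis
  have "card (orbit p x) = funpow_dist1 p x x"
    by (subst orbit_conv_funpow_dist1[OF x]) (simp add: card_image[OF inj_on_funpow_dist1[OF x]])
  then show "(p ^^ card (orbit p x)) x = x" "0 < j \<Longrightarrow> j < card (orbit p x) \<Longrightarrow> (p ^^ j) x \<noteq> x" "card (orbit p x) > 0"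
    using funpow_dist1_prop[OF x] funpow_dist1_least by (metis, metis, simp)
qed

lemma card_orbit_eqI:
  assumes "(p ^^ n) x = x" "0 < n" "\<And>j. 0 < j \<Longrightarrow> j < n \<Longrightarrow> (p ^^ j) x \<noteq> x"
  shows "card (orbit p x) = n"
proof -
  have x: "x \<in> orbit p x" using assms by (metis (mono_tags, lifting) mem_Collect_eq orbit_altdef)
  have "funpow_dist1 p x x = n"
    using funpow_dist1_prop[OF x] funpow_dist1_least[of _ p x x] assms by (metis linorder_neqE_nat zero_less_Suc)
  then show ?thesis
    using orbit_conv_funpow_dist1[OF x] card_image[OF inj_on_funpow_dist1[OF x]] by simp
qed

section \<open>Triangulations as combinatorial maps\<close>

locale triangulation =
  fixes T :: "'d cmap"
  assumes comb: "combinatorial_map T"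
    and face_3: "\<And>d. d \<in> darts T \<Longrightarrow> face T (face T (face T d)) = d"
begin

lemma finite_darts: "finite (darts T)" and opp_permutes: "opp T permutes darts T"
  and rot_permutes: "rot T permutes darts T"
  using comb by (auto simp: combinatorial_map_def)

lemma opp_in [simp, intro]: "d \<in> darts T \<Longrightarrow> opp T d \<in> darts T"
  and rot_in [simp, intro]: "d \<in> darts T \<Longrightarrow> rot T d \<in> darts T"
  using opp_permutes rot_permutes by (simp_all add: permutes_in_image)

lemma rot_pow_in [simp, intro]: "d \<in> darts T \<Longrightarrow> (rot T ^^ k) d \<in> darts T"
  by (induction k) auto

lemma face_in [simp, intro]: "d \<in> darts T \<Longrightarrow> face T d \<in> darts T"
  unfolding face_def using opp_in permutes_inv[OF rot_permutes] permutes_in_image by metis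

lemma opp_opp [simp]: "d \<in> darts T \<Longrightarrow> opp T (opp T d) = d"
  using comb by (auto simp: combinatorial_map_def)

lemma rot_face [simp]: "rot T (face T d) = opp T d"
  by (simp add: face_def permutes_inverses[OF rot_permutes])

lemma face_opp_rot: "d \<in> darts T \<Longrightarrow> face T (opp T (rot T d)) = d"
  by (simp add: face_def permutes_inverses[OF rot_permutes])

lemma opp_rot: "d \<in> darts T \<Longrightarrow> opp T (rot T d) = face T (face T d)"
  by (metis face_3 face_opp_rot opp_in rot_in)

lemma opp_face_face: "d \<in> darts T \<Longrightarrow> opp T (face T (face T d)) = rot T d"
  by (metis opp_rot opp_opp rot_in)

lemma face_inj: "d \<in> darts T \<Longrightarrow> e \<in> darts T \<Longrightarrow> face T d = face T e \<longleftrightarrow> d = e"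
  by (metis face_3)

end

section \<open>Developing a triangulation around a point of the lattice plane\<close>

text \<open>
  \<open>((\<delta>, e), (\<delta>', e')) \<in> link T t\<close>: if \<open>\<delta>\<close> is labelled by \<open>e\<close>, then unfolding \<open>T\<close> within the closed lattice
  triangles that contain \<open>t\<close> can label \<open>\<delta>'\<close> by \<open>e'\<close>. Around a pentagon \<open>e'\<close> depends on the path.
\<close>

definition lstep :: "'d cmap \<Rightarrow> complex \<Rightarrow> ((ldart \<times> 'd) \<times> (ldart \<times> 'd)) set" where
  "lstep T t = {((\<delta>, e), (\<delta>', e')). \<delta> \<in> ldarts \<and> e \<in> darts T \<and> t \<in> ctri \<delta> \<and>
     ((\<delta>' = lface \<delta> \<and> e' = face T e) \<or> (t \<in> ctri (lopp \<delta>) \<and> \<delta>' = lopp \<delta> \<and> e' = opp T e))}"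

definition link :: "'d cmap \<Rightarrow> complex \<Rightarrow> ((ldart \<times> 'd) \<times> (ldart \<times> 'd)) set" where
  "link T t = (lstep T t)\<^sup>*"

text \<open>A path of triangles through \<open>R\<close> then never leaves the star of
  \<open>t\<close>, i.e. the closed triangles that contain \<open>t\<close>.\<close>

definition near :: "complex \<Rightarrow> complex set \<Rightarrow> bool" where
  "near t R \<longleftrightarrow> (\<forall>\<delta>\<in>ldarts. \<forall>w\<in>R. w \<in> ctri \<delta> \<longrightarrow> t \<in> ctri \<delta>)"

lemma near_ball: obtains e where "e > 0" "near t (ball t e)"
  using ctri_locally_finite[of t] unfolding near_def by metis

lemma near_subset: "near t R \<Longrightarrow> S \<subseteq> R \<Longrightarrow> near t S"
  by (auto simp: near_def)

text \<open>In coordinates relative to the dart, the height over the edge is nonnegative on one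
  triangle and nonpositive on the other.\<close>

lemma closed_edge:
  assumes "t \<in> ctri (p, u)" "t \<in> ctri (lopp (p, u))" "u \<noteq> 0"
  obtains a where "0 \<le> a" "a \<le> 1" "t = p + of_real a * u"
proof -
  obtain a b where ab: "0 \<le> a" "0 \<le> b" "a + b \<le> 1" "t = p + of_real a * u + of_real b * (omega * u)"
    using assms(1) unfolding ctri_std by blast
  obtain a' b' where ab': "0 \<le> a'" "0 \<le> b'" "a' + b' \<le> 1"
    "t = p + u + of_real a' * (- u) + of_real b' * (omega * (- u))"
    using assms(2) unfolding lopp.simps ctri_std by blast
  have "(of_real a + of_real b * omega) * u = (1 - of_real a' - of_real b' * omega) * u"
    using ab(4) ab'(4) by (simp add: algebra_simps)
  then have "of_real a + of_real b * omega = 1 - of_real a' - of_real b' * omega"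
    using assms(3) mult_right_cancel by blast
  then have "yc (of_real a + of_real b * omega) = yc (1 - of_real a' - of_real b' * omega)" by simp
  then have "b = - b'" by simp
  then show ?thesis using that ab ab' by auto
qed

text \<open>Relative to the dart the coordinates of \<open>t\<close> are nonnegative integers with
  sum at most 1, so \<open>t\<close> is a corner; \<open>lface\<close> turns the triangle until this
  corner is the origin.\<close>

lemma star_lattice:
  assumes t: "t \<in> eisenstein" and d: "\<delta> \<in> ldarts" "t \<in> ctri \<delta>"
  obtains u where "u \<in> eisenstein_units" "\<delta> \<in> {(t, u), lface (t, u), lface (lface (t, u))}"
proof -
  obtain p u where pu: "\<delta> = (p, u)" by (cases \<delta>)
  have u: "u \<in> eisenstein_units" and p: "p \<in> eisenstein" using d pu by auto
  obtain a b where ab: "0 \<le> a" "0 \<le> b" "a + b \<le> 1" "t = p + of_real a * u + of_real b * (omega * u)"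
    using d(2) unfolding pu ctri_std by blast
  have "of_real a + of_real b * omega = (t - p) * inverse u"
    using ab(4) units_neq_0[OF u] by (simp add: field_simps)
  also have "\<dots> \<in> eisenstein" using t p u by blast
  finally have "a \<in> \<int>" "b \<in> \<int>" by (simp_all add: eisenstein_iff)
  then obtain i j where ij: "a = of_int i" "b = of_int j" by (auto elim!: Ints_cases)
  have "0 \<le> i" "0 \<le> j" "i + j \<le> 1" using ab(1-3) unfolding ij by linarith+
  then have "(i, j) = (0, 0) \<or> (i, j) = (1, 0) \<or> (i, j) = (0, 1)" by auto
  then consider "t = p" | "t = p + u" | "t = p + omega * u" using ab(4) ij by auto
  then show ?thesis
  proof cases
    case 1 then show ?thesis using that[of u] u pu by auto
  next
    case 2
    then have "lface \<delta> = (t, omega\<^sup>2 * u)" by (simp add: pu lface.simps)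
    then have "\<delta> = lface (lface (t, omega\<^sup>2 * u))" by (metis lface_3)
    then show ?thesis using that[of "omega\<^sup>2 * u"] u by auto
  next
    case 3
    then have "lface (lface \<delta>) = (t, - omega * u)" by (simp add: pu lface_2)
    then have "\<delta> = lface (t, - omega * u)" by (metis lface_3)
    then show ?thesis using that[of "- omega * u"] u by auto
  qed
qed

lemma lface_neq: assumes "\<delta> \<in> ldarts" shows "lface \<delta> \<noteq> \<delta>" "lface (lface \<delta>) \<noteq> \<delta>"
  using assms units_neq_0 by (cases \<delta>; auto simp: lface.simps; fail)
    (cases \<delta>; use assms units_neq_0 in \<open>auto simp: lface_2\<close>)

section \<open>Links at a point: path lifting, holonomy, uniqueness\<close>

context triangulation
begin

lemma link_refl [simp, intro]: "(x, x) \<in> link T t"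
  by (simp add: link_def)

lemma link_trans: "(x, y) \<in> link T t \<Longrightarrow> (y, z) \<in> link T t \<Longrightarrow> (x, z) \<in> link T t"
  by (simp add: link_def)

lemma lstep_closed:
  assumes "((\<delta>, e), (\<delta>', e')) \<in> lstep T t" shows "\<delta>' \<in> ldarts" "e' \<in> darts T" "t \<in> ctri \<delta>'"
  using assms by (auto simp: lstep_def)

lemma link_closed:
  assumes "((\<delta>, e), (\<delta>', e')) \<in> link T t" "\<delta> \<in> ldarts" "e \<in> darts T" "t \<in> ctri \<delta>"
  shows "\<delta>' \<in> ldarts \<and> e' \<in> darts T \<and> t \<in> ctri \<delta>'"
  using assms(1) unfolding link_def
proof (cases rule: rtranclE)
  case (step y)
  then show ?thesis by (cases y) (auto dest: lstep_closed)
qed (use assms in auto)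

lemma link_face:
  assumes "\<delta> \<in> ldarts" "e \<in> darts T" "t \<in> ctri \<delta>"
  shows "((\<delta>, e), (lface \<delta>, face T e)) \<in> link T t" "((lface \<delta>, face T e), (\<delta>, e)) \<in> link T t"
proof -
  have s: "((\<delta>, e), (lface \<delta>, face T e)) \<in> link T t"
    if "\<delta> \<in> ldarts" "e \<in> darts T" "t \<in> ctri \<delta>" for \<delta> e
    unfolding link_def by (rule r_into_rtrancl) (use that in \<open>simp add: lstep_def\<close>)
  show "((\<delta>, e), (lface \<delta>, face T e)) \<in> link T t" using s assms .
  show "((lface \<delta>, face T e), (\<delta>, e)) \<in> link T t"
    using s[of "lface \<delta>" "face T e"] s[of "lface (lface \<delta>)" "face T (face T e)"] assms
    by (simp add: face_3) (metis link_trans)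
qed

lemma link_opp:
  assumes "\<delta> \<in> ldarts" "e \<in> darts T" "t \<in> ctri \<delta>" "t \<in> ctri (lopp \<delta>)"
  shows "((\<delta>, e), (lopp \<delta>, opp T e)) \<in> link T t"
  unfolding link_def by (rule r_into_rtrancl) (use assms in \<open>simp add: lstep_def\<close>)

lemma link_sym: "(x, y) \<in> link T t \<Longrightarrow> (y, x) \<in> link T t"
  unfolding link_def
proof (induction rule: rtrancl_induct)
  case (step y z)
  obtain \<delta> e \<delta>' e' where yz: "y = (\<delta>, e)" "z = (\<delta>', e')" by (cases y, cases z) auto
  have s: "((\<delta>, e), (\<delta>', e')) \<in> lstep T t" using step yz by simp
  have "((\<delta>', e'), (\<delta>, e)) \<in> link T t"
  proof (cases "\<delta>' = lface \<delta> \<and> e' = face T e")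
    case True
    then show ?thesis using link_face(2) s by (auto simp: lstep_def)
  next
    case False
    then have *: "\<delta>' = lopp \<delta>" "e' = opp T e" "t \<in> ctri \<delta>" "t \<in> ctri (lopp \<delta>)" "\<delta> \<in> ldarts" "e \<in> darts T"
      using s by (auto simp: lstep_def)
    then show ?thesis using link_opp[of "lopp \<delta>" "opp T e" t] by simp
  qed
  then have "(z, y) \<in> (lstep T t)\<^sup>*" by (simp add: yz link_def)
  then show ?case using step(3) by (rule rtrancl_trans)
qed simp

lemma lstep_near:
  assumes "near t {t'}" shows "lstep T t' \<subseteq> lstep T t"
  using assms by (auto simp: lstep_def near_def)

lemma link_near:
  assumes "near t {t'}" "x \<in> link T t'" shows "x \<in> link T t"
  using assms rtrancl_mono[OF lstep_near] unfolding link_def by blast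

text \<open>Path lifting: as no step leaves the star of \<open>t\<close>, the label is simply
  carried along.\<close>

lemma link_lift:
  assumes "(\<delta>, \<delta>') \<in> (adj R)\<^sup>*" "near t R" "\<delta> \<in> ldarts" "t \<in> ctri \<delta>" "e \<in> darts T"
  shows "\<exists>e'. ((\<delta>, e), (\<delta>', e')) \<in> link T t"
  using assms(1)
proof (induction rule: rtrancl_induct)
  case (step y z)
  then obtain e' where e': "((\<delta>, e), (y, e')) \<in> link T t" by auto
  have y: "y \<in> ldarts" "e' \<in> darts T" "t \<in> ctri y" using link_closed[OF e'] assms by auto
  have "\<exists>e''. ((y, e'), (z, e'')) \<in> link T t"
  proof (cases "z = lface y")
    case True then show ?thesis using link_face(1) y by blast
  next
    case False
    then obtain w where w: "z = lopp y" "w \<in> ledge y" "w \<in> R" using step(2) by (auto simp: adj_def)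
    then have "t \<in> ctri (lopp y)" using assms(2) y ledge_subset_ctri lopp_ldarts unfolding near_def by blast
    then show ?thesis using link_opp y w by blast
  qed
  then show ?case using e' link_trans by blast
qed auto

lemma link_exists:
  assumes "\<delta> \<in> ldarts" "\<delta>' \<in> ldarts" "t \<in> ctri \<delta>" "t \<in> ctri \<delta>'" "e \<in> darts T"
  shows "\<exists>e'. ((\<delta>, e), (\<delta>', e')) \<in> link T t"
proof -
  obtain r where r: "r > 0" "near t (ball t r)" using near_ball .
  have "ltri \<delta> \<inter> ball t r \<noteq> {}" "ltri \<delta>' \<inter> ball t r \<noteq> {}"
    using ltri_meets[of _ "ball t r" t] assms r by simp_all
  then have "(\<delta>, \<delta>') \<in> (adj (ball t r))\<^sup>*" using adj_convex assms by simp
  then show ?thesis using link_lift r assms by blast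
qed

text \<open>A chart is itself a lift of the path: the conditions in \<open>unfolds\<close> are the
  steps of \<open>lstep\<close>.\<close>

lemma link_section:
  assumes u: "unfolds T R \<psi>" and R: "open R" "R' \<subseteq> R" "open R'" and n: "near t R'"
    and d: "(\<delta>, \<delta>') \<in> (adj R')\<^sup>*" "\<delta> \<in> ldarts" "ltri \<delta> \<inter> R' \<noteq> {}"
  shows "((\<delta>, \<psi> \<delta>), (\<delta>', \<psi> \<delta>')) \<in> link T t \<and> \<delta>' \<in> ldarts \<and> ltri \<delta>' \<inter> R' \<noteq> {}"
  using d(1)
proof (induction rule: rtrancl_induct)
  case base then show ?case using d by auto
next
  case (step y z)
  then have y: "y \<in> ldarts" "ltri y \<inter> R' \<noteq> {}" by auto
  have z: "z \<in> ldarts" "ltri z \<inter> R' \<noteq> {}" using adj_meets[OF step(2) R(3) y(2)] by auto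
  have yR: "ltri y \<inter> R \<noteq> {}" using y R by blast
  have ty: "t \<in> ctri y" using n y ltri_subset unfolding near_def by blast
  have *: "\<psi> y \<in> darts T" "\<psi> (lface y) = face T (\<psi> y)"
    "ledge y \<inter> R \<noteq> {} \<Longrightarrow> \<psi> (lopp y) = opp T (\<psi> y)"
    using u y yR unfolding unfolds_def by blast+
  have "((y, \<psi> y), (z, \<psi> z)) \<in> link T t"
  proof (cases "z = lface y")
    case True then show ?thesis using link_face(1) y ty * by metis
  next
    case False
    then obtain w where w: "z = lopp y" "w \<in> ledge y" "w \<in> R'" using step(2) by (auto simp: adj_def)
    then have "t \<in> ctri (lopp y)" using n y ledge_subset_ctri lopp_ldarts unfolding near_def by blast
    then show ?thesis using link_opp[OF y(1) *(1) ty] w *(3) R(2) by fastforce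
  qed
  then show ?case using step z link_trans by blast
qed

text \<open>The star of a lattice point is a fan. Passing to the next triangle multiplies the
  direction by \<open>omega\<close> and applies \<open>rot T\<close> to the label, so one exponent
  \<open>k\<close> records both.\<close>

lemma link_rotates:
  assumes t: "t \<in> eisenstein" and u: "u \<in> eisenstein_units" and e: "e \<in> darts T"
    and l: "(((t, u), e), (\<delta>, e')) \<in> link T t"
  obtains k where "(\<delta>, e') \<in> {((t, omega ^ k * u), (rot T ^^ k) e),
    (lface (t, omega ^ k * u), face T ((rot T ^^ k) e)),
    (lface (lface (t, omega ^ k * u)), face T (face T ((rot T ^^ k) e)))}"
proof -
  define L where "L = card (orbit (rot T) e)"
  have L: "(rot T ^^ L) e = e" "L > 0"
    using orbit_card_funpow[OF rot_permutes finite_darts] by (auto simp: L_def)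
  have Lm: "(rot T ^^ (m * L)) e = e" for m
    by (induction m) (simp_all add: funpow_add L)
  have "\<exists>k. (\<delta>, e') \<in> {((t, omega ^ k * u), (rot T ^^ k) e),
    (lface (t, omega ^ k * u), face T ((rot T ^^ k) e)),
    (lface (lface (t, omega ^ k * u)), face T (face T ((rot T ^^ k) e)))}"
    using l unfolding link_def
  proof (induction "(\<delta>, e')" arbitrary: \<delta> e' rule: rtrancl_induct)
    case base
    then show ?case by (intro exI[of _ 0]) simp
  next
    case (step y)
    obtain \<delta>1 e1 where y: "y = (\<delta>1, e1)" by (cases y)
    obtain k where k: "(\<delta>1, e1) \<in> {((t, omega ^ k * u), (rot T ^^ k) e),
      (lface (t, omega ^ k * u), face T ((rot T ^^ k) e)),
      (lface (lface (t, omega ^ k * u)), face T (face T ((rot T ^^ k) e)))}" using step(3) y by blast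
    define v x where "v = omega ^ k * u" and "x = (rot T ^^ k) e"
    have v: "v \<in> eisenstein_units"
    proof -
      have "omega ^ k \<in> eisenstein_units" by (induction k) auto
      then show ?thesis using u by (simp add: v_def)
    qed
    have x: "x \<in> darts T" using e by (simp add: x_def)
    have v0: "v \<noteq> 0" using units_neq_0 v by blast
    note k' = k[folded v_def x_def]
    have s: "((\<delta>1, e1), (\<delta>, e')) \<in> lstep T t" using step(2) y by simp
    show ?case
    proof (cases "\<delta> = lface \<delta>1 \<and> e' = face T e1")
      case True
      then show ?thesis using k face_3[OF x] unfolding x_def
        by (intro exI[of _ k]) auto
    next
      case False
      then have op: "\<delta> = lopp \<delta>1" "e' = opp T e1" "t \<in> ctri \<delta>1" "t \<in> ctri (lopp \<delta>1)"
        using s by (auto simp: lstep_def)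
      from k' consider "\<delta>1 = (t, v)" "e1 = x" | "\<delta>1 = lface (t, v)" "e1 = face T x"
        | "\<delta>1 = lface (lface (t, v))" "e1 = face T (face T x)" by blast
      then show ?thesis
      proof cases
        case 1
        \<comment> \<open>A clockwise turn would need the exponent \<open>k - 1\<close>. Adding
          \<open>6 * L\<close> keeps it natural and changes neither the power of
          \<open>omega\<close>, which has period 6, nor that of \<open>rot T\<close>, which has
          period \<open>L\<close> at \<open>e\<close>.\<close>
        define m where "m = k + 6 * L - 1"
        have m: "m + 1 = k + 6 * L" using L by (simp add: m_def)
        have "omega ^ (m + 1) = omega ^ k" unfolding m by (simp add: power_add power_mult omega_powers)
        then have om: "omega * (omega ^ m * u) = v" by (simp add: v_def mult.assoc[symmetric])
        have "(rot T ^^ (m + 1)) e = x" unfolding m x_def using Lm[of 6] by (simp add: funpow_add)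
        then have rx: "rot T ((rot T ^^ m) e) = x" by simp
        have "lface (lface (t, omega ^ m * u)) = (t + v, - v)"
          using om by (simp add: lface_2)
        moreover have "face T (face T ((rot T ^^ m) e)) = opp T x"
          using opp_rot[of "(rot T ^^ m) e"] e rx by simp
        ultimately have "(\<delta>, e') = (lface (lface (t, omega ^ m * u)), face T (face T ((rot T ^^ m) e)))"
          using op 1 by simp
        then show ?thesis by blast
      next
        case 2
        \<comment> \<open>This edge is opposite to \<open>t\<close> in its triangle, so it cannot be
          crossed at \<open>t\<close>.\<close>
        have "t \<in> ctri (t + v, omega\<^sup>2 * v)" "t \<in> ctri (lopp (t + v, omega\<^sup>2 * v))"
          using op 2 by (simp_all add: lface.simps)
        then obtain a where a: "t = t + v + of_real a * (omega\<^sup>2 * v)"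
          using closed_edge v0 by (metis mult_eq_0_iff omega_neq_0 power_eq_0_iff)
        then have "(1 + of_real a * omega\<^sup>2) * v = 0" by (simp add: algebra_simps)
        then have "1 + of_real a * (omega - 1) = 0" using v0 by (simp add: omega_square)
        then have "yc (1 + of_real a * (omega - 1)) = 0" "xc (1 + of_real a * (omega - 1)) = 0" by simp_all
        then have False by simp
        then show ?thesis ..
      next
        case 3
        have "lopp (lface (lface (t, v))) = (t, omega * v)" by (simp add: lface_2)
        then have "(\<delta>, e') = ((t, omega ^ Suc k * u), (rot T ^^ Suc k) e)"
          using op 3 opp_face_face[OF x] by (simp add: v_def x_def mult.assoc)
        then show ?thesis by blast
      qed
    qed
  qed
  then show ?thesis using that by blast
qed

lemma lface_eq_origin:
  assumes "(t, u) \<in> ldarts"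
  shows "lface (t, u) \<noteq> (t, v)" "lface (lface (t, u)) \<noteq> (t, v)"
  using assms units_neq_0[of u] by (auto simp: lface_2) (auto simp: lface.simps)

lemma link_same_orbit:
  assumes "t \<in> eisenstein" "u \<in> eisenstein_units" "e \<in> darts T"
    and l: "(((t, u), e), ((t, v), e')) \<in> link T t"
  obtains k where "v = omega ^ k * u" "e' = (rot T ^^ k) e"
proof -
  have "omega ^ k \<in> eisenstein_units" for k by (induction k) auto
  then have *: "(t, omega ^ k * u) \<in> ldarts" for k using assms by simp
  show ?thesis using link_rotates[OF assms]
  proof (cases)
    case (1 k)
    then show ?thesis using lface_eq_origin[OF *[of k], of v] that[of k] by (metis Pair_inject empty_iff insert_iff)
  qed
qed

lemma omega_power_mod: "omega ^ k = omega ^ (k mod 6)"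
proof -
  have "omega ^ (6 * (k div 6) + k mod 6) = omega ^ (k mod 6)"
    by (simp only: power_add power_mult omega_powers) simp
  then show ?thesis by simp
qed

lemma omega_power_eq_1: assumes "omega ^ k = 1" shows "k mod 6 = 0"
proof -
  have "k mod 6 \<in> {0, 1, 2, 3, 4, 5}" by auto
  moreover have "omega ^ (k mod 6) = 1" using assms omega_power_mod by metis
  moreover have "xc (omega ^ 1) \<noteq> xc 1" "xc (omega ^ 2) \<noteq> xc 1" "xc (omega ^ 3) \<noteq> xc 1"
    "xc (omega ^ 4) \<noteq> xc 1" "yc (omega ^ 5) \<noteq> yc 1" by (simp_all add: omega_powers)
  ultimately show ?thesis by (metis empty_iff insert_iff)
qed

text \<open>Returning to the same lattice dart means that the number of turns is a multiple of 6,
  and then \<open>rot T\<close> has returned as well. At a pentagon six turns in the lattice are one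
  turn too many in \<open>T\<close>.\<close>

lemma link_unique_lattice:
  assumes t: "t \<in> eisenstein" and u: "u \<in> eisenstein_units" and e: "e \<in> darts T"
    and six: "(rot T ^^ 6) e = e" and l: "(((t, u), e), ((t, u), e')) \<in> link T t"
  shows "e' = e"
proof -
  obtain k where k: "u = omega ^ k * u" "e' = (rot T ^^ k) e"
    using link_same_orbit[OF t u e l] by blast
  have "omega ^ k = 1" using k(1) units_neq_0[OF u] by simp
  then have "k mod 6 = 0" by (rule omega_power_eq_1)
  then obtain m where m: "k = m * 6" by (metis dvd_def mod_0_imp_dvd mult.commute)
  have "(rot T ^^ (m * 6)) e = e" for m
    by (induction m) (simp_all add: funpow_add six del: funpow.simps)
  then show ?thesis using k m by simp
qed

text \<open>A dart of the star that does not start at \<open>t\<close> is turned by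
  \<open>lface\<close> until it does; injectivity of \<open>face T\<close> transfers the equality
  back.\<close>

lemma link_unique_from:
  assumes t: "t \<in> eisenstein" "u \<in> eisenstein_units" and e: "e \<in> darts T" "(rot T ^^ 6) e = e"
    and l: "(((t, u), e), (\<delta>, x)) \<in> link T t" "(((t, u), e), (\<delta>, y)) \<in> link T t"
  shows "x = y"
proof -
  have tu: "(t, u) \<in> ldarts" "t \<in> ctri (t, u)" using t by (auto simp: ctri.simps hull_inc)
  have c: "\<delta> \<in> ldarts" "t \<in> ctri \<delta>" "x \<in> darts T" "y \<in> darts T"
    using link_closed[OF l(1) tu(1) e(1) tu(2)] link_closed[OF l(2) tu(1) e(1) tu(2)] by auto
  have base: "z = w" if z: "(((t, u), e), ((t, v), z)) \<in> link T t" and w: "(((t, u), e), ((t, v), w)) \<in> link T t"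
    and v: "v \<in> eisenstein_units" for v z w
  proof -
    obtain k where k: "z = (rot T ^^ k) e" using link_same_orbit[OF t e(1) z] by blast
    have "(rot T ^^ 6) z = (rot T ^^ k) ((rot T ^^ 6) e)" unfolding k by (metis add.commute comp_apply funpow_add)
    then have "(rot T ^^ 6) z = z" using e k by simp
    moreover have "(((t, v), z), ((t, v), w)) \<in> link T t" using z w link_sym link_trans by blast
    moreover have "z \<in> darts T" using k e by simp
    ultimately show ?thesis using link_unique_lattice[OF t(1) v] by blast
  qed
  have s: "(((t, u), e), (lface \<delta>, face T x)) \<in> link T t" "(((t, u), e), (lface \<delta>, face T y)) \<in> link T t"
    using link_trans[OF l(1) link_face(1)] link_trans[OF l(2) link_face(1)] c by blast+
  have s': "(((t, u), e), (lface (lface \<delta>), face T (face T x))) \<in> link T t"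
    "(((t, u), e), (lface (lface \<delta>), face T (face T y))) \<in> link T t"
    using link_trans[OF s(1) link_face(1)] link_trans[OF s(2) link_face(1)] c by auto
  obtain v where v: "v \<in> eisenstein_units" "\<delta> \<in> {(t, v), lface (t, v), lface (lface (t, v))}"
    using star_lattice[OF t(1) c(1,2)] by blast
  from v(2) consider "\<delta> = (t, v)" | "lface (lface \<delta>) = (t, v)" | "lface \<delta> = (t, v)" by auto
  then show ?thesis
  proof cases
    case 1 then show ?thesis using base l v by blast
  next
    case 2
    then have "face T (face T x) = face T (face T y)" using base s' v by simp
    then show ?thesis using face_inj face_in c by metis
  next
    case 3
    then have "face T x = face T y" using base s v by simp
    then show ?thesis using face_inj c by metis
  qed
qed

lemma link_invariant:
  assumes l: "((\<delta>, e), (\<delta>', e')) \<in> link T t" and X: "(\<delta>, e) \<in> X"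
    and step: "\<And>\<epsilon> x \<epsilon>' x'. (\<epsilon>, x) \<in> X \<Longrightarrow> ((\<epsilon>, x), (\<epsilon>', x')) \<in> lstep T t \<Longrightarrow> (\<epsilon>', x') \<in> X"
  shows "(\<delta>', e') \<in> X"
  using l unfolding link_def
proof (induction "(\<delta>', e')" arbitrary: \<delta>' e' rule: rtrancl_induct)
  case (step y) then show ?case using assms(3) by (cases y) blast
qed (use X in auto)

lemma one_edge:
  assumes "z \<in> ledge \<delta>" "\<delta> \<in> ldarts" shows "z \<notin> ledge (lface \<delta>)"
proof
  assume z': "z \<in> ledge (lface \<delta>)"
  obtain p u where pu: "\<delta> = (p, u)" by (cases \<delta>)
  obtain a where a: "0 < a" "a < 1" "z = p + of_real a * u" using assms(1) unfolding pu ledge_iff by blast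
  obtain b where b: "0 < b" "b < 1" "z = p + u + of_real b * (omega\<^sup>2 * u)"
    using z' unfolding pu lface.simps ledge_iff by blast
  have "(of_real a - 1 - of_real b * (omega - 1)) * u = 0" using a(3) b(3) by (simp add: omega_square algebra_simps)
  then have "of_real a - 1 - of_real b * (omega - 1) = 0" using units_neq_0[of u] assms(2) pu by simp
  then have "yc (of_real a - 1 - of_real b * (omega - 1)) = 0" by simp
  then show False using b by simp
qed

text \<open>Off the lattice the star of \<open>t\<close> is one triangle, or two triangles with a
  common edge, so it has no cycle. In either case \<open>X\<close> lists the labels obtained without
  a detour and is closed under \<open>lstep\<close>.\<close>

lemma link_unique_nonlattice:
  assumes t: "t \<notin> eisenstein" and d: "\<delta> \<in> ldarts" "t \<in> ctri \<delta>" "e \<in> darts T"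
    and l: "((\<delta>, e), (\<delta>, e')) \<in> link T t"
  shows "e' = e"
proof -
  have edge: "t \<in> ledge \<epsilon>" if h: "\<epsilon> \<in> ldarts" "t \<in> ctri \<epsilon>" "t \<in> ctri (lopp \<epsilon>)" for \<epsilon>
  proof -
    obtain p u where pu: "\<epsilon> = (p, u)" by (cases \<epsilon>)
    have u: "u \<noteq> 0" "p \<in> eisenstein" "u \<in> eisenstein" using h pu units_neq_0[of u] by auto
    obtain a where a: "0 \<le> a" "a \<le> 1" "t = p + of_real a * u"
      using closed_edge[of t p u] h(2,3) u(1) unfolding pu by blast
    then have "a \<noteq> 0" "a \<noteq> 1" using t u by auto
    then show ?thesis unfolding pu ledge_iff using a u by (intro conjI exI[of _ a]) auto
  qed
  show ?thesis
  proof (cases "\<exists>\<epsilon> \<in> {\<delta>, lface \<delta>, lface (lface \<delta>)}. t \<in> ledge \<epsilon>")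
    case False
    define X where "X = {(\<delta>, e), (lface \<delta>, face T e), (lface (lface \<delta>), face T (face T e))}"
    have "(\<delta>, e') \<in> X"
    proof (rule link_invariant[OF l])
      fix \<epsilon> x \<epsilon>' x' assume *: "(\<epsilon>, x) \<in> X" "((\<epsilon>, x), (\<epsilon>', x')) \<in> lstep T t"
      have "t \<notin> ledge \<epsilon>" using False * by (auto simp: X_def)
      then have "\<not> (\<epsilon> \<in> ldarts \<and> t \<in> ctri \<epsilon> \<and> t \<in> ctri (lopp \<epsilon>))" using edge by blast
      then have "\<epsilon>' = lface \<epsilon>" "x' = face T x" using *(2) unfolding lstep_def by blast+
      then show "(\<epsilon>', x') \<in> X" using *(1) face_3[OF d(3)] by (auto simp: X_def)
    qed (simp add: X_def)
    then show ?thesis using lface_neq[OF d(1)] by (auto simp: X_def)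
  next
    case True
    then have "\<exists>\<epsilon>0 x0. (\<epsilon>0, x0) \<in> {(\<delta>, e), (lface \<delta>, face T e), (lface (lface \<delta>), face T (face T e))} \<and>
      t \<in> ledge \<epsilon>0" by blast
    then obtain \<epsilon>0 x0 where e0: "(\<epsilon>0, x0) \<in> {(\<delta>, e), (lface \<delta>, face T e), (lface (lface \<delta>), face T (face T e))}"
      "t \<in> ledge \<epsilon>0" by blast
    have E0: "\<epsilon>0 \<in> ldarts" "x0 \<in> darts T" using e0 d by auto
    have rep0: "(\<delta>, e) \<in> {(\<epsilon>0, x0), (lface \<epsilon>0, face T x0), (lface (lface \<epsilon>0), face T (face T x0))}"
      using e0 face_3[OF d(3)] by auto
    define X where "X = {(\<epsilon>0, x0), (lface \<epsilon>0, face T x0), (lface (lface \<epsilon>0), face T (face T x0)),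
      (lopp \<epsilon>0, opp T x0), (lface (lopp \<epsilon>0), face T (opp T x0)), (lface (lface (lopp \<epsilon>0)), face T (face T (opp T x0)))}"
    have n1: "t \<notin> ledge (lface \<epsilon>0)" "t \<notin> ledge (lface (lopp \<epsilon>0))"
      using one_edge e0(2) E0 by auto
    have n2: "t \<notin> ledge (lface (lface \<epsilon>0))" "t \<notin> ledge (lface (lface (lopp \<epsilon>0)))"
      using one_edge[of t "lface (lface \<epsilon>0)"] one_edge[of t "lface (lface (lopp \<epsilon>0))"] e0(2) E0 by auto
    have "(\<delta>, e') \<in> X"
    proof (rule link_invariant[OF l])
      show "(\<delta>, e) \<in> X" using rep0 by (auto simp: X_def)
      fix \<epsilon> x \<epsilon>' x' assume *: "(\<epsilon>, x) \<in> X" "((\<epsilon>, x), (\<epsilon>', x')) \<in> lstep T t"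
      show "(\<epsilon>', x') \<in> X"
      proof (cases "\<epsilon>' = lface \<epsilon> \<and> x' = face T x")
        case True
        then show ?thesis using *(1) face_3[OF E0(2)] face_3[of "opp T x0"] E0 unfolding X_def by auto
      next
        case False
        then have op: "\<epsilon>' = lopp \<epsilon>" "x' = opp T x" "\<epsilon> \<in> ldarts" "t \<in> ctri \<epsilon>" "t \<in> ctri (lopp \<epsilon>)"
          using * by (auto simp: lstep_def)
        have "t \<in> ledge \<epsilon>" using edge op by blast
        then have "(\<epsilon>, x) = (\<epsilon>0, x0) \<or> (\<epsilon>, x) = (lopp \<epsilon>0, opp T x0)" using *(1) n1 n2 unfolding X_def by auto
        then show ?thesis using op E0 unfolding X_def by auto
      qed
    qed
    have ne: "\<epsilon> \<noteq> \<epsilon>'"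
      if e: "\<epsilon> \<in> {\<epsilon>0, lface \<epsilon>0, lface (lface \<epsilon>0)}"
        "\<epsilon>' \<in> {lopp \<epsilon>0, lface (lopp \<epsilon>0), lface (lface (lopp \<epsilon>0))}" for \<epsilon> \<epsilon>'
    proof -
      obtain p u where pu: "\<epsilon>0 = (p, u)" by (cases \<epsilon>0)
      have u: "u \<noteq> 0" using E0 pu units_neq_0 by auto
      have s1: "snd (lface (q, v)) = (omega - 1) * v" for q v by (simp add: lface.simps omega_square)
      have s2: "snd (lface (lface (q, v))) = - omega * v" for q v by (simp add: lface_2)
      have "snd \<epsilon> \<in> {u, (omega - 1) * u, - omega * u}" "snd \<epsilon>' \<in> {- u, (1 - omega) * u, omega * u}"
        using e unfolding pu by (auto simp: s1 s2 left_diff_distrib)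
      then have "\<exists>c \<in> {1, omega - 1, - omega}. snd \<epsilon> = c * u" "\<exists>c' \<in> {-1, 1 - omega, omega}. snd \<epsilon>' = c' * u"
        by auto
      then obtain c c' where c: "snd \<epsilon> = c * u" "c \<in> {1, omega - 1, - omega}"
        "snd \<epsilon>' = c' * u" "c' \<in> {-1, 1 - omega, omega}" by blast
      \<comment> \<open>Modulo \<open>1 + omega\<close> the first three factors are 1 and the other
        three are -1; \<open>xc - yc\<close> detects this.\<close>
      have "xc c - yc c \<noteq> xc c' - yc c'" using c(2,4) by auto
      then have "c \<noteq> c'" by auto
      then have "snd \<epsilon> \<noteq> snd \<epsilon>'" using c u by simp
      then show ?thesis by auto
    qed
    have "\<delta> \<in> {\<epsilon>0, lface \<epsilon>0, lface (lface \<epsilon>0)}" using rep0 by blast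
    then have "\<delta> \<notin> {lopp \<epsilon>0, lface (lopp \<epsilon>0), lface (lface (lopp \<epsilon>0))}" using ne by blast
    with \<open>(\<delta>, e') \<in> X\<close>
    have "(\<delta>, e') \<in> {(\<epsilon>0, x0), (lface \<epsilon>0, face T x0), (lface (lface \<epsilon>0), face T (face T x0))}"
      unfolding X_def by blast
    moreover have "lface \<epsilon>0 \<noteq> \<epsilon>0" "lface (lface \<epsilon>0) \<noteq> \<epsilon>0" "lface (lface \<epsilon>0) \<noteq> lface \<epsilon>0"
      using lface_neq[OF E0(1)] lface_neq(1)[of "lface \<epsilon>0"] E0 by simp_all
    ultimately show ?thesis using rep0 by (metis Pair_inject empty_iff insert_iff)
  qed
qed

end

section \<open>Comparing two charts along a common segment\<close>

lemma segment_near: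
  fixes t z :: complex
  assumes "e > 0" "z \<noteq> t" obtains w where "w \<in> open_segment z t" "w \<in> ball t e"
proof -
  define s where "s = min (1/2) (e / (2 * norm (z - t)))"
  have n: "norm (z - t) > 0" using assms by simp
  have s: "0 < s" "s < 1" "s * norm (z - t) < e"
    using n assms by (auto simp: s_def min_def field_simps)
  define w where "w = t + s *\<^sub>R (z - t)"
  have "w \<in> open_segment z t"
    unfolding in_segment using assms s
    by (intro conjI exI[of _ "1 - s"]) (auto simp: w_def algebra_simps)
  moreover have "w \<in> ball t e" using s by (simp add: w_def dist_norm)
  ultimately show ?thesis using that by blast
qed

text \<open>Both regions lie in the same plane, and \<open>t\<close> may be a boundary point of
  both. The labels are compared through the star of \<open>t\<close>, since the two charts may be
  meaningful on different triangles there.\<close>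

definition agree :: "'d cmap \<Rightarrow> complex \<Rightarrow> complex set \<Rightarrow> (ldart \<Rightarrow> 'd) \<Rightarrow> complex set \<Rightarrow> (ldart \<Rightarrow> 'd) \<Rightarrow> bool" where
  "agree T t R1 \<psi>1 R2 \<psi>2 \<longleftrightarrow>
     (\<forall>\<delta>\<in>ldarts. \<forall>\<delta>'\<in>ldarts. t \<in> ctri \<delta> \<longrightarrow> t \<in> ctri \<delta>' \<longrightarrow> ltri \<delta> \<inter> R1 \<noteq> {} \<longrightarrow> ltri \<delta>' \<inter> R2 \<noteq> {} \<longrightarrow>
        ((\<delta>, \<psi>1 \<delta>), (\<delta>', \<psi>2 \<delta>')) \<in> link T t)"

lemma agreeD:
  "agree T t R1 \<psi>1 R2 \<psi>2 \<Longrightarrow> \<delta> \<in> ldarts \<Longrightarrow> \<delta>' \<in> ldarts \<Longrightarrow> t \<in> ctri \<delta> \<Longrightarrow> t \<in> ctri \<delta>' \<Longrightarrow>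
    ltri \<delta> \<inter> R1 \<noteq> {} \<Longrightarrow> ltri \<delta>' \<inter> R2 \<noteq> {} \<Longrightarrow> ((\<delta>, \<psi>1 \<delta>), (\<delta>', \<psi>2 \<delta>')) \<in> link T t"
  unfolding agree_def by blast

lemma closure_star:
  assumes "t \<in> closure R" "open R" "open U" "t \<in> U" "near t U"
  obtains \<delta> where "\<delta> \<in> ldarts" "t \<in> ctri \<delta>" "ltri \<delta> \<inter> R \<noteq> {}"
proof -
  have "R \<inter> U \<noteq> {}" using assms open_Int_closure_eq_empty[of U R] by (metis Int_iff Int_commute empty_iff)
  then obtain q where q: "q \<in> R" "q \<in> U" by blast
  obtain \<delta> where "\<delta> \<in> ldarts" "q \<in> ctri \<delta>" using ctri_cover by blast
  then show ?thesis using that[of \<delta>] ltri_meets[of \<delta> R q] assms q unfolding near_def by blast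
qed

lemma closure_star':
  assumes "t \<in> closure R" "open R"
  obtains \<delta> where "\<delta> \<in> ldarts" "t \<in> ctri \<delta>" "ltri \<delta> \<inter> R \<noteq> {}"
proof -
  obtain e where e: "e > 0" "near t (ball t e)" using near_ball .
  show ?thesis by (rule closure_star[OF assms, of "ball t e"]) (use e that in auto)
qed

text \<open>Go from a common point of the triangle and \<open>R\<close> towards \<open>t\<close>:
  the open segment stays inside both convex sets.\<close>

lemma convex_star_near:
  assumes "t \<in> closure R" "open R" "convex R" "\<delta> \<in> ldarts" "t \<in> ctri \<delta>" "ltri \<delta> \<inter> R \<noteq> {}" "e > 0"
  shows "ltri \<delta> \<inter> (R \<inter> ball t e) \<noteq> {}"
proof -
  obtain z where z: "z \<in> ltri \<delta>" "z \<in> R" using assms by blast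
  show ?thesis
  proof (cases "z = t")
    case False
    obtain w where w: "w \<in> open_segment z t" "w \<in> ball t e" using segment_near[OF assms(7) False] .
    have "open_segment z t \<subseteq> interior R"
      by (rule in_interior_closure_convex_segment) (use assms z in \<open>auto simp: interior_open\<close>)
    moreover have "open_segment z t \<subseteq> interior (ltri \<delta>)"
      by (rule in_interior_closure_convex_segment)
        (use assms z convex_ltri open_ltri closure_ltri in \<open>auto simp: interior_open\<close>)
    ultimately have "w \<in> R" "w \<in> ltri \<delta>" using w interior_subset by blast+
    then show ?thesis using w by blast
  next
    case True
    then show ?thesis using z assms by auto
  qed
qed

section \<open>Agreement of two charts and its continuation\<close>

context triangulation
begin

text \<open>By convexity the triangles in question are already connected by a path within
  \<open>R\<close> close to \<open>t\<close>, and close to \<open>t\<close> every step of a path is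
  a link at \<open>t\<close>.\<close>

lemma star_section:
  assumes "unfolds T R \<psi>" "open R" "convex R" "t \<in> closure R"
    "\<delta> \<in> ldarts" "t \<in> ctri \<delta>" "ltri \<delta> \<inter> R \<noteq> {}" "\<delta>' \<in> ldarts" "t \<in> ctri \<delta>'" "ltri \<delta>' \<inter> R \<noteq> {}"
  shows "((\<delta>, \<psi> \<delta>), (\<delta>', \<psi> \<delta>')) \<in> link T t"
proof -
  obtain e where e: "e > 0" "near t (ball t e)" using near_ball .
  have m: "ltri \<delta> \<inter> (R \<inter> ball t e) \<noteq> {}" "ltri \<delta>' \<inter> (R \<inter> ball t e) \<noteq> {}"
    using convex_star_near assms e by blast+
  have o: "open (R \<inter> ball t e)" "convex (R \<inter> ball t e)" using assms by (auto intro: convex_Int)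
  have "(\<delta>, \<delta>') \<in> (adj (R \<inter> ball t e))\<^sup>*" using adj_convex[OF o _ _ m] assms by blast
  then show ?thesis
    using link_section[OF assms(1,2) _ o(1) near_subset[OF e(2)] _ _ m(1)] assms by blast
qed

lemma unfolds_darts:
  "unfolds T R \<psi> \<Longrightarrow> \<delta> \<in> ldarts \<Longrightarrow> ltri \<delta> \<inter> R \<noteq> {} \<Longrightarrow> \<psi> \<delta> \<in> darts T"
  "unfolds T R \<psi> \<Longrightarrow> \<delta> \<in> ldarts \<Longrightarrow> ltri \<delta> \<inter> R \<noteq> {} \<Longrightarrow> \<psi> (lface \<delta>) = face T (\<psi> \<delta>)"
  unfolding unfolds_def by blast+

lemma agreeI:
  assumes 1: "unfolds T R1 \<psi>1" "open R1" "convex R1" "t \<in> closure R1"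
    and 2: "unfolds T R2 \<psi>2" "open R2" "convex R2" "t \<in> closure R2"
    and d: "\<delta> \<in> ldarts" "t \<in> ctri \<delta>" "ltri \<delta> \<inter> R1 \<noteq> {}" "\<delta>' \<in> ldarts" "t \<in> ctri \<delta>'" "ltri \<delta>' \<inter> R2 \<noteq> {}"
    and l: "((\<delta>, \<psi>1 \<delta>), (\<delta>', \<psi>2 \<delta>')) \<in> link T t"
  shows "agree T t R1 \<psi>1 R2 \<psi>2"
  unfolding agree_def
proof (intro ballI impI)
  fix \<epsilon> \<epsilon>' assume "\<epsilon> \<in> ldarts" "\<epsilon>' \<in> ldarts" "t \<in> ctri \<epsilon>" "t \<in> ctri \<epsilon>'" "ltri \<epsilon> \<inter> R1 \<noteq> {}" "ltri \<epsilon>' \<inter> R2 \<noteq> {}"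
  then have "((\<epsilon>, \<psi>1 \<epsilon>), (\<delta>, \<psi>1 \<delta>)) \<in> link T t" "((\<delta>', \<psi>2 \<delta>'), (\<epsilon>', \<psi>2 \<epsilon>')) \<in> link T t"
    using star_section[OF 1] star_section[OF 2] d by blast+
  then show "((\<epsilon>, \<psi>1 \<epsilon>), (\<epsilon>', \<psi>2 \<epsilon>')) \<in> link T t" using l link_trans by blast
qed

lemma agree_sym: "agree T t R1 \<psi>1 R2 \<psi>2 \<Longrightarrow> agree T t R2 \<psi>2 R1 \<psi>1"
  unfolding agree_def using link_sym by blast

text \<open>Absence of holonomy at \<open>t\<close>, as seen in the chart; vacuous off the
  lattice.\<close>

definition hexagonal :: "complex \<Rightarrow> complex set \<Rightarrow> (ldart \<Rightarrow> 'd) \<Rightarrow> bool" where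
  "hexagonal t R \<psi> \<longleftrightarrow> (t \<in> eisenstein \<longrightarrow>
     (\<forall>u. (t, u) \<in> ldarts \<longrightarrow> ltri (t, u) \<inter> R \<noteq> {} \<longrightarrow> (rot T ^^ 6) (\<psi> (t, u)) = \<psi> (t, u)))"

lemma link_unique:
  assumes u: "unfolds T R \<psi>" and h: "hexagonal t R \<psi>"
    and d: "\<delta> \<in> ldarts" "t \<in> ctri \<delta>" "ltri \<delta> \<inter> R \<noteq> {}" and l: "((\<delta>, \<psi> \<delta>), (\<delta>, e)) \<in> link T t"
  shows "e = \<psi> \<delta>"
proof (cases "t \<in> eisenstein")
  case False
  then show ?thesis using link_unique_nonlattice d l unfolds_darts(1)[OF u] by blast
next
  case True
  obtain v where v: "v \<in> eisenstein_units" "\<delta> \<in> {(t, v), lface (t, v), lface (lface (t, v))}"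
    using star_lattice[OF True d(1,2)] .
  have tv: "(t, v) \<in> ldarts" "lface (t, v) \<in> ldarts" "ltri (t, v) \<inter> R \<noteq> {}" "t \<in> ctri (t, v)" using v True d by auto
  define x where "x = \<psi> (t, v)"
  have x: "x \<in> darts T" using unfolds_darts(1)[OF u] tv x_def by blast
  have f: "\<psi> (lface (t, v)) = face T x" "\<psi> (lface (lface (t, v))) = face T (face T x)"
    using unfolds_darts(2)[OF u tv(1,3)] unfolds_darts(2)[OF u tv(2)] tv(3) by (simp_all add: x_def)
  have six: "(rot T ^^ 6) x = x" using h True tv unfolding hexagonal_def x_def by blast
  have 1: "(((t, v), x), (lface (t, v), face T x)) \<in> link T t" using link_face(1)[OF tv(1) x tv(4)] .
  have 2: "(((t, v), x), (lface (lface (t, v)), face T (face T x))) \<in> link T t"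
    using link_trans[OF 1 link_face(1)] tv x by simp
  have "(((t, v), x), (\<delta>, \<psi> \<delta>)) \<in> link T t" using v(2) f 1 2 x_def by auto
  then show ?thesis using link_unique_from[OF True v(1) x six] l link_trans by metis
qed

text \<open>The star of \<open>t'\<close> is contained in that of \<open>t\<close>, so links at
  \<open>t'\<close> are links at \<open>t\<close>. This works even if \<open>t\<close> is a
  pentagon.\<close>

lemma agree_closed:
  assumes 1: "unfolds T R1 \<psi>1" "open R1" "convex R1" "t \<in> closure R1" "t' \<in> closure R1"
    and 2: "unfolds T R2 \<psi>2" "open R2" "convex R2" "t \<in> closure R2" "t' \<in> closure R2"
    and n: "near t {t'}" and a: "agree T t' R1 \<psi>1 R2 \<psi>2"
  shows "agree T t R1 \<psi>1 R2 \<psi>2"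
proof -
  obtain \<delta> where d: "\<delta> \<in> ldarts" "t' \<in> ctri \<delta>" "ltri \<delta> \<inter> R1 \<noteq> {}" using closure_star'[OF 1(5,2)] .
  obtain \<delta>' where d': "\<delta>' \<in> ldarts" "t' \<in> ctri \<delta>'" "ltri \<delta>' \<inter> R2 \<noteq> {}" using closure_star'[OF 2(5,2)] .
  have "((\<delta>, \<psi>1 \<delta>), (\<delta>', \<psi>2 \<delta>')) \<in> link T t" using link_near[OF n agreeD[OF a]] d d' by blast
  moreover have "t \<in> ctri \<delta>" "t \<in> ctri \<delta>'" using n d d' unfolding near_def by blast+
  ultimately show ?thesis using agreeI[OF 1(1-4) 2(1-4)] d d' by blast
qed

text \<open>The converse direction, from \<open>t\<close> to nearby points. The label developed at
  \<open>t'\<close> and the value of the second chart are linked around \<open>t\<close>; they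
  coincide because there is no holonomy at \<open>t\<close>.\<close>

lemma agree_open:
  assumes 1: "unfolds T R1 \<psi>1" "open R1" "convex R1" "t \<in> closure R1" "t' \<in> closure R1"
    and 2: "unfolds T R2 \<psi>2" "open R2" "convex R2" "t \<in> closure R2" "t' \<in> closure R2"
    and n: "near t {t'}" and a: "agree T t R1 \<psi>1 R2 \<psi>2" and h: "hexagonal t R2 \<psi>2"
  shows "agree T t' R1 \<psi>1 R2 \<psi>2"
proof -
  obtain \<delta> where d: "\<delta> \<in> ldarts" "t' \<in> ctri \<delta>" "ltri \<delta> \<inter> R1 \<noteq> {}" using closure_star'[OF 1(5,2)] .
  obtain \<delta>' where d': "\<delta>' \<in> ldarts" "t' \<in> ctri \<delta>'" "ltri \<delta>' \<inter> R2 \<noteq> {}" using closure_star'[OF 2(5,2)] .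
  have t: "t \<in> ctri \<delta>" "t \<in> ctri \<delta>'" using n d d' unfolding near_def by blast+
  obtain e where e: "((\<delta>, \<psi>1 \<delta>), (\<delta>', e)) \<in> link T t'"
    using link_exists d d' unfolds_darts(1)[OF 1(1)] by blast
  then have "((\<delta>, \<psi>1 \<delta>), (\<delta>', e)) \<in> link T t" using link_near n by blast
  moreover have "((\<delta>, \<psi>1 \<delta>), (\<delta>', \<psi>2 \<delta>')) \<in> link T t" using agreeD[OF a] d d' t by blast
  ultimately have "((\<delta>', \<psi>2 \<delta>'), (\<delta>', e)) \<in> link T t" using link_sym link_trans by blast
  then have "e = \<psi>2 \<delta>'" using link_unique[OF 2(1) h] d' t by blast
  then show ?thesis using agreeI[OF 1(1-3,5) 2(1-3,5)] d d' e by blast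
qed

text \<open>\<open>hexagonal\<close> is asked for \<open>s < 1\<close> only: the last step uses
  \<open>agree_closed\<close>, so the segment may end at a pentagon.\<close>

lemma agree_propagate:
  assumes 1: "unfolds T R1 \<psi>1" "open R1" "convex R1" and 2: "unfolds T R2 \<psi>2" "open R2" "convex R2"
    and cl: "\<And>s. 0 \<le> s \<Longrightarrow> s \<le> 1 \<Longrightarrow> t + of_real s * v \<in> closure R1 \<inter> closure R2"
    and h: "\<And>s. 0 \<le> s \<Longrightarrow> s < 1 \<Longrightarrow> hexagonal (t + of_real s * v) R2 \<psi>2"
    and a: "agree T t R1 \<psi>1 R2 \<psi>2"
  shows "agree T (t + v) R1 \<psi>1 R2 \<psi>2"
proof -
  define g where "g s = t + of_real s * v" for s :: real
  define P where "P s \<longleftrightarrow> agree T (g s) R1 \<psi>1 R2 \<psi>2" for s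
  have g: "g s \<in> closure R1" "g s \<in> closure R2" if "0 \<le> s" "s \<le> 1" for s using cl that by (auto simp: g_def)
  have cont: "continuous_on UNIV g" unfolding g_def by (intro continuous_intros)
  have all: "P s" if s: "0 \<le> s" "s < 1" for s
  proof (rule connected_induction_simple[of "{0..<1::real}" 0 s P])
    show "P 0" using a by (simp add: P_def g_def)
    fix s :: real assume s: "s \<in> {0..<1}"
    obtain e where e: "e > 0" "near (g s) (ball (g s) e)" using near_ball .
    define U where "U = {0..<1} \<inter> g -` ball (g s) e"
    have "open (g -` ball (g s) e)" using cont by (simp add: open_vimage continuous_on_eq_continuous_within)
    then have "openin (top_of_set {0..<1}) U" unfolding U_def by (simp add: openin_open_Int)
    moreover have "s \<in> U" using s e by (simp add: U_def)
    moreover have "P x \<longleftrightarrow> P s" if x: "x \<in> U" for x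
    proof -
      have "near (g s) {g x}" using x e near_subset unfolding U_def by blast
      moreover have "0 \<le> s" "s \<le> 1" "0 \<le> x" "x \<le> 1" using s x by (auto simp: U_def)
      moreover have "hexagonal (g s) R2 \<psi>2" using h[of s] s by (simp add: g_def)
      ultimately show ?thesis
        unfolding P_def
        using agree_open[OF 1 g(1)[of s] g(1)[of x] 2 g(2)[of s] g(2)[of x]]
          agree_closed[OF 1 g(1)[of s] g(1)[of x] 2 g(2)[of s] g(2)[of x]] by blast
    qed
    ultimately show "\<exists>U. openin (top_of_set {0..<1}) U \<and> s \<in> U \<and> (\<forall>x\<in>U. \<forall>y\<in>U. P x \<longrightarrow> P y)" by blast
  qed (use s in auto)
  obtain e where e: "e > 0" "near (g 1) (ball (g 1) e)" using near_ball .
  \<comment> \<open>The 1 in the denominator covers the case \<open>v = 0\<close>.\<close>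
  define r where "r = min 1 (e / (2 * (norm v + 1)))"
  have r: "0 < r" "r \<le> 1" "r * norm v < e"
  proof -
    show "0 < r" "r \<le> 1" using e by (auto simp: r_def add_nonneg_pos)
    have "r * norm v \<le> r * (norm v + 1)" using \<open>0 < r\<close> by (simp add: algebra_simps)
    also have "\<dots> \<le> (e / (2 * (norm v + 1))) * (norm v + 1)" by (intro mult_right_mono) (auto simp: r_def)
    also have "\<dots> = e / 2" using norm_ge_zero[of v] by (simp add: field_simps add_nonneg_eq_0_iff)
    finally show "r * norm v < e" using e by simp
  qed
  have "g (1 - r) \<in> ball (g 1) e" using r by (simp add: g_def dist_norm algebra_simps norm_mult)
  then have "near (g 1) {g (1 - r)}" using e near_subset by blast
  moreover have "P (1 - r)" using all r by simp
  ultimately have "P 1"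
    unfolding P_def using r agree_closed[OF 1 g(1)[of 1] g(1)[of "1 - r"] 2 g(2)[of 1] g(2)[of "1 - r"]] by simp
  then show ?thesis by (simp add: P_def g_def)
qed

text \<open>At a lattice point agreeing charts show the same vertex of \<open>T\<close>, hence the
  same degree. In this way a corner of one tile is recognised in another.\<close>

lemma agree_orbit:
  assumes t: "t \<in> eisenstein" and 1: "unfolds T R1 \<psi>1" and a: "agree T t R1 \<psi>1 R2 \<psi>2"
    and u: "(t, u) \<in> ldarts" "ltri (t, u) \<inter> R1 \<noteq> {}" and v: "(t, v) \<in> ldarts" "ltri (t, v) \<inter> R2 \<noteq> {}"
  shows "orbit (rot T) (\<psi>2 (t, v)) = orbit (rot T) (\<psi>1 (t, u))"
proof -
  have c: "t \<in> ctri (t, w)" for w by (auto simp: ctri.simps intro: hull_inc)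
  have "(((t, u), \<psi>1 (t, u)), ((t, v), \<psi>2 (t, v))) \<in> link T t" using agreeD[OF a] u v c by blast
  then obtain k where "\<psi>2 (t, v) = (rot T ^^ k) (\<psi>1 (t, u))"
    using link_same_orbit[OF t _ unfolds_darts(1)[OF 1 u]] u(1) by (metis ldarts_iff)
  then have "\<psi>2 (t, v) \<in> orbit (rot T) (\<psi>1 (t, u))"
    using permutes_in_orbit[OF rot_permutes finite_darts] funpow_in_orbit by metis
  then show ?thesis by (rule permutes_orbit_eq[OF rot_permutes finite_darts])
qed

end

lemma star_origin:
  assumes "t \<in> eisenstein" "t \<in> closure R" "open R"
  obtains u where "(t, u) \<in> ldarts" "ltri (t, u) \<inter> R \<noteq> {}"
proof -
  obtain \<delta> where d: "\<delta> \<in> ldarts" "t \<in> ctri \<delta>" "ltri \<delta> \<inter> R \<noteq> {}" using closure_star'[OF assms(2,3)] .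
  obtain u where u: "u \<in> eisenstein_units" "\<delta> \<in> {(t, u), lface (t, u), lface (lface (t, u))}"
    using star_lattice[OF assms(1) d(1,2)] .
  then have "ltri \<delta> = ltri (t, u)" by auto
  then show ?thesis using that[of u] u d assms by auto
qed

section \<open>Two tiles with a common point\<close>

text \<open>The cross product of plane vectors: zero for parallel vectors, and otherwise its sign
  tells on which side of \<open>u\<close> the vector \<open>v\<close> points.\<close>

definition cr :: "complex \<Rightarrow> complex \<Rightarrow> real" where "cr u v = Im (cnj u * v)"

lemma cr_simps [simp]:
  "cr v v = 0" "cr (a + b) c = cr a c + cr b c" "cr a (b + c) = cr a b + cr a c"
  "cr (of_real r * a) b = r * cr a b" "cr a (of_real r * b) = r * cr a b" "cr (- a) b = - cr a b" "cr a (- b) = - cr a b"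
  by (simp_all add: cr_def algebra_simps)

lemma cr_commute: "cr u v = - cr v u"
  by (simp add: cr_def algebra_simps)

lemma cramer:
  assumes "cr v k \<noteq> 0" shows "h = of_real (cr h k / cr v k) * v + of_real (cr v h / cr v k) * k"
proof -
  have "of_real (cr v k) * h = of_real (cr h k) * v + of_real (cr v h) * k"
    by (simp add: complex_eq_iff cr_def algebra_simps)
  then show ?thesis using assms by (simp add: field_simps)
qed

lemma not_collinear_cr:
  assumes "\<not> collinear {a, b, c}" shows "cr (b - a) (c - a) \<noteq> 0"
proof
  assume cr0: "cr (b - a) (c - a) = 0"
  have ba: "b - a \<noteq> 0" using assms by auto
  have "cnj (b - a) * (c - a) = of_real (Re (cnj (b - a) * (c - a)))"
    using cr0 by (simp add: complex_eq_iff cr_def)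
  then obtain r where "cnj (b - a) * (c - a) = of_real r" by blast
  then have "(cnj (b - a) * (b - a)) * (c - a) = of_real r * (b - a)" by (simp add: mult_ac)
  moreover have "cnj (b - a) * (b - a) = of_real ((norm (b - a))\<^sup>2)"
    using complex_norm_square[of "b - a"] by (simp add: mult.commute)
  ultimately have "of_real ((norm (b - a))\<^sup>2) * (c - a) = of_real r * (b - a)" by metis
  moreover have "(norm (b - a))\<^sup>2 \<noteq> 0" using ba by simp
  ultimately have "c - a = of_real (r / (norm (b - a))\<^sup>2) * (b - a)"
    by (metis nonzero_mult_div_cancel_left of_real_divide of_real_eq_0_iff times_divide_eq_left)
  then have "collinear {0, b - a, c - a}"
    unfolding collinear_lemma by (metis scaleR_conv_of_real)
  then have "collinear {b, a, c}" by (simp add: collinear_3[of b a c])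
  then show False using assms by (simp add: insert_commute)
qed

lemma interior_hull_iff:
  fixes a b c :: complex
  assumes "\<not> collinear {a, b, c}"
  shows "interior (convex hull {a, b, c}) =
    {v. \<exists>x y z. 0 < x \<and> 0 < y \<and> 0 < z \<and> x + y + z = 1 \<and> x *\<^sub>R a + y *\<^sub>R b + z *\<^sub>R c = v}"
  by (rule interior_convex_hull_3_minimal[OF assms]) simp

text \<open>The corners in a freely chosen order, so that any side can be called \<open>a b\<close>,
  with \<open>c\<close> as the opposite corner.\<close>

definition side :: "'d tile \<Rightarrow> complex \<Rightarrow> complex \<Rightarrow> complex \<Rightarrow> bool" where
  "side P a b c \<longleftrightarrow> corner_set (corners P) = {a, b, c} \<and> triangle (corners P) = convex hull {a, b, c}"

definition region :: "'d tile \<Rightarrow> complex set" where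
  "region P = interior (triangle (corners P))"

lemma side_swap: "side P a b c \<Longrightarrow> side P b a c" "side P a b c \<Longrightarrow> side P b c a"
  by (simp_all add: side_def insert_commute)

lemma tile_side: obtains a b c where "side P a b c"
  by (cases "corners P") (auto simp: side_def intro: that)

lemma region_props: "open (region P)" "convex (region P)" "region P \<subseteq> triangle (corners P)"
  by (cases "corners P"; simp add: region_def convex_interior interior_subset)+

lemma compact_triangle: "compact (triangle (corners P))" "convex (triangle (corners P))"
  by (cases "corners P"; simp add: finite_imp_compact_convex_hull)+

locale tile = triangulation T for T :: "'d cmap" +
  fixes P :: "'d tile"
  assumes master: "master_tile T P"
begin

abbreviation "Tri \<equiv> triangle (corners P)"
abbreviation "Cor \<equiv> corner_set (corners P)"

lemma side_nc: assumes "side P a b c" shows "\<not> collinear {a, b, c}"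
  using assms master by (simp add: side_def master_tile_def)

lemma Cor_lattice: "Cor \<subseteq> eisenstein" using master by (simp add: master_tile_def)

lemma unf: "unfolds T (region P) (chart P)" using master by (simp add: master_tile_def region_def)

lemma region_nonempty: "region P \<noteq> {}"
proof -
  obtain a b c where s: "side P a b c" by (rule tile_side)
  have "(1/3) *\<^sub>R a + (1/3) *\<^sub>R b + (1/3) *\<^sub>R c \<in> interior (convex hull {a, b, c})"
    unfolding interior_hull_iff[OF side_nc[OF s]]
    by (intro CollectI exI[of _ "1/3"]) auto
  then show ?thesis using s by (auto simp: region_def side_def)
qed

lemma closure_region: "closure (region P) = Tri"
  using convex_closure_interior[OF compact_triangle(2)[of P]] region_nonempty
    closure_closed[OF compact_imp_closed[OF compact_triangle(1)[of P]]]
  unfolding region_def by simp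

lemma Cor_subset: "Cor \<subseteq> Tri"
  by (cases "corners P") (auto simp: hull_inc)

lemma corner_degree:
  assumes "(t, u) \<in> ldarts" "ltri (t, u) \<inter> region P \<noteq> {}" "t \<in> Tri"
  shows "card (orbit (rot T) (chart P (t, u))) = 5 \<longleftrightarrow> t \<in> Cor"
  using master assms unfolding master_tile_def tile_darts_def region_def by fastforce

lemma boundary_side:
  assumes "t \<in> Tri" "t \<notin> region P" "t \<notin> Cor"
  obtains a b c \<mu> where "side P a b c" "0 < \<mu>" "\<mu> < 1" "t = a + of_real \<mu> * (b - a)"
proof -
  obtain a b c where s: "side P a b c" by (rule tile_side)
  have "t \<in> convex hull {a, b, c}" using assms s by (simp add: side_def)
  then obtain x y z where xyz: "0 \<le> x" "0 \<le> y" "0 \<le> z" "x + y + z = 1" "t = x *\<^sub>R a + y *\<^sub>R b + z *\<^sub>R c"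
    unfolding convex_hull_3 by blast
  have n: "t \<noteq> a" "t \<noteq> b" "t \<noteq> c" using assms s by (auto simp: side_def)
  have "t \<notin> interior (convex hull {a, b, c})" using assms(2) s by (simp add: side_def region_def)
  then have "\<not> (0 < x \<and> 0 < y \<and> 0 < z)" unfolding interior_hull_iff[OF side_nc[OF s]] using xyz by blast
  then consider "x = 0" | "y = 0" | "z = 0" using xyz by linarith
  then show ?thesis
  proof cases
    case 1
    have *: "y = 1 - z" using 1 xyz(4) by simp
    have "t = b + of_real z * (c - b)" using xyz(5) unfolding * 1 by (simp add: scaleR_conv_of_real algebra_simps)
    moreover from this have "z \<noteq> 0" "z \<noteq> 1" using n by auto
    ultimately show ?thesis using that[of b c a z] side_swap(2)[OF s] xyz 1 by auto
  next
    case 2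
    have *: "z = 1 - x" using 2 xyz(4) by simp
    have "t = c + of_real x * (a - c)" using xyz(5) unfolding * 2 by (simp add: scaleR_conv_of_real algebra_simps)
    moreover from this have "x \<noteq> 0" "x \<noteq> 1" using n by auto
    ultimately show ?thesis using that[of c a b x] side_swap(2)[OF side_swap(2)[OF s]] xyz 2 by auto
  next
    case 3
    have *: "x = 1 - y" using 3 xyz(4) by simp
    have "t = a + of_real y * (b - a)" using xyz(5) unfolding * 3 by (simp add: scaleR_conv_of_real algebra_simps)
    moreover from this have "y \<noteq> 0" "y \<noteq> 1" using n by auto
    ultimately show ?thesis using that[of a b c y] s xyz 3 by auto
  qed
qed

lemma side_in:
  assumes "side P a b c" "0 \<le> \<mu>" "\<mu> \<le> 1" shows "a + of_real \<mu> * (b - a) \<in> Tri"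
proof -
  have "a + of_real \<mu> * (b - a) = (1 - \<mu>) *\<^sub>R a + \<mu> *\<^sub>R b + 0 *\<^sub>R c"
    by (simp add: scaleR_conv_of_real algebra_simps)
  moreover have "(1 - \<mu>) *\<^sub>R a + \<mu> *\<^sub>R b + 0 *\<^sub>R c \<in> convex hull {a, b, c}"
    unfolding convex_hull_3 using assms by (intro CollectI exI[of _ "1 - \<mu>"] exI[of _ \<mu>] exI[of _ 0]) auto
  ultimately show ?thesis using assms by (simp add: side_def)
qed

lemma side_not_corner:
  assumes s: "side P a b c" and m: "0 < \<mu>" "\<mu> < 1" shows "a + of_real \<mu> * (b - a) \<notin> Cor"
proof
  assume "a + of_real \<mu> * (b - a) \<in> Cor"
  then consider "of_real \<mu> * (b - a) = 0" | "of_real (1 - \<mu>) * (b - a) = 0" | "c - a = of_real \<mu> * (b - a)"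
    using s by (auto simp: side_def algebra_simps)
  then have "cr (b - a) (c - a) = 0"
  proof cases
    case 1 then show ?thesis using m by (auto simp: cr_def)
  next
    case 2 then show ?thesis using m by (auto simp: cr_def simp del: of_real_diff)
  next
    case 3 then show ?thesis by (simp only: cr_simps)
  qed
  then show False using not_collinear_cr side_nc[OF s] by blast
qed

text \<open>The condition on \<open>cr\<close> says that \<open>h\<close> points to the side of the
  line \<open>a b\<close> on which \<open>c\<close> lies. In barycentric coordinates the weight of
  \<open>c\<close> grows from 0, while the other two stay positive for a short time.\<close>

lemma inward:
  assumes s: "side P a b c" and m: "0 < \<mu>" "\<mu> < 1" and t: "t = a + of_real \<mu> * (b - a)"
    and pos: "cr (b - a) h / cr (b - a) (c - a) > 0"
  obtains r where "r > 0" "\<And>s. 0 < s \<Longrightarrow> s < r \<Longrightarrow> t + of_real s * h \<in> region P"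
proof -
  define \<alpha> \<gamma> where "\<alpha> = cr h (c - a) / cr (b - a) (c - a)" and "\<gamma> = cr (b - a) h / cr (b - a) (c - a)"
  have h: "h = of_real \<alpha> * (b - a) + of_real \<gamma> * (c - a)"
    unfolding \<alpha>_def \<gamma>_def using cramer not_collinear_cr[OF side_nc[OF s]] by blast
  \<comment> \<open>\<open>K\<close> bounds the speed at which the weights of \<open>a\<close> and
    \<open>b\<close> change; the 1 keeps it positive.\<close>
  define K where "K = 1 + \<bar>\<alpha>\<bar> + \<bar>\<gamma>\<bar>"
  define r where "r = min \<mu> (1 - \<mu>) / K"
  have K: "K \<ge> 1" by (simp add: K_def)
  have "t + of_real q * h \<in> region P" if q: "0 < q" "q < r" for q
  proof -
    have "q * K < min \<mu> (1 - \<mu>)" using q K by (simp add: r_def field_simps)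
    then have qK: "q + q * \<bar>\<alpha>\<bar> + q * \<bar>\<gamma>\<bar> < \<mu>" "q + q * \<bar>\<alpha>\<bar> + q * \<bar>\<gamma>\<bar> < 1 - \<mu>"
      by (auto simp: K_def algebra_simps)
    have b: "\<bar>q * \<alpha>\<bar> = q * \<bar>\<alpha>\<bar>" "\<bar>q * \<gamma>\<bar> = q * \<bar>\<gamma>\<bar>" "0 \<le> q * \<bar>\<alpha>\<bar>" "0 \<le> q * \<bar>\<gamma>\<bar>" using q by (auto simp: abs_mult)
    have gpos: "\<gamma> > 0" using pos by (simp add: \<gamma>_def)
    have p: "0 < 1 - \<mu> - q * \<alpha> - q * \<gamma>" "0 < \<mu> + q * \<alpha>" "0 < q * \<gamma>"
      using b(1,3,4) qK q gpos abs_ge_self[of "q * \<alpha>"] abs_ge_minus_self[of "q * \<alpha>"] by (simp_all, linarith+)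
    have "t + of_real q * h = (1 - \<mu> - q * \<alpha> - q * \<gamma>) *\<^sub>R a + (\<mu> + q * \<alpha>) *\<^sub>R b + (q * \<gamma>) *\<^sub>R c"
      by (simp add: t h scaleR_conv_of_real algebra_simps)
    then have "t + of_real q * h \<in> interior (convex hull {a, b, c})"
      unfolding interior_hull_iff[OF side_nc[OF s]] using p
      by (intro CollectI exI[of _ "1 - \<mu> - q * \<alpha> - q * \<gamma>"] exI[of _ "\<mu> + q * \<alpha>"] exI[of _ "q * \<gamma>"]) auto
    then show ?thesis using s by (simp add: region_def side_def)
  qed
  moreover have "r > 0" using m K by (simp add: r_def)
  ultimately show ?thesis using that by blast
qed

end

locale two_tiles = T1: tile T P1 + T2: tile T P2 for T :: "'d cmap" and P1 P2 +
  assumes degree: "\<And>d. d \<in> darts T \<Longrightarrow> card (orbit (rot T) d) = 5 \<or> card (orbit (rot T) d) = 6"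
begin

abbreviation "agr t \<equiv> agree T t (region P1) (chart P1) (region P2) (chart P2)"

lemma hexagonal_noncorner:
  assumes "t \<in> T2.Tri" "t \<notin> T2.Cor" shows "T1.hexagonal t (region P2) (chart P2)"
  unfolding T1.hexagonal_def
proof (intro impI allI)
  fix u assume t: "t \<in> eisenstein" and u: "(t, u) \<in> ldarts" "ltri (t, u) \<inter> region P2 \<noteq> {}"
  have "card (orbit (rot T) (chart P2 (t, u))) \<noteq> 5" using T2.corner_degree[OF u assms(1)] assms(2) by blast
  then have "card (orbit (rot T) (chart P2 (t, u))) = 6"
    using degree T1.unfolds_darts(1)[OF T2.unf u] by blast
  then show "(rot T ^^ 6) (chart P2 (t, u)) = chart P2 (t, u)"
    using orbit_card_funpow(1)[OF T1.rot_permutes T1.finite_darts] by metis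
qed

lemma agree_corner:
  assumes a: "agr t" and t: "t \<in> eisenstein" "t \<in> T1.Tri" "t \<in> T2.Tri"
  shows "t \<in> T1.Cor \<longleftrightarrow> t \<in> T2.Cor"
proof -
  obtain u where u: "(t, u) \<in> ldarts" "ltri (t, u) \<inter> region P1 \<noteq> {}"
    using star_origin[of t "region P1"] t T1.closure_region region_props by metis
  obtain v where v: "(t, v) \<in> ldarts" "ltri (t, v) \<inter> region P2 \<noteq> {}"
    using star_origin[of t "region P2"] t T2.closure_region region_props by metis
  have "orbit (rot T) (chart P2 (t, v)) = orbit (rot T) (chart P1 (t, u))"
    using T1.agree_orbit[OF t(1) T1.unf a u v] .
  then show ?thesis using T1.corner_degree[OF u t(2)] T2.corner_degree[OF v t(3)] by metis
qed

text \<open>Walk from \<open>t\<close> to \<open>b1\<close> along the common line. No corner of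
  \<open>P2\<close> is met before the end, so agreement is carried along; at \<open>b1\<close> the
  degree 5 known from \<open>P1\<close> makes it a corner of \<open>P2\<close> too.\<close>

lemma corner_transfer:
  assumes a: "agr t"
    and s1: "side P1 a1 b1 c1" and m1: "0 < \<mu>1" "\<mu>1 < 1" "t = a1 + of_real \<mu>1 * (b1 - a1)"
    and s2: "side P2 a2 b2 c2" and m2: "0 < \<mu>2" "\<mu>2 < 1" "t = a2 + of_real \<mu>2 * (b2 - a2)"
    and l: "\<mu>2 \<le> \<nu>" "\<nu> \<le> 1" "b1 = a2 + of_real \<nu> * (b2 - a2)"
  shows "b1 \<in> T1.Cor \<inter> T2.Cor"
proof -
  have b1: "b1 \<in> T1.Cor" "b1 \<in> eisenstein" using s1 T1.Cor_lattice by (auto simp: side_def)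
  have g1: "t + of_real s * (b1 - t) = a1 + of_real (\<mu>1 + s * (1 - \<mu>1)) * (b1 - a1)" for s
    by (simp add: m1(3) algebra_simps)
  have g2: "t + of_real s * (b1 - t) = a2 + of_real (\<mu>2 + s * (\<nu> - \<mu>2)) * (b2 - a2)" for s
    by (simp add: m2(3) l(3) algebra_simps)
  have in1: "t + of_real s * (b1 - t) \<in> T1.Tri" if "0 \<le> s" "s \<le> 1" for s
    unfolding g1 by (rule T1.side_in[OF s1]) (use m1 that in \<open>auto simp: mult_left_le_one_le add_increasing2\<close>,
      smt (verit) mult_left_le_one_le)
  have s2': "0 < \<mu>2 + s * (\<nu> - \<mu>2)" "\<mu>2 + s * (\<nu> - \<mu>2) \<le> \<nu>" if "0 \<le> s" "s \<le> 1" for s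
  proof -
    have "0 \<le> s * (\<nu> - \<mu>2)" "s * (\<nu> - \<mu>2) \<le> \<nu> - \<mu>2" using that l by (auto intro: mult_left_le_one_le)
    then show "0 < \<mu>2 + s * (\<nu> - \<mu>2)" "\<mu>2 + s * (\<nu> - \<mu>2) \<le> \<nu>" using m2 by linarith+
  qed
  have in2: "t + of_real s * (b1 - t) \<in> T2.Tri" if "0 \<le> s" "s \<le> 1" for s
    unfolding g2 by (rule T2.side_in[OF s2]) (use s2'[OF that] l in linarith)+
  have nc: "t + of_real s * (b1 - t) \<notin> T2.Cor" if "0 \<le> s" "s < 1" for s
  proof -
    have "\<mu>2 + s * (\<nu> - \<mu>2) < 1"
    proof (cases "\<nu> = \<mu>2")
      case True then show ?thesis using m2 by simp
    next
      case False
      then have "s * (\<nu> - \<mu>2) < 1 * (\<nu> - \<mu>2)" using that l by (intro mult_strict_right_mono) auto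
      then show ?thesis using l(2) by (simp add: algebra_simps)
    qed
    then show ?thesis unfolding g2 using T2.side_not_corner[OF s2] s2'(1)[of s] that by (metis less_imp_le)
  qed
  have "agr (t + (b1 - t))"
  proof (rule T1.agree_propagate[OF T1.unf _ _ T2.unf _ _ _ _ a])
    show "t + of_real s * (b1 - t) \<in> closure (region P1) \<inter> closure (region P2)" if "0 \<le> s" "s \<le> 1" for s
      using in1 in2 that by (simp add: T1.closure_region T2.closure_region)
    show "T1.hexagonal (t + of_real s * (b1 - t)) (region P2) (chart P2)" if "0 \<le> s" "s < 1" for s
      using hexagonal_noncorner in2 nc that by simp
  qed (auto simp: region_props)
  then have "agr b1" by simp
  moreover have "b1 \<in> T1.Tri" "b1 \<in> T2.Tri" using in1[of 1] in2[of 1] by simp_all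
  ultimately show ?thesis using agree_corner b1 by blast
qed

end

lemma two_tiles_sym: "two_tiles T P1 P2 \<Longrightarrow> two_tiles T P2 P1"
  by (simp add: two_tiles_def two_tiles_axioms_def)

context two_tiles
begin

text \<open>The tile whose side ends first supplies the corner. The case distinction compares what
  is left of the two sides beyond \<open>t\<close>, in units of \<open>b1 - a1\<close>.\<close>

lemma common_corner_parallel:
  assumes a: "agr t"
    and s1: "side P1 a1 b1 c1" and m1: "0 < \<mu>1" "\<mu>1 < 1" "t = a1 + of_real \<mu>1 * (b1 - a1)"
    and s2: "side P2 a2 b2 c2" and m2: "0 < \<mu>2" "\<mu>2 < 1" "t = a2 + of_real \<mu>2 * (b2 - a2)"
    and k: "b2 - a2 = of_real \<kappa> * (b1 - a1)" "\<kappa> > 0"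
  shows "T1.Cor \<inter> T2.Cor \<noteq> {}"
proof (cases "1 - \<mu>1 \<le> (1 - \<mu>2) * \<kappa>")
  case True
  define \<nu> where "\<nu> = \<mu>2 + (1 - \<mu>1) / \<kappa>"
  have "b1 = t + of_real (1 - \<mu>1) * (b1 - a1)" by (simp add: m1(3) algebra_simps)
  also have "\<dots> = t + of_real ((1 - \<mu>1) / \<kappa>) * (b2 - a2)" using k by simp
  also have "\<dots> = a2 + of_real \<nu> * (b2 - a2)" by (simp add: m2(3) \<nu>_def algebra_simps)
  finally have "b1 = a2 + of_real \<nu> * (b2 - a2)" .
  moreover have "\<mu>2 \<le> \<nu>" "\<nu> \<le> 1" using True m1 k by (auto simp: \<nu>_def field_simps)
  ultimately show ?thesis using corner_transfer[OF a s1 m1 s2 m2] by blast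
next
  case False
  interpret S: two_tiles T P2 P1 using two_tiles_sym two_tiles_axioms .
  define \<nu> where "\<nu> = \<mu>1 + (1 - \<mu>2) * \<kappa>"
  have "b2 = t + of_real (1 - \<mu>2) * (b2 - a2)" by (simp add: m2(3) algebra_simps)
  also have "\<dots> = t + of_real ((1 - \<mu>2) * \<kappa>) * (b1 - a1)" using k by simp
  also have "\<dots> = a1 + of_real \<nu> * (b1 - a1)" by (simp add: m1(3) \<nu>_def algebra_simps)
  finally have "b2 = a1 + of_real \<nu> * (b1 - a1)" .
  moreover have "\<mu>1 \<le> \<nu>" "\<nu> \<le> 1" using False m2 k by (auto simp: \<nu>_def)
  ultimately show ?thesis using S.corner_transfer[OF T1.agree_sym[OF a] s2 m2 s1 m1] by blast
qed

text \<open>If the interiors overlap near \<open>t\<close>, then \<open>disj\<close> gives equal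
  corners. Otherwise \<open>t\<close> lies on a side of each tile, and these sides are parallel,
  since otherwise some direction would lead from \<open>t\<close> into both interiors.\<close>

lemma common_corner:
  assumes t: "t \<notin> eisenstein" "t \<in> T1.Tri" "t \<in> T2.Tri" and a: "agr t"
    and disj: "\<And>\<delta> z. \<delta> \<in> ldarts \<Longrightarrow> z \<in> ltri \<delta> \<inter> region P1 \<inter> region P2 \<Longrightarrow> chart P1 \<delta> = chart P2 \<delta> \<Longrightarrow>
      corners P1 = corners P2"
  shows "T1.Cor \<inter> T2.Cor \<noteq> {}"
proof -
  obtain e where e: "e > 0" "near t (ball t e)" using near_ball .
  show ?thesis
  proof (cases "region P1 \<inter> region P2 \<inter> ball t e = {}")
    case False
    then obtain q where q: "q \<in> region P1 \<inter> region P2 \<inter> ball t e" by blast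
    obtain \<delta> where d: "\<delta> \<in> ldarts" "q \<in> ctri \<delta>" using ctri_cover by blast
    have td: "t \<in> ctri \<delta>" using e d q unfolding near_def by blast
    have "open (region P1 \<inter> region P2 \<inter> ball t e)" using region_props by auto
    then obtain z where z: "z \<in> ltri \<delta>" "z \<in> region P1 \<inter> region P2 \<inter> ball t e"
      using ltri_meets[OF d(1) _ d(2) q] by blast
    have m: "ltri \<delta> \<inter> region P1 \<noteq> {}" "ltri \<delta> \<inter> region P2 \<noteq> {}" using z by blast+
    have "((\<delta>, chart P1 \<delta>), (\<delta>, chart P2 \<delta>)) \<in> link T t" using agreeD[OF a] d td m by blast
    then have "chart P1 \<delta> = chart P2 \<delta>"
      using T1.link_unique_nonlattice[OF t(1) d(1) td] T1.unfolds_darts(1)[OF T1.unf d(1) m(1)] by metis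
    then have "corners P1 = corners P2" using disj d z by blast
    moreover have "T1.Cor \<noteq> {}" by (cases "corners P1") auto
    ultimately show ?thesis by simp
  next
    case True
    have nb: "R1 \<inter> R2 \<inter> ball t e \<noteq> {}" if "t \<in> R1" "open R1" "t \<in> closure R2" for R1 R2
    proof -
      have "t \<in> (R1 \<inter> ball t e) \<inter> closure R2" using that e by simp
      then have "(R1 \<inter> ball t e) \<inter> R2 \<noteq> {}"
        using open_Int_closure_eq_empty[of "R1 \<inter> ball t e" R2] that(2) by blast
      then show ?thesis by blast
    qed
    have n1: "t \<notin> region P1" using nb[of "region P1" "region P2"] True t region_props T2.closure_region by metis
    have n2: "t \<notin> region P2"
      using nb[of "region P2" "region P1"] True t region_props T1.closure_region by (metis Int_commute)
    have nC: "t \<notin> T1.Cor" "t \<notin> T2.Cor" using t T1.Cor_lattice T2.Cor_lattice by blast+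
    obtain a1 b1 c1 \<mu>1 where s1: "side P1 a1 b1 c1" and m1: "0 < \<mu>1" "\<mu>1 < 1" "t = a1 + of_real \<mu>1 * (b1 - a1)"
      using T1.boundary_side[OF t(2) n1 nC(1)] .
    obtain a2 b2 c2 \<mu>2 where s2: "side P2 a2 b2 c2" and m2: "0 < \<mu>2" "\<mu>2 < 1" "t = a2 + of_real \<mu>2 * (b2 - a2)"
      using T2.boundary_side[OF t(3) n2 nC(2)] .
    define v1 v2 where "v1 = b1 - a1" and "v2 = b2 - a2"
    have k1: "cr v1 (c1 - a1) \<noteq> 0" and k2: "cr v2 (c2 - a2) \<noteq> 0"
      using not_collinear_cr T1.side_nc[OF s1] T2.side_nc[OF s2] by (auto simp: v1_def v2_def)
    have "cr v1 v2 = 0"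
    proof (rule ccontr)
      assume c: "cr v1 v2 \<noteq> 0"
      \<comment> \<open>Cramer's solution of \<open>cr v1 h = cr v1 (c1 - a1)\<close> and
        \<open>cr v2 h = cr v2 (c2 - a2)\<close>, so \<open>h\<close> points inward for both
        tiles.\<close>
      define h where "h = of_real (- cr v2 (c2 - a2) / cr v1 v2) * v1 + of_real (cr v1 (c1 - a1) / cr v1 v2) * v2"
      have "cr v1 h = cr v1 (c1 - a1)" unfolding h_def cr_simps using c by (simp del: of_real_divide of_real_minus)
      then have "cr (b1 - a1) h / cr (b1 - a1) (c1 - a1) > 0" using k1 by (simp add: v1_def)
      then obtain r1 where r1: "r1 > 0" "\<And>s. 0 < s \<Longrightarrow> s < r1 \<Longrightarrow> t + of_real s * h \<in> region P1"
        using T1.inward[OF s1 m1] by blast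
      have "cr v2 h = cr v2 (c2 - a2)" unfolding h_def cr_simps using c cr_commute[of v2 v1]
        by (simp del: of_real_divide of_real_minus)
      then have "cr (b2 - a2) h / cr (b2 - a2) (c2 - a2) > 0" using k2 by (simp add: v2_def)
      then obtain r2 where r2: "r2 > 0" "\<And>s. 0 < s \<Longrightarrow> s < r2 \<Longrightarrow> t + of_real s * h \<in> region P2"
        using T2.inward[OF s2 m2] by blast
      define s where "s = min (min r1 r2 / 2) (e / (2 * (norm h + 1)))"
      have hp: "norm h + 1 > 0" by (simp add: add_nonneg_pos)
      have "e / (2 * (norm h + 1)) > 0" using e hp by simp
      then have s: "0 < s" "s < r1" "s < r2" using r1(1) r2(1) unfolding s_def by linarith+
      have "s * norm h \<le> s * (norm h + 1)" using s by (simp add: algebra_simps)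
      also have "\<dots> \<le> (e / (2 * (norm h + 1))) * (norm h + 1)" using hp by (intro mult_right_mono) (auto simp: s_def)
      also have "\<dots> = e / 2" using hp by (simp add: field_simps)
      finally have "t + of_real s * h \<in> ball t e" using s e by (simp add: dist_norm norm_mult)
      then show False using r1(2)[of s] r2(2)[of s] s True by blast
    qed
    moreover have v1: "v1 \<noteq> 0" using k1 by (auto simp: cr_def)
    ultimately have "v2 = of_real (cr v2 (c1 - a1) / cr v1 (c1 - a1)) * v1"
      using cramer[OF k1, of v2] by simp
    then obtain \<kappa> where k: "v2 = of_real \<kappa> * v1" by blast
    have "\<kappa> \<noteq> 0" using k k2 by (auto simp: cr_def)
    then consider "\<kappa> > 0" | "- \<kappa> > 0" by linarith
    then show ?thesis
    proof cases
      case 1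
      then show ?thesis using common_corner_parallel[OF a s1 m1 s2 m2 k[unfolded v1_def v2_def]] by blast
    next
      case 2
      have m2': "0 < 1 - \<mu>2" "1 - \<mu>2 < 1" "t = b2 + of_real (1 - \<mu>2) * (a2 - b2)"
        using m2 by (simp_all add: algebra_simps)
      have k': "a2 - b2 = of_real (- \<kappa>) * (b1 - a1)" using k by (simp add: v1_def v2_def algebra_simps)
      show ?thesis using common_corner_parallel[OF a s1 m1 side_swap(1)[OF s2] m2' k' 2] .
    qed
  qed
qed

end

section \<open>Residues modulo \<open>1 + \<omega>\<close>\<close>

text \<open>
  Since \<open>\<omega> \<equiv> -1\<close>, the ring of Eisenstein integers modulo \<open>1 + \<omega>\<close> is the field with three elements.
\<close>

definition res :: "complex \<Rightarrow> int" where "res z = \<lfloor>xc z\<rfloor> - \<lfloor>yc z\<rfloor>"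

lemma res_lat [simp]: "res (lat m n) = m - n"
  by (simp add: res_def)

lemma eisenstein_latE: assumes "z \<in> eisenstein" obtains m n where "z = lat m n"
  using assms by (auto simp: eisenstein_lat)

lemma res_add: "a \<in> eisenstein \<Longrightarrow> b \<in> eisenstein \<Longrightarrow> res (a + b) = res a + res b"
  and res_diff: "a \<in> eisenstein \<Longrightarrow> b \<in> eisenstein \<Longrightarrow> res (a - b) = res a - res b"
  and res_minus: "a \<in> eisenstein \<Longrightarrow> res (- a) = - res a"
  by (auto simp: res_def elim!: eisenstein_latE)

lemma res_mult:
  assumes "a \<in> eisenstein" "b \<in> eisenstein" shows "[res (a * b) = res a * res b] (mod 3)"
proof -
  obtain k l m n where kl: "a = lat k l" "b = lat m n" using assms by (metis eisenstein_latE)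
  have "a * b = lat (k * m - l * n) (l * m + (k + l) * n)"
    unfolding kl lat_def by (rule eisenstein_mult)
  then have "res (a * b) = res a * res b - 3 * (l * n)" by (simp add: kl algebra_simps)
  then show ?thesis by (simp add: cong_iff_dvd_diff)
qed

lemma res_units: assumes "u \<in> eisenstein_units" shows "[res u * res u = 1] (mod 3)"
proof -
  have "u \<in> {lat 1 0, lat 0 1, lat (-1) 1, lat (-1) 0, lat 0 (-1), lat 1 (-1)}"
    using assms by (auto simp: units_eq lat_def)
  then show ?thesis by (elim insertE emptyE) (simp_all add: cong_def)
qed

lemma res_1 [simp]: "res 1 = 1"
  by (simp add: res_def)

lemma res_omega2: assumes "u \<in> eisenstein" shows "[res (omega\<^sup>2 * u) = res u] (mod 3)"
proof -
  obtain m n where u: "u = lat m n" using assms by (rule eisenstein_latE)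
  have "omega\<^sup>2 * u = lat (- m - n) m"
    by (simp add: u lat_def omega_square omega_mult_self algebra_simps)
  then have "res (omega\<^sup>2 * u) - res u = 3 * (- m)" by (simp add: u)
  then show ?thesis by (simp add: cong_iff_dvd_diff)
qed

text \<open>The cases are the six closed sectors between consecutive units. Existence keeps the
  universal statement in \<open>coxeter_res\<close> from being vacuous.\<close>

lemma coxeter_coordinates_exist:
  assumes "v \<in> eisenstein" obtains a b where "coxeter_coordinates v a b"
proof -
  obtain m n where v: "v = lat m n" using assms by (rule eisenstein_latE)
  have U: "1 \<in> eisenstein_units" "omega \<in> eisenstein_units" "omega - 1 \<in> eisenstein_units"
    "-1 \<in> eisenstein_units" "-omega \<in> eisenstein_units" "1 - omega \<in> eisenstein_units" by (simp_all add: units_eq)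
  have *: "coxeter_coordinates v (nat a) (nat b)"
    if "u \<in> eisenstein_units" "0 \<le> a" "0 \<le> b" "v = u * (of_int a + of_int b * omega)" for u a b
    using that unfolding coxeter_coordinates_def by (intro bexI[of _ u]) auto
  consider "0 \<le> m" "0 \<le> n" | "m \<le> 0" "0 \<le> m + n" | "0 \<le> n" "m + n \<le> 0"
    | "m \<le> 0" "n \<le> 0" | "0 \<le> m" "m + n \<le> 0" | "n \<le> 0" "0 \<le> m + n" by linarith
  then show ?thesis
  proof cases
    case 1 then show ?thesis using that *[OF U(1), of m n] by (simp add: v lat_def)
  next
    case 2
    then show ?thesis using that *[OF U(2), of "m + n" "- m"]
      by (simp add: v lat_def omega_mult_self algebra_simps)
  next
    case 3
    then show ?thesis using that *[OF U(3), of n "- m - n"]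
      by (simp add: v lat_def omega_mult_self algebra_simps)
  next
    case 4 then show ?thesis using that *[OF U(4), of "- m" "- n"] by (simp add: v lat_def algebra_simps)
  next
    case 5
    then show ?thesis using that *[OF U(5), of "- m - n" m]
      by (simp add: v lat_def omega_mult_self algebra_simps)
  next
    case 6
    then show ?thesis using that *[OF U(6), of "- n" "m + n"]
      by (simp add: v lat_def omega_mult_self algebra_simps)
  qed
qed

text \<open>Multiplication by a unit changes the residue modulo 3 only by a sign.\<close>

lemma coxeter_res:
  assumes v: "v \<in> eisenstein"
  shows "(\<forall>a b. coxeter_coordinates v a b \<longrightarrow> [a = b] (mod 3)) \<longleftrightarrow> 3 dvd res v"
proof -
  have *: "[a = b] (mod 3) \<longleftrightarrow> 3 dvd res v" if c: "coxeter_coordinates v a b" for a b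
  proof -
    obtain u where u: "u \<in> eisenstein_units" "v = u * lat (int a) (int b)"
      using c by (auto simp: coxeter_coordinates_def lat_def)
    have L: "lat (int a) (int b) \<in> eisenstein" by (auto simp: eisenstein_lat)
    have r: "[res v = res u * (int a - int b)] (mod 3)"
      using res_mult[OF _ L, of u] u by simp
    have "[res u * res v = res u * res u * (int a - int b)] (mod 3)"
      using cong_mult[OF cong_refl r, of "res u"] by (simp add: mult.assoc)
    also have "[res u * res u * (int a - int b) = 1 * (int a - int b)] (mod 3)"
      by (rule cong_mult[OF res_units[OF u(1)] cong_refl])
    finally have r': "[res u * res v = int a - int b] (mod 3)" by simp
    have "3 dvd res v \<longleftrightarrow> 3 dvd (int a - int b)"
      using cong_dvd_iff[OF r] cong_dvd_iff[OF r'] by (metis dvd_mult)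
    also have "\<dots> \<longleftrightarrow> [int a = int b] (mod int 3)" by (simp add: cong_iff_dvd_diff)
    also have "\<dots> \<longleftrightarrow> [a = b] (mod 3)" by (simp only: cong_int_iff)
    finally show ?thesis by simp
  qed
  obtain a b where "coxeter_coordinates v a b" using coxeter_coordinates_exist[OF v] .
  then show ?thesis using * by blast
qed

section \<open>Colourings\<close>

text \<open>
  \<open>\<sigma> d = 0, 1, 2\<close> says that the distinguished vertex of the triangle to the left of \<open>d\<close> is the origin
  of \<open>d\<close>, the end of \<open>d\<close>, or the third vertex.
\<close>

definition colouring :: "'d cmap \<Rightarrow> ('d \<Rightarrow> int) \<Rightarrow> bool" where
  "colouring T \<sigma> \<longleftrightarrow> (\<forall>d\<in>darts T.
     [\<sigma> (face T d) = \<sigma> d - 1] (mod 3) \<and> [\<sigma> (opp T d) = 1 - \<sigma> d] (mod 3))"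

context triangulation
begin

text \<open>The sign exchanges 1 and 2: around a vertex that is not distinguished, every second
  neighbour is.\<close>

lemma colouring_rot:
  assumes c: "colouring T \<sigma>" and d: "d \<in> darts T" shows "[\<sigma> (rot T d) = - \<sigma> d] (mod 3)"
proof -
  have "rot T d = opp T (face T (face T d))" using opp_face_face d by simp
  then have "[\<sigma> (rot T d) = 1 - \<sigma> (face T (face T d))] (mod 3)" using c d by (simp add: colouring_def)
  then have 1: "3 dvd \<sigma> (rot T d) - (1 - \<sigma> (face T (face T d)))" by (simp add: cong_iff_dvd_diff)
  have 2: "3 dvd \<sigma> (face T (face T d)) - (\<sigma> (face T d) - 1)" and 3: "3 dvd \<sigma> (face T d) - (\<sigma> d - 1)"
    using c d by (simp_all add: colouring_def flip: cong_iff_dvd_diff)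
  show ?thesis using dvd_add[OF dvd_diff[OF dvd_diff[OF 1 2] 3] dvd_refl] by (simp add: cong_iff_dvd_diff)
qed

lemma colouring_rot_rot:
  assumes c: "colouring T \<sigma>" and d: "d \<in> darts T" shows "[\<sigma> (rot T (rot T d)) = \<sigma> d] (mod 3)"
  using cong_trans[OF colouring_rot[OF c, of "rot T d"]] colouring_rot[OF c d] d
  by (metis add.inverse_inverse cong_minus_minus_iff rot_in)

text \<open>After five turns the sign has changed but the dart is the same, so 3 divides
  \<open>2 * \<sigma> d\<close>.\<close>

lemma colouring_pentagon:
  assumes c: "colouring T \<sigma>" and d: "d \<in> darts T" and 5: "card (orbit (rot T) d) = 5"
  shows "[\<sigma> d = 0] (mod 3)"
proof -
  have "(rot T ^^ 5) d = d" using orbit_card_funpow(1)[OF rot_permutes finite_darts] 5 by metis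
  then have r5: "rot T (rot T (rot T (rot T (rot T d)))) = d" by (simp add: numeral_eq_Suc)
  have "[\<sigma> (rot T (rot T (rot T (rot T (rot T d))))) = \<sigma> (rot T (rot T (rot T d)))] (mod 3)"
    "[\<sigma> (rot T (rot T (rot T d))) = \<sigma> (rot T d)] (mod 3)" "[\<sigma> (rot T d) = - \<sigma> d] (mod 3)"
    using d by (auto intro!: colouring_rot_rot colouring_rot c)
  then have "[\<sigma> d = - \<sigma> d] (mod 3)" unfolding r5 using cong_trans by blast
  then have "3 dvd 2 * \<sigma> d" by (simp add: cong_iff_dvd_diff)
  moreover have "coprime 3 (2 :: int)" by simp
  ultimately have "3 dvd \<sigma> d" using coprime_dvd_mult_right_iff by blast
  then show ?thesis by (simp add: cong_iff_dvd_diff)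
qed

end

section \<open>Distinguished vertices in the chart of a tile\<close>

context tile
begin

text \<open>\<open>\<kappa>\<close> is the residue of the distinguished vertex seen at a dart: for
  colour 2 the third vertex \<open>p + omega * u\<close> has, modulo 3, the residue of
  \<open>p + 2 * u\<close>. Steps of \<open>adj\<close> do not change it, and at a corner, where the
  colour is 0, it is the residue of the corner itself.\<close>

lemma colouring_corners:
  assumes c: "colouring T \<sigma>" and x: "x \<in> Cor" and y: "y \<in> Cor"
  shows "[res x = res y] (mod 3)"
proof -
  define \<kappa> where "\<kappa> \<delta> = res (fst \<delta>) + res (snd \<delta>) * \<sigma> (chart P \<delta>)" for \<delta>
  have step: "[\<kappa> b = \<kappa> a] (mod 3)" if ab: "(a, b) \<in> adj (region P)" and m: "ltri a \<inter> region P \<noteq> {}" for a b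
  proof -
    obtain p u where a: "a = (p, u)" by (cases a)
    have pu: "p \<in> eisenstein" "u \<in> eisenstein_units" "a \<in> ldarts" using ab a by (auto simp: adj_def)
    define e where "e = chart P a"
    have e: "e \<in> darts T" using unfolds_darts(1)[OF unf] pu m e_def by blast
    show ?thesis
    proof (cases "b = lface a")
      case True
      have "chart P b = face T e" using unfolds_darts(2)[OF unf] pu m e_def True by blast
      then have "\<kappa> b = res (p + u) + res (omega\<^sup>2 * u) * \<sigma> (face T e)"
        using True a by (simp add: \<kappa>_def lface.simps)
      also have "[\<dots> = (res p + res u) + res u * (\<sigma> e - 1)] (mod 3)"
        using pu c e by (intro cong_add cong_mult res_omega2) (auto simp: res_add colouring_def)
      also have "(res p + res u) + res u * (\<sigma> e - 1) = \<kappa> a" by (simp add: \<kappa>_def a e_def algebra_simps)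
      finally show ?thesis .
    next
      case False
      then have b: "b = lopp a" "ledge a \<inter> region P \<noteq> {}" using ab by (auto simp: adj_def)
      then have "chart P b = opp T e" using unf pu m e_def unfolding unfolds_def by blast
      then have "\<kappa> b = (res p + res u) + (- res u) * \<sigma> (opp T e)"
        using b a pu by (simp add: \<kappa>_def res_add res_minus)
      also have "[\<dots> = (res p + res u) + (- res u) * (1 - \<sigma> e)] (mod 3)"
        using c e by (intro cong_add cong_mult) (auto simp: colouring_def)
      also have "(res p + res u) + (- res u) * (1 - \<sigma> e) = \<kappa> a" by (simp add: \<kappa>_def a e_def algebra_simps)
      finally show ?thesis .
    qed
  qed
  have const: "[\<kappa> b = \<kappa> a] (mod 3)"
    if a: "a \<in> ldarts" "ltri a \<inter> region P \<noteq> {}" and b: "b \<in> ldarts" "ltri b \<inter> region P \<noteq> {}" for a b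
  proof -
    have "(a, b) \<in> (adj (region P))\<^sup>*" using adj_convex region_props a b by blast
    then have "[\<kappa> b = \<kappa> a] (mod 3) \<and> ltri b \<inter> region P \<noteq> {}"
    proof (induction rule: rtrancl_induct)
      case (step y z)
      then show ?case
        using assms adj_meets(2)[OF step(2) region_props(1)] that \<open>\<And>b a. (a, b) \<in> adj (region P) \<Longrightarrow> ltri a \<inter> region P \<noteq> {} \<Longrightarrow> [\<kappa> b = \<kappa> a] (mod 3)\<close>
        by (meson cong_trans)
    qed (use a in auto)
    then show ?thesis by blast
  qed
  have corner: "\<exists>u. (t, u) \<in> ldarts \<and> ltri (t, u) \<inter> region P \<noteq> {} \<and> [\<kappa> (t, u) = res t] (mod 3)" if t: "t \<in> Cor" for t
  proof -
    obtain u where u: "(t, u) \<in> ldarts" "ltri (t, u) \<inter> region P \<noteq> {}"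
      using star_origin[of t "region P"] t Cor_lattice Cor_subset closure_region region_props(1) by blast
    have "card (orbit (rot T) (chart P (t, u))) = 5" using corner_degree[OF u] t Cor_subset by blast
    then have "[\<sigma> (chart P (t, u)) = 0] (mod 3)"
      using colouring_pentagon[OF c] unfolds_darts(1)[OF unf u] by blast
    then have "[res t + res u * \<sigma> (chart P (t, u)) = res t + res u * 0] (mod 3)" by (intro cong_add cong_mult) auto
    then show ?thesis using u by (auto simp: \<kappa>_def)
  qed
  obtain u where u: "(x, u) \<in> ldarts" "ltri (x, u) \<inter> region P \<noteq> {}" "[\<kappa> (x, u) = res x] (mod 3)"
    using corner[OF x] by blast
  obtain v where v: "(y, v) \<in> ldarts" "ltri (y, v) \<inter> region P \<noteq> {}" "[\<kappa> (y, v) = res y] (mod 3)"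
    using corner[OF y] by blast
  show ?thesis using const[OF v(1,2) u(1,2)] u(3) v(3) by (meson cong_sym cong_trans)
qed

end

section \<open>Moving tiles\<close>

lemma move_lface: "move c s (lface \<delta>) = lface (move c s \<delta>)"
  and move_lopp: "move c s (lopp \<delta>) = lopp (move c s \<delta>)"
  by (cases \<delta>; simp add: lface.simps algebra_simps; fail)+

lemma move_ldarts: "c \<in> eisenstein_units \<Longrightarrow> s \<in> eisenstein \<Longrightarrow> \<delta> \<in> ldarts \<Longrightarrow> move c s \<delta> \<in> ldarts"
  by (cases \<delta>) auto

lemma move_inverse [simp]:
  assumes "c \<noteq> 0" shows "move (1 / c) (- (s / c)) (move c s \<delta>) = \<delta>" "move c s (move (1 / c) (- (s / c)) \<delta>) = \<delta>"
  using assms by (cases \<delta>; simp add: field_simps)+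

definition aff :: "complex \<Rightarrow> complex \<Rightarrow> complex \<Rightarrow> complex" where "aff c s z = c * z + s"

lemma aff_inverse [simp]: "c \<noteq> 0 \<Longrightarrow> aff (1 / c) (- (s / c)) (aff c s z) = z" "c \<noteq> 0 \<Longrightarrow> aff c s (aff (1 / c) (- (s / c)) z) = z"
  by (simp_all add: aff_def field_simps)

lemma aff_image: "aff c s ` S = (\<lambda>z. s + z) ` ((\<lambda>z. c * z) ` S)"
  by (auto simp: aff_def image_image add.commute)

lemma hull_aff: "convex hull (aff c s ` S) = aff c s ` (convex hull S)"
  unfolding aff_image by (simp add: convex_hull_translation convex_hull_linear_image linear_times)

lemma interior_aff: assumes "c \<noteq> 0" shows "interior (aff c s ` S) = aff c s ` interior S"
proof -
  have "inj ((*) c)" using assms by (auto intro: injI)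
  then show ?thesis
    unfolding aff_image interior_translation by (simp add: interior_injective_linear_image linear_times)
qed

lemma ctri_move: "ctri (move c s \<delta>) = aff c s ` ctri \<delta>"
proof (cases \<delta>)
  case (Pair p u)
  have "{c * p + s, c * p + s + c * u, c * p + s + omega * (c * u)} = aff c s ` {p, p + u, p + omega * u}"
    by (simp add: aff_def algebra_simps)
  then show ?thesis by (simp add: Pair ctri.simps flip: hull_aff)
qed

lemma ltri_move: "c \<noteq> 0 \<Longrightarrow> ltri (move c s \<delta>) = aff c s ` ltri \<delta>"
  by (simp add: ltri_eq ctri_move interior_aff)

lemma ledge_move: "c \<noteq> 0 \<Longrightarrow> z \<in> ledge \<delta> \<Longrightarrow> aff c s z \<in> ledge (move c s \<delta>)"
  by (cases \<delta>) (auto simp: ledge_iff aff_def algebra_simps simp del: ledge.simps)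

text \<open>A tile carried along by a lattice motion, its chart pulled back by the inverse motion.
  Two tiles are compared only after they have been moved so that they show neighbouring or equal
  triangles of \<open>T\<close> in matching positions.\<close>

definition mvt :: "complex \<Rightarrow> complex \<Rightarrow> 'd tile \<Rightarrow> 'd tile" where
  "mvt c s P = \<lparr>corners = (case corners P of (x, y, z) \<Rightarrow> (aff c s x, aff c s y, aff c s z)),
     chart = (\<lambda>\<delta>. chart P (move (1 / c) (- (s / c)) \<delta>))\<rparr>"

lemma mvt_simps:
  "chart (mvt c s P) \<delta> = chart P (move (1 / c) (- (s / c)) \<delta>)"
  "corner_set (corners (mvt c s P)) = aff c s ` corner_set (corners P)"
  "triangle (corners (mvt c s P)) = aff c s ` triangle (corners P)"
  "c \<noteq> 0 \<Longrightarrow> region (mvt c s P) = aff c s ` region P"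
proof -
  show t: "triangle (corners (mvt c s P)) = aff c s ` triangle (corners P)"
    by (cases "corners P") (simp add: mvt_def flip: hull_aff)
  show "c \<noteq> 0 \<Longrightarrow> region (mvt c s P) = aff c s ` region P"
    by (simp add: region_def t interior_aff)
qed (cases "corners P"; simp add: mvt_def)+

lemma mvt_chart_move: "c \<noteq> 0 \<Longrightarrow> chart (mvt c s P) (move c s \<delta>) = chart P \<delta>"
  by (simp add: mvt_simps)

lemma ltri_mvt_meets:
  assumes "c \<noteq> 0"
  shows "ltri (move c s \<delta>) \<inter> region (mvt c s P) = aff c s ` (ltri \<delta> \<inter> region P)"
proof -
  have "inj (aff c s)" by (rule inj_on_inverseI[where g = "aff (1 / c) (- (s / c))"]) (use assms in simp)
  then show ?thesis using assms by (simp add: ltri_move mvt_simps image_Int)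
qed

lemma units_eisenstein_inverse:
  assumes "c \<in> eisenstein_units" "s \<in> eisenstein"
  shows "1 / c \<in> eisenstein_units" "- (s / c) \<in> eisenstein" "c \<noteq> 0"
proof -
  show i: "1 / c \<in> eisenstein_units" using assms by auto
  have "- s * (1 / c) \<in> eisenstein" using assms i by blast
  then show "- (s / c) \<in> eisenstein" by simp
  show "c \<noteq> 0" using units_neq_0 assms by blast
qed

context tile
begin

lemma mvt_tile:
  assumes c: "c \<in> eisenstein_units" and s: "s \<in> eisenstein" shows "tile T (mvt c s P)"
proof
  note i = units_eisenstein_inverse[OF c s]
  have c0: "c \<noteq> 0" using i by blast
  have pullback: "\<exists>\<epsilon>\<in>ldarts. \<delta> = move c s \<epsilon> \<and> chart (mvt c s P) \<delta> = chart P \<epsilon> \<and> (ltri \<epsilon> \<inter> region P \<noteq> {} \<longleftrightarrow> ltri \<delta> \<inter> region (mvt c s P) \<noteq> {})"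
    if "\<delta> \<in> ldarts" for \<delta>
  proof (rule bexI[of _ "move (1 / c) (- (s / c)) \<delta>"])
    show "move (1 / c) (- (s / c)) \<delta> \<in> ldarts" using move_ldarts i that by blast
    have "\<delta> = move c s (move (1 / c) (- (s / c)) \<delta>)" using c0 by simp
    moreover have "ltri \<delta> \<inter> region (mvt c s P) = aff c s ` (ltri (move (1 / c) (- (s / c)) \<delta>) \<inter> region P)"
      using ltri_mvt_meets[OF c0, of s "move (1 / c) (- (s / c)) \<delta>" P] c0 by simp
    ultimately show "\<delta> = move c s (move (1 / c) (- (s / c)) \<delta>) \<and>
      chart (mvt c s P) \<delta> = chart P (move (1 / c) (- (s / c)) \<delta>) \<and>
      (ltri (move (1 / c) (- (s / c)) \<delta>) \<inter> region P \<noteq> {} \<longleftrightarrow> ltri \<delta> \<inter> region (mvt c s P) \<noteq> {})"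
      by (simp add: mvt_simps)
  qed
  have inj: "aff c s x = aff c s y \<longleftrightarrow> x = y" for x y using c0 by (simp add: aff_def)
  have cs: "corner_set (corners (mvt c s P)) \<subseteq> eisenstein"
    using Cor_lattice c s by (auto simp: mvt_simps aff_def)
  obtain x y z where xyz: "corners P = (x, y, z)" by (cases "corners P")
  have "side P x y z" by (simp add: side_def xyz)
  then have "region P \<noteq> {}" "\<not> collinear {x, y, z}" using region_nonempty side_nc by blast+
  \<comment> \<open>Noncollinearity is transported through the interior of the hull, which is empty
    for collinear points.\<close>
  have "interior (convex hull (aff c s ` {x, y, z})) \<noteq> {}"
    using \<open>region P \<noteq> {}\<close> unfolding hull_aff interior_aff[OF c0] by (simp add: region_def xyz)
  then have "\<not> collinear (aff c s ` {x, y, z})"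
    using aff_dim_nonempty_interior[of "convex hull (aff c s ` {x, y, z})"]
    by (simp add: aff_dim_convex_hull collinear_aff_dim)
  then have nc: "\<not> collinear (corner_set (corners (mvt c s P)))" by (simp add: mvt_simps xyz)
  have un: "unfolds T (region (mvt c s P)) (chart (mvt c s P))"
    unfolding unfolds_def
  proof (intro ballI impI)
    fix \<delta> assume d: "\<delta> \<in> ldarts" "ltri \<delta> \<inter> region (mvt c s P) \<noteq> {}"
    obtain \<epsilon> where e: "\<epsilon> \<in> ldarts" "\<delta> = move c s \<epsilon>" "ltri \<epsilon> \<inter> region P \<noteq> {}" using pullback[OF d(1)] d(2) by blast
    have "ledge \<epsilon> \<inter> region P \<noteq> {}" if h: "ledge \<delta> \<inter> region (mvt c s P) \<noteq> {}"
    proof -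
      obtain w where w: "w \<in> ledge \<delta>" "w \<in> region (mvt c s P)" using h by blast
      then obtain w' where w': "w = aff c s w'" "w' \<in> region P" using c0 by (auto simp: mvt_simps)
      have "aff (1 / c) (- (s / c)) w \<in> ledge (move (1 / c) (- (s / c)) \<delta>)" by (rule ledge_move[OF _ w(1)]) (use c0 in simp)
      then have "w' \<in> ledge \<epsilon>" using e(2) w'(1) c0 by simp
      then show ?thesis using w' by blast
    qed
    then show "chart (mvt c s P) \<delta> \<in> darts T \<and> chart (mvt c s P) (lface \<delta>) = face T (chart (mvt c s P) \<delta>) \<and>
       (ledge \<delta> \<inter> region (mvt c s P) \<noteq> {} \<longrightarrow> chart (mvt c s P) (lopp \<delta>) = opp T (chart (mvt c s P) \<delta>))"
      using unf e unfolding unfolds_def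
      by (simp add: mvt_chart_move c0 flip: move_lface move_lopp)
  qed
  have deg: "card (orbit (rot T) (chart (mvt c s P) \<delta>)) = 5 \<longleftrightarrow> fst \<delta> \<in> corner_set (corners (mvt c s P))"
    if d: "\<delta> \<in> ldarts" "ltri \<delta> \<inter> region (mvt c s P) \<noteq> {}" "fst \<delta> \<in> triangle (corners (mvt c s P))" for \<delta>
  proof -
    obtain \<epsilon> where e: "\<epsilon> \<in> ldarts" "\<delta> = move c s \<epsilon>" "ltri \<epsilon> \<inter> region P \<noteq> {}" using pullback[OF d(1)] d(2) by blast
    obtain p u where pu: "\<epsilon> = (p, u)" by (cases \<epsilon>)
    have f: "fst \<delta> = aff c s p" using e pu by (simp add: aff_def)
    have "p \<in> Tri" using d(3) inj unfolding f mvt_simps by (metis imageE)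
    moreover have "fst \<delta> \<in> corner_set (corners (mvt c s P)) \<longleftrightarrow> p \<in> Cor" unfolding f mvt_simps using inj by (metis image_iff)
    moreover have "chart (mvt c s P) \<delta> = chart P (p, u)" by (simp only: e(2) pu mvt_chart_move[OF c0])
    ultimately show ?thesis using corner_degree[of p u] e(1,3) unfolding pu by metis
  qed
  show "master_tile T (mvt c s P)"
    unfolding master_tile_def using cs nc un deg by (auto simp: region_def tile_darts_def)
qed

end

section \<open>Colouring by means of tiles\<close>

lemma finite_lattice_ball: "finite {p \<in> eisenstein. norm p \<le> K}"
proof (rule finite_subset)
  show "{p \<in> eisenstein. norm p \<le> K} \<subseteq> (\<lambda>(m, n). lat m n) ` ({- \<lceil>2 * K\<rceil>..\<lceil>2 * K\<rceil>} \<times> {- \<lceil>2 * K\<rceil>..\<lceil>2 * K\<rceil>})"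
  proof
    fix p assume p: "p \<in> {p \<in> eisenstein. norm p \<le> K}"
    then obtain m n where mn: "p = lat m n" by (auto elim: eisenstein_latE)
    have "\<bar>real_of_int m\<bar> \<le> 2 * K" "\<bar>real_of_int n\<bar> \<le> 2 * K"
      using abs_xc_le[of p] abs_yc_le[of p] p by (simp_all add: mn)
    then have "\<bar>m\<bar> \<le> \<lceil>2 * K\<rceil>" "\<bar>n\<bar> \<le> \<lceil>2 * K\<rceil>" by linarith+
    then show "p \<in> (\<lambda>(m, n). lat m n) ` ({- \<lceil>2 * K\<rceil>..\<lceil>2 * K\<rceil>} \<times> {- \<lceil>2 * K\<rceil>..\<lceil>2 * K\<rceil>})"
      using mn by (auto simp: abs_le_iff intro!: image_eqI[of _ _ "(m, n)"])
  qed
qed simp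

lemma finite_ldarts_meeting:
  assumes "bounded B" shows "finite {\<delta> \<in> ldarts. ltri \<delta> \<inter> B \<noteq> {}}"
proof -
  obtain K where K: "\<And>z. z \<in> B \<Longrightarrow> norm z \<le> K" using assms by (auto simp: bounded_iff)
  have "{\<delta> \<in> ldarts. ltri \<delta> \<inter> B \<noteq> {}} \<subseteq> {p \<in> eisenstein. norm p \<le> K + 1} \<times> eisenstein_units"
  proof
    fix \<delta> assume d: "\<delta> \<in> {\<delta> \<in> ldarts. ltri \<delta> \<inter> B \<noteq> {}}"
    obtain p u where pu: "\<delta> = (p, u)" by (cases \<delta>)
    obtain z where z: "z \<in> ltri \<delta>" "z \<in> B" using d by blast
    then have "z \<in> ctri (p, u)" using ltri_subset pu by blast
    then obtain a b where ab: "0 \<le> a" "0 \<le> b" "a + b \<le> 1" "z = p + of_real a * u + of_real b * (omega * u)"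
      unfolding ctri_std by blast
    have u: "norm u = 1" using d pu units_norm by auto
    have "p = z - (of_real a * u + of_real b * (omega * u))" using ab(4) by simp
    then have "norm p \<le> norm z + norm (of_real a * u + of_real b * (omega * u))" using norm_triangle_ineq4 by metis
    also have "norm (of_real a * u + of_real b * (omega * u)) \<le> a + b"
      using norm_triangle_ineq[of "of_real a * u" "of_real b * (omega * u)"] ab u by (simp add: norm_mult)
    finally show "\<delta> \<in> {p \<in> eisenstein. norm p \<le> K + 1} \<times> eisenstein_units"
      using K[OF z(2)] ab d pu by auto
  qed
  moreover have "finite eisenstein_units" by (simp add: units_eq)
  ultimately show ?thesis using finite_lattice_ball finite_subset by blast
qed

lemma ltri_place: "u \<noteq> 0 \<Longrightarrow> ltri (p, u) = place (p, u) ` ltri (0, 1)"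
  using ltri_move[of u p "(0, 1)"] by (simp add: aff_def add.commute)

lemma mvt_mvt:
  assumes "c \<noteq> 0" "c' \<noteq> 0" shows "mvt c s (mvt c' s' P) = mvt (c * c') (c * s' + s) P"
proof -
  have "move (1 / c') (- (s' / c')) (move (1 / c) (- (s / c)) \<delta>) = move (1 / (c * c')) (- ((c * s' + s) / (c * c'))) \<delta>" for \<delta>
    using assms by (cases \<delta>) (simp add: field_simps)
  moreover have "aff c s (aff c' s' z) = aff (c * c') (c * s' + s) z" for z by (simp add: aff_def algebra_simps)
  ultimately show ?thesis by (simp add: mvt_def split: prod.split)
qed

locale tiled = triangulation T for T :: "'d cmap" +
  fixes M :: "'d tile set"
  assumes finite_tiles: "finite M"
    and master_tiles: "\<And>P. P \<in> M \<Longrightarrow> master_tile T P"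
    and cover: "tiles_cover T M" and disjoint: "tiles_disjoint M"
    and degree: "\<And>d. d \<in> darts T \<Longrightarrow> card (orbit (rot T) d) = 5 \<or> card (orbit (rot T) d) = 6"
begin

definition placed :: "'d tile set" where
  "placed = {mvt c s P | c s P. c \<in> eisenstein_units \<and> s \<in> eisenstein \<and> P \<in> M}"

lemma tile_M: "P \<in> M \<Longrightarrow> tile T P"
  using master_tiles by (simp add: tile_def tile_axioms_def triangulation_axioms)

lemma placed_tile: "Q \<in> placed \<Longrightarrow> tile T Q"
  using tile.mvt_tile[OF tile_M] by (auto simp: placed_def)

lemma placed_mvt: 
  assumes "Q \<in> placed" "c \<in> eisenstein_units" "s \<in> eisenstein" shows "mvt c s Q \<in> placed"
proof -
  obtain c' s' P where Q: "Q = mvt c' s' P" "c' \<in> eisenstein_units" "s' \<in> eisenstein" "P \<in> M"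
    using assms(1) by (auto simp: placed_def)
  have "mvt c s Q = mvt (c * c') (c * s' + s) P" using Q assms units_neq_0 by (simp add: mvt_mvt)
  moreover have "c * c' \<in> eisenstein_units" "c * s' + s \<in> eisenstein" using Q assms by blast+
  ultimately show ?thesis using Q(4) unfolding placed_def by blast
qed

text \<open>Pulled back to \<open>M\<close>, the copies show the same point of \<open>T\<close> in
  their interiors, so \<open>tiles_disjoint\<close> gives the same tile and the same lattice dart. A
  motion is determined by what it does to one dart.\<close>

lemma placed_disjoint:
  assumes Q: "Q \<in> placed" "Q' \<in> placed" and d: "\<delta> \<in> ldarts"
    and z: "z \<in> ltri \<delta> \<inter> region Q \<inter> region Q'" and eq: "chart Q \<delta> = chart Q' \<delta>"
  shows "Q = Q'"
proof -
  obtain c s P where P: "Q = mvt c s P" "c \<in> eisenstein_units" "s \<in> eisenstein" "P \<in> M"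
    using Q by (auto simp: placed_def)
  obtain c' s' P' where P': "Q' = mvt c' s' P'" "c' \<in> eisenstein_units" "s' \<in> eisenstein" "P' \<in> M"
    using Q by (auto simp: placed_def)
  obtain p u where pu: "\<delta> = (p, u)" by (cases \<delta>)
  have u: "u \<noteq> 0" using d pu units_neq_0 by auto
  obtain w where w: "w \<in> ltri (0, 1)" "z = p + u * w" using z pu ltri_place[OF u] by auto
  have *: "\<exists>\<epsilon>\<in>tile_darts P. \<epsilon> = move (1 / c) (- (s / c)) \<delta> \<and> chart P \<epsilon> = chart (mvt c s P) \<delta> \<and>
      place \<epsilon> w \<in> interior (triangle (corners P))"
    if z: "z \<in> region (mvt c s P)" and c: "c \<in> eisenstein_units" "s \<in> eisenstein" "P \<in> M" for c s and P :: "'d tile"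
  proof (intro bexI conjI)
    note i = units_eisenstein_inverse[OF c(1,2)]
    define \<epsilon> where "\<epsilon> = move (1 / c) (- (s / c)) \<delta>"
    show "move (1 / c) (- (s / c)) \<delta> = move (1 / c) (- (s / c)) \<delta>" ..
    show "chart P (move (1 / c) (- (s / c)) \<delta>) = chart (mvt c s P) \<delta>" by (simp add: mvt_simps)
    obtain z' where z': "z' \<in> region P" "z = aff c s z'" using z i by (auto simp: mvt_simps)
    have "place (move (1 / c) (- (s / c)) \<delta>) w = aff (1 / c) (- (s / c)) z"
      using i w by (simp add: pu aff_def field_simps)
    also have "\<dots> = z'" using z' i by simp
    finally have pz: "place (move (1 / c) (- (s / c)) \<delta>) w = z'" .
    then show "place (move (1 / c) (- (s / c)) \<delta>) w \<in> interior (triangle (corners P))" using z' by (simp add: region_def)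
    have "move (1 / c) (- (s / c)) \<delta> \<in> ldarts" using move_ldarts i d by blast
    moreover have "z' \<in> ltri (move (1 / c) (- (s / c)) \<delta>)"
    proof -
      have "aff (1 / c) (- (s / c)) z \<in> ltri (move (1 / c) (- (s / c)) \<delta>)"
        using ltri_move[of "1 / c"] i \<open>z \<in> ltri \<delta> \<inter> region Q \<inter> region Q'\<close> by auto
      then show ?thesis using z' i by simp
    qed
    ultimately show "move (1 / c) (- (s / c)) \<delta> \<in> tile_darts P" using z' by (auto simp: tile_darts_def region_def)
  qed
  obtain \<epsilon> where e: "\<epsilon> \<in> tile_darts P" "\<epsilon> = move (1 / c) (- (s / c)) \<delta>" "chart P \<epsilon> = chart Q \<delta>"
    "place \<epsilon> w \<in> interior (triangle (corners P))" using *[of c s P] z P by blast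
  obtain \<epsilon>' where e': "\<epsilon>' \<in> tile_darts P'" "\<epsilon>' = move (1 / c') (- (s' / c')) \<delta>" "chart P' \<epsilon>' = chart Q' \<delta>"
    "place \<epsilon>' w \<in> interior (triangle (corners P'))" using *[of c' s' P'] z P' by blast
  have "P = P' \<and> \<epsilon> = \<epsilon>'"
    using disjoint P P' e e' w(1) eq unfolding tiles_disjoint_def by metis
  then have 1: "P = P'" and 2: "move (1 / c) (- (s / c)) (p, u) = move (1 / c') (- (s' / c')) (p, u)" using e e' pu by auto
  have n: "c \<noteq> 0" "c' \<noteq> 0" using P P' units_neq_0 by blast+
  have "u / c = u / c'" "(p - s) / c = (p - s') / c'" using 2 by (simp_all add: diff_divide_distrib)
  then have "c = c'" using u n by (simp add: field_simps)
  then have "s = s'" using \<open>(p - s) / c = (p - s') / c'\<close> n by simp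
  then show ?thesis using 1 P P' \<open>c = c'\<close> by simp
qed

text \<open>The tiles that show the triangle to the left of \<open>d\<close> on the standard
  triangle, with \<open>d\<close> from 0 to 1. Their interior must meet that triangle, since only
  then is the value of the chart meaningful.\<close>

definition over :: "'d \<Rightarrow> 'd tile set" where
  "over d = {Q \<in> placed. ltri (0, 1) \<inter> region Q \<noteq> {} \<and> chart Q (0, 1) = d}"

text \<open>Such a tile is determined by its original in \<open>M\<close> and the lattice dart that
  is moved to \<open>(0, 1)\<close>; a bounded tile has finitely many darts.\<close>

lemma finite_over: "finite (over d)"
proof (rule finite_subset)
  show "over d \<subseteq> (\<lambda>(P, (p, u)). mvt (1 / u) (- (p / u)) P) ` (SIGMA P:M. {\<delta> \<in> ldarts. ltri \<delta> \<inter> region P \<noteq> {}})"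
  proof
    fix Q assume "Q \<in> over d"
    then obtain c s P where Q: "Q = mvt c s P" "c \<in> eisenstein_units" "s \<in> eisenstein" "P \<in> M"
      "ltri (0, 1) \<inter> region Q \<noteq> {}" by (auto simp: over_def placed_def)
    note i = units_eisenstein_inverse[OF Q(2,3)]
    define \<delta> where "\<delta> = move (1 / c) (- (s / c)) (0, 1)"
    have d: "\<delta> = (- (s / c), 1 / c)" by (simp add: \<delta>_def)
    have "\<delta> \<in> ldarts" using i d by simp
    moreover have "move c s \<delta> = (0, 1)" using i unfolding \<delta>_def by simp
    then have "ltri \<delta> \<inter> region P \<noteq> {}" using ltri_mvt_meets[OF i(3), of s \<delta> P] Q by auto
    moreover have "Q = (\<lambda>(P, (p, u)). mvt (1 / u) (- (p / u)) P) (P, \<delta>)" using i by (simp add: d Q(1))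
    ultimately show "Q \<in> (\<lambda>(P, (p, u)). mvt (1 / u) (- (p / u)) P) ` (SIGMA P:M. {\<delta> \<in> ldarts. ltri \<delta> \<inter> region P \<noteq> {}})"
      using Q(4) by (intro image_eqI[of _ _ "(P, \<delta>)"]) auto
  qed
  have "bounded (region P)" for P :: "'d tile"
    using compact_triangle(1) compact_imp_bounded bounded_subset region_props(3) by metis
  then show "finite ((\<lambda>(P, (p, u)). mvt (1 / u) (- (p / u)) P) ` (SIGMA P:M. {\<delta> \<in> ldarts. ltri \<delta> \<inter> region P \<noteq> {}}))"
    using finite_tiles finite_ldarts_meeting by (intro finite_imageI finite_SigmaI) auto
qed

lemma over_cover:
  assumes d: "d \<in> darts T" and w: "w \<in> ltri (0, 1)"
  shows "\<exists>Q\<in>over d. w \<in> triangle (corners Q)"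
proof -
  obtain P \<delta> where P: "P \<in> M" "\<delta> \<in> tile_darts P" "chart P \<delta> = d" "place \<delta> w \<in> triangle (corners P)"
    using cover d w unfolding tiles_cover_def by blast
  obtain p u where pu: "\<delta> = (p, u)" by (cases \<delta>)
  have pu': "p \<in> eisenstein" "u \<in> eisenstein_units" "ltri (p, u) \<inter> region P \<noteq> {}"
    using P(2) pu by (auto simp: tile_darts_def region_def)
  note i = units_eisenstein_inverse[OF pu'(2,1)]
  define Q where "Q = mvt (1 / u) (- (p / u)) P"
  have mv: "move (1 / u) (- (p / u)) (p, u) = (0, 1)" using i by simp
  have "Q \<in> placed" unfolding Q_def placed_def using i P(1) by blast
  moreover have "chart Q (0, 1) = d"
    using mvt_chart_move[of "1 / u" "- (p / u)" P "(p, u)"] i P pu unfolding mv Q_def by simp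
  moreover have "ltri (0, 1) \<inter> region Q \<noteq> {}"
    using ltri_mvt_meets[of "1 / u" "- (p / u)" "(p, u)" P] i pu' unfolding mv Q_def by simp
  moreover have "w \<in> triangle (corners Q)"
  proof -
    have "aff (1 / u) (- (p / u)) (place (p, u) w) = w" using i by (simp add: aff_def field_simps)
    then show ?thesis using P(4) unfolding Q_def mvt_simps pu by (metis imageI)
  qed
  ultimately show ?thesis unfolding over_def by blast
qed

text \<open>Finitely many compact tiles have a closed union, which contains the closure of the open
  triangle. This reaches the edge midpoints used in \<open>tile_colouring\<close>.\<close>

lemma over_cover_closed:
  assumes d: "d \<in> darts T" and w: "w \<in> ctri (0, 1)"
  shows "\<exists>Q\<in>over d. w \<in> triangle (corners Q)"
proof -
  have "closed (\<Union>Q\<in>over d. triangle (corners Q))"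
    using finite_over compact_triangle(1) compact_imp_closed by (intro closed_UN) auto
  moreover have "ltri (0, 1) \<subseteq> (\<Union>Q\<in>over d. triangle (corners Q))" using over_cover[OF d] by blast
  ultimately have "closure (ltri (0, 1)) \<subseteq> (\<Union>Q\<in>over d. triangle (corners Q))" by (simp add: closure_minimal)
  then show ?thesis using closure_ltri[of "(0, 1)"] w by auto
qed

section \<open>Congruent corners on every tile yield a colouring\<close>

context
  assumes congruent: "\<And>P x y. P \<in> M \<Longrightarrow> x \<in> corner_set (corners P) \<Longrightarrow> y \<in> corner_set (corners P) \<Longrightarrow>
    [res x = res y] (mod 3)"
begin

lemma placed_congruent:
  assumes "Q \<in> placed" "x \<in> corner_set (corners Q)" "y \<in> corner_set (corners Q)"
  shows "[res x = res y] (mod 3)"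
proof -
  obtain c s P where P: "Q = mvt c s P" "c \<in> eisenstein_units" "s \<in> eisenstein" "P \<in> M"
    using assms by (auto simp: placed_def)
  obtain x' y' where xy: "x = c * x' + s" "y = c * y' + s" "x' \<in> corner_set (corners P)" "y' \<in> corner_set (corners P)"
    using assms(2,3) unfolding P(1) mvt_simps by (auto simp: aff_def)
  have E: "c \<in> eisenstein" "x' \<in> eisenstein" "y' \<in> eisenstein" "c * x' \<in> eisenstein" "c * y' \<in> eisenstein"
    using xy P tile.Cor_lattice[OF tile_M] by blast+
  have "[res (c * x') = res c * res x'] (mod 3)" "[res c * res x' = res c * res y'] (mod 3)"
    "[res c * res y' = res (c * y')] (mod 3)"
    using res_mult E congruent P xy by (auto intro: cong_mult cong_sym)
  then have "[res (c * x') = res (c * y')] (mod 3)" using cong_trans by blast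
  then show ?thesis using E P(3) unfolding xy by (auto simp: res_add intro: cong_add)
qed

lemma common_point_congruent:
  assumes Q: "Q \<in> placed" "Q' \<in> placed" and t: "t \<notin> eisenstein" "t \<in> triangle (corners Q)" "t \<in> triangle (corners Q')"
    and d: "\<delta> \<in> ldarts" "t \<in> ctri \<delta>" "ltri \<delta> \<inter> region Q \<noteq> {}" "\<delta>' \<in> ldarts" "t \<in> ctri \<delta>'" "ltri \<delta>' \<inter> region Q' \<noteq> {}"
    and l: "((\<delta>, chart Q \<delta>), (\<delta>', chart Q' \<delta>')) \<in> link T t"
    and xy: "x \<in> corner_set (corners Q)" "y \<in> corner_set (corners Q')"
  shows "[res x = res y] (mod 3)"
proof -
  interpret two_tiles T Q Q'
    using placed_tile Q degree by (simp add: two_tiles_def two_tiles_axioms_def)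
  have "agr t"
    by (rule agreeI[OF T1.unf _ _ _ T2.unf _ _ _ d l])
      (use region_props t in \<open>auto simp: T1.closure_region T2.closure_region\<close>)
  moreover have "corners Q = corners Q'"
    if "\<delta> \<in> ldarts" "z \<in> ltri \<delta> \<inter> region Q \<inter> region Q'" "chart Q \<delta> = chart Q' \<delta>" for \<delta> z
    using placed_disjoint[OF Q that] by simp
  ultimately obtain r where r: "r \<in> T1.Cor" "r \<in> T2.Cor" using common_corner[OF t] by blast
  show ?thesis using placed_congruent[OF Q(1) xy(1) r(1)] placed_congruent[OF Q(2) r(2) xy(2)] cong_trans by blast
qed

text \<open>Split the tiles over \<open>d\<close> by whether their corners are congruent to
  \<open>x\<close>. Both families have closed unions, together they cover the open triangle, and on
  it they are disjoint because tiles with a common point have congruent corners. Connectedness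
  leaves one family empty.\<close>

lemma over_congruent:
  assumes d: "d \<in> darts T" and Q: "Q \<in> over d" "Q' \<in> over d"
    and x: "x \<in> corner_set (corners Q)" and y: "y \<in> corner_set (corners Q')"
  shows "[res x = res y] (mod 3)"
proof (rule ccontr)
  assume nc: "\<not> [res x = res y] (mod 3)"
  define good where "good S \<longleftrightarrow> (\<exists>z\<in>corner_set (corners S). [res x = res z] (mod 3))" for S :: "'d tile"
  define A where "A = (\<Union>S\<in>{S \<in> over d. good S}. triangle (corners S))"
  define B where "B = (\<Union>S\<in>{S \<in> over d. \<not> good S}. triangle (corners S))"
  have cl: "closed A" "closed B"
    unfolding A_def B_def using finite_over compact_triangle(1) compact_imp_closed by (auto intro!: closed_UN)
  have "ltri (0, 1) \<subseteq> A \<union> B" using over_cover[OF d] unfolding A_def B_def by blast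
  moreover have "A \<inter> B \<inter> ltri (0, 1) = {}"
  proof (rule ccontr)
    assume "A \<inter> B \<inter> ltri (0, 1) \<noteq> {}"
    then obtain t S S' where t: "t \<in> ltri (0, 1)" "S \<in> over d" "good S" "t \<in> triangle (corners S)"
      "S' \<in> over d" "\<not> good S'" "t \<in> triangle (corners S')" unfolding A_def B_def by blast
    have nl: "t \<notin> eisenstein" using ltri_no_lattice[of "(0, 1)" t] t(1) by simp
    obtain z where z: "z \<in> corner_set (corners S)" "[res x = res z] (mod 3)" using t(3) good_def by blast
    obtain z' where z': "z' \<in> corner_set (corners S')" by (cases "corners S'") auto
    have S: "S \<in> placed" "S' \<in> placed" "ltri (0, 1) \<inter> region S \<noteq> {}" "ltri (0, 1) \<inter> region S' \<noteq> {}"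
      "chart S (0, 1) = d" "chart S' (0, 1) = d" using t(2,5) by (auto simp: over_def)
    have "[res z = res z'] (mod 3)"
      by (rule common_point_congruent[OF S(1,2) nl t(4,7) _ _ S(3) _ _ S(4) _ z(1) z'])
        (use t(1) S ltri_subset in auto)
    then show False using z z' t(6) unfolding good_def using cong_trans by blast
  qed
  moreover have "connected (ltri (0, 1))" using convex_ltri convex_connected by blast
  moreover have "A \<inter> ltri (0, 1) \<noteq> {}"
  proof -
    have "good Q" using x good_def by (auto intro: cong_refl)
    then show ?thesis using Q(1) region_props(3) unfolding A_def over_def by blast
  qed
  moreover have "B \<inter> ltri (0, 1) \<noteq> {}"
  proof -
    have "\<not> good Q'"
    proof
      assume "good Q'"
      then obtain z where "z \<in> corner_set (corners Q')" "[res x = res z] (mod 3)" using good_def by blast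
      then show False using placed_congruent[of Q' z y] Q y nc cong_trans by (auto simp: over_def)
    qed
    then show ?thesis using Q(2) region_props(3) unfolding B_def over_def by blast
  qed
  ultimately show False using cl unfolding connected_closed by blast
qed

text \<open>The standard vertices 0, 1 and \<open>omega\<close> have the residues 0, 1 and 2 modulo
  3, so the residue of the corners is the colour that points to the vertex congruent to
  them.\<close>

definition tile_colour :: "'d \<Rightarrow> int" where
  "tile_colour d = res (SOME x. \<exists>Q\<in>over d. x \<in> corner_set (corners Q))"

lemma tile_colour:
  assumes d: "d \<in> darts T" and Q: "Q \<in> over d" "x \<in> corner_set (corners Q)"
  shows "[tile_colour d = res x] (mod 3)"
proof -
  have "\<exists>x. \<exists>Q\<in>over d. x \<in> corner_set (corners Q)" using Q by blast
  from someI_ex[OF this] show ?thesis unfolding tile_colour_def using over_congruent[OF d _ Q(1) _ Q(2)] by blast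
qed

lemma tile_colouring: "colouring T tile_colour"
  unfolding colouring_def
proof (intro ballI conjI)
  fix d assume d: "d \<in> darts T"
  have std: "(0, 1) \<in> ldarts" by simp
  define h :: complex where "h = of_real (1 / 2)"
  have hc: "xc h = 1 / 2" "yc h = 0" unfolding h_def by (simp_all del: of_real_divide)
  have h: "h \<in> ctri (0, 1)" by (simp add: ctri_up hc)
  have hn: "h \<notin> eisenstein"
  proof
    assume "h \<in> eisenstein"
    then obtain m where "1 / 2 = real_of_int m" by (auto simp: hc eisenstein_iff elim!: Ints_cases)
    then have "2 * m = 1" by linarith
    then show False by presburger
  qed
  obtain Q where Q: "Q \<in> over d" "h \<in> triangle (corners Q)" using over_cover_closed[OF d h] by blast
  interpret Q: tile T Q using placed_tile Q(1) by (simp add: over_def)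
  obtain x where x: "x \<in> Q.Cor" by (cases "corners Q") auto
  have xE: "x \<in> eisenstein" using x Q.Cor_lattice by blast
  have cx: "[tile_colour d = res x] (mod 3)" using tile_colour[OF d Q(1) x] .
  have Q': "Q \<in> placed" "ltri (0, 1) \<inter> region Q \<noteq> {}" "chart Q (0, 1) = d" using Q(1) by (auto simp: over_def)
  show "[tile_colour (face T d) = tile_colour d - 1] (mod 3)"
  proof -
    \<comment> \<open>The rotation about the centre of the standard triangle that takes the dart
      from 1 to \<open>omega\<close> to the dart from 0 to 1.\<close>
    define Q1 where "Q1 = mvt (- omega) omega Q"
    have mv: "move (- omega) omega (lface (0, 1)) = (0, 1)"
      by (simp add: lface.simps omega_square omega_mult_self algebra_simps)
    have "Q1 \<in> placed" unfolding Q1_def by (rule placed_mvt[OF Q'(1)]) auto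
    moreover have "chart Q1 (0, 1) = face T d"
      using mvt_chart_move[of "- omega" omega Q "lface (0, 1)"] unfolds_darts(2)[OF Q.unf std Q'(2)] Q'(3)
      unfolding mv Q1_def by simp
    moreover have "ltri (0, 1) \<inter> region Q1 \<noteq> {}"
      using ltri_mvt_meets[of "- omega" omega "lface (0, 1)" Q] Q'(2) unfolding mv Q1_def by simp
    ultimately have "Q1 \<in> over (face T d)" by (simp add: over_def)
    moreover have "aff (- omega) omega x \<in> corner_set (corners Q1)" unfolding Q1_def mvt_simps using x by blast
    ultimately have c: "[tile_colour (face T d) = res (aff (- omega) omega x)] (mod 3)" using tile_colour d by blast
    obtain m n where mn: "x = lat m n" using xE by (rule eisenstein_latE)
    have "aff (- omega) omega x = lat n (1 - m - n)" by (simp add: aff_def mn lat_def omega_mult_self algebra_simps)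
    then have "res (aff (- omega) omega x) - (res x - 1) = 3 * n" by (simp add: mn)
    then have "[res (aff (- omega) omega x) = res x - 1] (mod 3)" by (simp add: cong_iff_dvd_diff)
    moreover have "[res x - 1 = tile_colour d - 1] (mod 3)" using cx by (intro cong_diff) (auto intro: cong_sym)
    ultimately show ?thesis using c cong_trans by blast
  qed
  show "[tile_colour (opp T d) = 1 - tile_colour d] (mod 3)"
  proof -
    have od: "opp T d \<in> darts T" using d by blast
    obtain S where S: "S \<in> over (opp T d)" "h \<in> triangle (corners S)" using over_cover_closed[OF od h] by blast
    obtain y where y: "y \<in> corner_set (corners S)" by (cases "corners S") auto
    have yE: "y \<in> eisenstein" using y tile.Cor_lattice[OF placed_tile] S by (auto simp: over_def)
    have cy: "[tile_colour (opp T d) = res y] (mod 3)" using tile_colour[OF od S(1) y] .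
    \<comment> \<open>The half-turn about the midpoint \<open>h\<close> of the edge. Afterwards both
      tiles contain \<open>h\<close>, which is off the lattice, and their labels are linked
      there.\<close>
    define S1 where "S1 = mvt (-1) 1 S"
    have mv: "move (-1) 1 (0, 1) = lopp (0, 1)" by simp
    have S1: "S1 \<in> placed" unfolding S1_def by (rule placed_mvt) (use S in \<open>auto simp: over_def\<close>)
    have c1: "chart S1 (lopp (0, 1)) = opp T d"
      using mvt_chart_move[of "-1" 1 S "(0, 1)"] S unfolding mv S1_def by (simp add: over_def)
    have m1: "ltri (lopp (0, 1)) \<inter> region S1 \<noteq> {}"
      using ltri_mvt_meets[of "-1" 1 "(0, 1)" S] S unfolding mv S1_def by (simp add: over_def)
    have "aff (-1) 1 h = h" by (simp add: aff_def h_def)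
    then have h1: "h \<in> triangle (corners S1)" unfolding S1_def mvt_simps using S(2) by (metis imageI)
    have y1: "aff (-1) 1 y \<in> corner_set (corners S1)" unfolding S1_def mvt_simps using y by blast
    have ho: "h \<in> ctri (lopp (0, 1))" by (simp add: ctri_down hc)
    have "(((0, 1), d), (lopp (0, 1), opp T d)) \<in> link T h" by (rule link_opp[OF std d h ho])
    then have l: "(((0, 1), chart Q (0, 1)), (lopp (0, 1), chart S1 (lopp (0, 1)))) \<in> link T h"
      unfolding c1 Q'(3) .
    have "[res x = res (aff (-1) 1 y)] (mod 3)"
      by (rule common_point_congruent[OF Q'(1) S1 hn Q(2) h1 std h Q'(2) lopp_ldarts[OF std] ho m1 l x y1])
    also have "res (aff (-1) 1 y) = 1 - res y" using yE res_add[of "- y" 1] by (simp add: aff_def res_minus)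
    finally have "[1 - res x = 1 - (1 - res y)] (mod 3)" by (intro cong_diff) auto
    then have "[res y = 1 - res x] (mod 3)" by (simp add: cong_sym)
    moreover have "[1 - res x = 1 - tile_colour d] (mod 3)" using cx by (intro cong_diff) (auto intro: cong_sym)
    ultimately show ?thesis using cy cong_trans by blast
  qed
qed

end

theorem colouring_iff_side_vectors:
  "(\<exists>\<sigma>. colouring T \<sigma>) \<longleftrightarrow>
    (\<forall>v\<in>master_edges M. \<forall>a b. coxeter_coordinates v a b \<longrightarrow> [a = b] (mod 3))"
proof -
  have E: "v \<in> eisenstein" if v: "v \<in> master_edges M" for v
  proof -
    obtain P where P: "P \<in> M" "v \<in> side_vectors (corners P)" using v by (auto simp: master_edges_def)
    then show ?thesis using tile.Cor_lattice[OF tile_M[OF P(1)]] by (cases "corners P") auto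
  qed
  have "(\<forall>v\<in>master_edges M. \<forall>a b. coxeter_coordinates v a b \<longrightarrow> [a = b] (mod 3)) \<longleftrightarrow> (\<forall>v\<in>master_edges M. 3 dvd res v)"
    using coxeter_res[OF E] by blast
  also have "\<dots> \<longleftrightarrow> (\<forall>P\<in>M. \<forall>x\<in>corner_set (corners P). \<forall>y\<in>corner_set (corners P). [res x = res y] (mod 3))"
  proof -
    have "(\<forall>v\<in>side_vectors (corners P). 3 dvd res v) \<longleftrightarrow>
      (\<forall>x\<in>corner_set (corners P). \<forall>y\<in>corner_set (corners P). [res x = res y] (mod 3))" if P: "P \<in> M" for P
    proof -
      obtain x y z where xyz: "corners P = (x, y, z)" by (cases "corners P")
      have L: "x \<in> eisenstein" "y \<in> eisenstein" "z \<in> eisenstein" using tile.Cor_lattice[OF tile_M[OF P]] xyz by auto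
      have "(\<forall>v\<in>side_vectors (corners P). 3 dvd res v) \<longleftrightarrow>
        [res y = res x] (mod 3) \<and> [res z = res y] (mod 3) \<and> [res x = res z] (mod 3)"
        by (simp add: xyz res_diff L cong_iff_dvd_diff)
      also have "\<dots> \<longleftrightarrow> (\<forall>x\<in>corner_set (corners P). \<forall>y\<in>corner_set (corners P). [res x = res y] (mod 3))"
        by (auto simp: xyz cong_sym_eq)
      finally show ?thesis .
    qed
    then show ?thesis unfolding master_edges_def by blast
  qed
  also have "\<dots> \<longleftrightarrow> (\<exists>\<sigma>. colouring T \<sigma>)"
  proof
    assume "\<forall>P\<in>M. \<forall>x\<in>corner_set (corners P). \<forall>y\<in>corner_set (corners P). [res x = res y] (mod 3)"
    then show "\<exists>\<sigma>. colouring T \<sigma>" using tile_colouring by blast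
  next
    assume "\<exists>\<sigma>. colouring T \<sigma>"
    then show "\<forall>P\<in>M. \<forall>x\<in>corner_set (corners P). \<forall>y\<in>corner_set (corners P). [res x = res y] (mod 3)"
      using tile.colouring_corners[OF tile_M] by blast
  qed
  finally show ?thesis by blast
qed

end

section \<open>Cubic maps with pentagonal and hexagonal faces\<close>

lemma card_classes:
  assumes "finite A" "\<And>x. x \<in> A \<Longrightarrow> x \<in> h x \<and> h x \<subseteq> A \<and> card (h x) = k"
    "\<And>x y. x \<in> A \<Longrightarrow> y \<in> h x \<Longrightarrow> h y = h x"
  shows "k * card (h ` A) = card A"
proof -
  have U: "\<Union> (h ` A) = A" using assms(2) by blast
  have "k * card (h ` A) = card (\<Union> (h ` A))"
  proof (rule card_partition)
    show "finite (h ` A)" using assms(1) by blast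
    show "finite (\<Union> (h ` A))" unfolding U by (rule assms(1))
    show "card c = k" if "c \<in> h ` A" for c using that assms(2) by blast
    fix c1 c2 assume c: "c1 \<in> h ` A" "c2 \<in> h ` A" "c1 \<noteq> c2"
    show "c1 \<inter> c2 = {}"
    proof (rule ccontr)
      assume "c1 \<inter> c2 \<noteq> {}"
      then obtain z where "z \<in> c1" "z \<in> c2" by blast
      then have "h z = c1" "h z = c2" using c assms(3) by auto
      then show False using c by simp
    qed
  qed
  then show ?thesis using U by simp
qed

lemma orbit_subset_closed:
  assumes "x \<in> A" "\<And>y. y \<in> A \<Longrightarrow> p y \<in> A" shows "orbit p x \<subseteq> A"
proof
  fix y assume "y \<in> orbit p x" then show "y \<in> A" by induction (use assms in auto)
qed

lemma card_orbit_classes: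
  assumes "p permutes D" "finite D" "A \<subseteq> D" "\<And>y. y \<in> A \<Longrightarrow> p y \<in> A" "\<And>x. x \<in> A \<Longrightarrow> card (orbit p x) = k"
  shows "k * card (orbit p ` A) = card A"
proof (rule card_classes)
  show "finite A" using assms finite_subset by blast
  show "x \<in> orbit p x \<and> orbit p x \<subseteq> A \<and> card (orbit p x) = k" if "x \<in> A" for x
    using permutes_in_orbit[OF assms(1,2)] orbit_subset_closed[of x A p] assms that by blast
qed (use permutes_orbit_eq[OF assms(1,2)] in blast)

lemma card_edges:
  assumes "combinatorial_map G" shows "2 * card (edges G) = card (darts G)"
  unfolding edges_def
proof (rule card_classes)
  have o: "opp G permutes darts G" using assms by (simp add: combinatorial_map_def)
  show "d \<in> {d, opp G d} \<and> {d, opp G d} \<subseteq> darts G \<and> card {d, opp G d} = 2" if "d \<in> darts G" for d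
    using assms that permutes_in_image[OF o] by (auto simp: combinatorial_map_def card_2_iff)
  show "{e, opp G e} = {d, opp G d}" if "d \<in> darts G" "e \<in> {d, opp G d}" for d e
    using assms that by (auto simp: combinatorial_map_def)
qed (use assms in \<open>auto simp: combinatorial_map_def\<close>)

text \<open>Simplicity, connectedness and Euler's formula are left out, so that the preimage can be
  treated before these are established for it.\<close>

locale cubic =
  fixes G :: "'d cmap"
  assumes comb: "combinatorial_map G"
    and vertex_card: "\<And>d. d \<in> darts G \<Longrightarrow> card (orbit (rot G) d) = 3"
    and face_card: "\<And>d. d \<in> darts G \<Longrightarrow> card (orbit (face G) d) = 5 \<or> card (orbit (face G) d) = 6"
begin

lemma fin: "finite (darts G)" and opp_perm: "opp G permutes darts G" and rot_perm: "rot G permutes darts G"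
  using comb by (auto simp: combinatorial_map_def)

lemma opp_in [simp, intro]: "d \<in> darts G \<Longrightarrow> opp G d \<in> darts G"
  and rot_in [simp, intro]: "d \<in> darts G \<Longrightarrow> rot G d \<in> darts G"
  using opp_perm rot_perm by (simp_all add: permutes_in_image)

lemma opp_opp [simp]: "opp G (opp G d) = d"
  using comb permutes_not_in[OF opp_perm] by (cases "d \<in> darts G") (auto simp: combinatorial_map_def)

lemma opp_neq: "d \<in> darts G \<Longrightarrow> opp G d \<noteq> d"
  using comb by (auto simp: combinatorial_map_def)

lemma rot_3 [simp]: "rot G (rot G (rot G d)) = d"
proof (cases "d \<in> darts G")
  case True
  then have "(rot G ^^ 3) d = d" using orbit_card_funpow(1)[OF rot_perm fin] vertex_card by metis
  then show ?thesis by (simp add: numeral_3_eq_3)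
next
  case False then show ?thesis using permutes_not_in[OF rot_perm] by simp
qed

lemma rot_neq: "d \<in> darts G \<Longrightarrow> rot G d \<noteq> d" "d \<in> darts G \<Longrightarrow> rot G (rot G d) \<noteq> d"
  using orbit_card_funpow(2)[OF rot_perm fin, of 1 d] orbit_card_funpow(2)[OF rot_perm fin, of 2 d] vertex_card
  by (simp_all add: numeral_2_eq_2)

lemma orbit_rot: "orbit (rot G) d = {d, rot G d, rot G (rot G d)}"
proof -
  have "(rot G ^^ 3) d = d" by (simp add: numeral_3_eq_3)
  then have "orbit (rot G) d = {(rot G ^^ m) d | m. m < 3}" by (rule orbit_altdef_bounded) simp
  also have "\<dots> = (\<lambda>m. (rot G ^^ m) d) ` {m. m < 3}" by blast
  also have "{m::nat. m < 3} = {0, 1, 2}" by auto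
  finally show ?thesis by (simp add: numeral_2_eq_2)
qed

lemma face_eq: "face G d = rot G (rot G (opp G d))"
proof -
  have "inv (rot G) (rot G (rot G (rot G (opp G d)))) = rot G (rot G (opp G d))"
    by (simp only: permutes_inverses[OF rot_perm])
  then show ?thesis by (simp add: face_def)
qed

lemma face_perm: "face G permutes darts G"
proof -
  have "face G = inv (rot G) \<circ> opp G" by (auto simp: face_def)
  then show ?thesis using permutes_compose[OF opp_perm permutes_inv[OF rot_perm]] by simp
qed

lemma face_in [simp, intro]: "d \<in> darts G \<Longrightarrow> face G d \<in> darts G"
  by (simp add: face_eq)

lemma face_long: 
  assumes "d \<in> darts G" "0 < j" "j < 5" shows "(face G ^^ j) d \<noteq> d"
  using orbit_card_funpow(2)[OF face_perm fin, of j d] face_card[OF assms(1)] assms by linarith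

lemma no_loop: "d \<in> darts G \<Longrightarrow> opp G d \<noteq> rot G d"
  using face_long[of d 1] by (auto simp: face_eq)

lemma face_orbit_step: "d \<in> darts G \<Longrightarrow> orbit (face G) (face G d) = orbit (face G) d"
  using self_in_orbit_step permutes_in_orbit[OF face_perm fin] by metis

text \<open>
  \<open>digon q\<close>: the two darts following \<open>q\<close> around its origin lie on two parallel edges that are not
  the two sides of a digonal face.
\<close>

definition digon :: "'d \<Rightarrow> bool" where
  "digon q \<longleftrightarrow> q \<in> darts G \<and> opp G (rot G (rot G q)) = rot G (opp G (rot G q))"

text \<open>At the other end the two parallel edges follow each other in the opposite order, so the
  third dart there is in the same situation.\<close>

lemma digon_across:
  assumes "digon q" shows "digon (rot G (rot G (opp G (rot G q))))"
  using assms unfolding digon_def by (metis opp_in opp_opp rot_3 rot_in)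

text \<open>A face of size at most six leaves no choice for the other end of the edge of \<open>q\<close>.\<close>

lemma digon_opp:
  assumes q: "digon q" shows "card (orbit (face G) q) = 6" "digon (opp G q)"
proof -
  define y where "y = opp G q"
  define e where "e = opp G (rot G q)"
  have D: "q \<in> darts G" "y \<in> darts G" "e \<in> darts G" using q by (auto simp: digon_def y_def e_def)
  have Q: "opp G (rot G (rot G q)) = rot G e" using q by (simp add: digon_def e_def)
  \<comment> \<open>The darts \<open>y\<close>, \<open>rot G (rot G q)\<close>, \<open>e\<close>,
    \<open>q\<close> and \<open>rot G (rot G y)\<close> follow each other on one face, which leaves
    at most one further dart.\<close>
  have f1: "face G y = rot G (rot G q)" by (simp add: face_eq y_def)
  have f2: "face G (rot G (rot G q)) = e" by (simp add: face_eq Q)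
  have f3: "face G e = q" by (simp add: face_eq e_def)
  have f4: "face G q = rot G (rot G y)" by (simp add: face_eq y_def)
  have orb: "orbit (face G) q = orbit (face G) y"
    using face_orbit_step D f1 f2 f3 by (metis rot_in)
  \<comment> \<open>A pentagon would close up with a loop at the far end of \<open>q\<close>. A
    hexagon closes up with two parallel edges there.\<close>
  have "card (orbit (face G) y) \<noteq> 5"
  proof
    assume "card (orbit (face G) y) = 5"
    then have "(face G ^^ 5) y = y" using orbit_card_funpow(1)[OF face_perm fin] by metis
    then have "face G (rot G (rot G y)) = y" by (simp add: numeral_eq_Suc f1 f2 f3 f4)
    then have "opp G (rot G (rot G y)) = rot G y" unfolding face_eq by (metis rot_3)
    then have "opp G (rot G y) = rot G (rot G y)" by (metis opp_opp)
    then show False using no_loop D by blast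
  qed
  then have 6: "card (orbit (face G) y) = 6" using face_card D by blast
  then show "card (orbit (face G) q) = 6" using orb by simp
  have "(face G ^^ 6) y = y" using orbit_card_funpow(1)[OF face_perm fin] 6 by metis
  then have "face G (face G (rot G (rot G y))) = y" by (simp add: numeral_eq_Suc f1 f2 f3 f4)
  then have "opp G (face G (rot G (rot G y))) = rot G y" unfolding face_eq[of "face G _"] by (metis rot_3)
  then have "face G (rot G (rot G y)) = opp G (rot G y)" by (metis opp_opp)
  then have "opp G (rot G (rot G y)) = rot G (opp G (rot G y))" unfolding face_eq by (metis rot_3)
  then show "digon (opp G q)" using D by (simp add: digon_def y_def)
qed

section \<open>A digon spreads over the whole map\<close>

definition near_digon :: "'d \<Rightarrow> bool" where
  "near_digon x \<longleftrightarrow> x \<in> darts G \<and> (digon x \<or> digon (rot G x) \<or> digon (rot G (rot G x)))"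

lemma near_digon_rot: "near_digon x \<Longrightarrow> near_digon (rot G x)"
  by (auto simp: near_digon_def)

lemma near_digon_opp:
  assumes "near_digon x" shows "near_digon (opp G x)"
proof -
  have x: "x \<in> darts G" using assms by (simp add: near_digon_def)
  consider "digon x" | "digon (rot G x)" | "digon (rot G (rot G x))" using assms by (auto simp: near_digon_def)
  then show ?thesis
  proof cases
    case 1
    then show ?thesis using digon_opp(2) x by (auto simp: near_digon_def)
  next
    case 2
    have "opp G x = rot G (opp G (rot G (rot G x)))" using 2 by (simp add: digon_def)
    then have "digon (rot G (opp G x))" using digon_across[OF 2] by simp
    then show ?thesis using x by (auto simp: near_digon_def)
  next
    case 3
    then have "digon (rot G (rot G (opp G x)))" using digon_across[OF 3] by simp
    then show ?thesis using x by (auto simp: near_digon_def)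
  qed
qed

lemma near_digon_face:
  assumes "near_digon x" shows "card (orbit (face G) x) = 6"
proof -
  have x: "x \<in> darts G" using assms by (simp add: near_digon_def)
  consider "digon x" | "digon (rot G x)" | "digon (rot G (rot G x))" using assms by (auto simp: near_digon_def)
  then show ?thesis
  proof cases
    case 1 then show ?thesis using digon_opp by blast
  next
    case 2
    have "opp G x = rot G (opp G (rot G (rot G x)))" using 2 by (simp add: digon_def)
    then have "face G x = opp G (rot G (rot G x))" by (simp add: face_eq)
    moreover have "face G (opp G (rot G (rot G x))) = rot G x" by (simp add: face_eq)
    ultimately have "orbit (face G) (rot G x) = orbit (face G) x" using face_orbit_step x by (metis face_in)
    then show ?thesis using digon_opp[OF 2] by simp
  next
    case 3
    then have "digon (face G x)" using digon_across[OF 3] by (simp add: face_eq)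
    then show ?thesis using digon_opp(1) face_orbit_step x by metis
  qed
qed

lemma card_vertices: "3 * card (vertices G) = card (darts G)"
  unfolding vertices_def by (rule card_orbit_classes[OF rot_perm fin]) (use vertex_card in auto)

lemma simple:
  assumes conn: "connected_map G" and euler: "card (vertices G) + card (faces G) = card (edges G) + 2"
  shows "simple_map G"
proof -
  have no_digon: "\<not> digon q" for q
  proof
    assume q: "digon q"
    have "near_digon x" if x: "x \<in> darts G" for x
    proof -
      have "(q, x) \<in> {(x, y). x \<in> darts G \<and> (y = opp G x \<or> y = rot G x)}\<^sup>*"
        using conn q x by (auto simp: connected_map_def digon_def)
      then show ?thesis
      proof (induction rule: rtrancl_induct)
        case base show ?case using q by (auto simp: near_digon_def digon_def)
      qed (auto intro: near_digon_rot near_digon_opp)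
    qed
    \<comment> \<open>Counting darts gives \<open>6 f = 3 v = 2 e\<close>, hence
      \<open>v + f = e\<close>, which contradicts Euler's formula.\<close>
    then have "6 * card (faces G) = card (darts G)"
      unfolding faces_def by (intro card_orbit_classes[OF face_perm fin]) (auto simp: near_digon_face)
    then show False using card_vertices card_edges[OF comb] euler by linarith
  qed
  have no_parallel: "opp G (rot G d) \<notin> orbit (rot G) (opp G d)" if d: "d \<in> darts G" for d
  proof
    assume "opp G (rot G d) \<in> orbit (rot G) (opp G d)"
    \<comment> \<open>The three darts at the far vertex: equal darts, a digon in the above sense, or
      a face of length 2.\<close>
    then consider "opp G (rot G d) = opp G d" | "opp G (rot G d) = rot G (opp G d)"
      | "opp G (rot G d) = rot G (rot G (opp G d))" unfolding orbit_rot by blast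
    then show False
    proof cases
      case 1
      then have "rot G d = d" by (metis opp_opp)
      then show ?thesis using rot_neq d by blast
    next
      case 2
      then have "digon (rot G (rot G d))" using d by (simp add: digon_def)
      then show ?thesis using no_digon by blast
    next
      case 3
      then have "face G d = opp G (rot G d)" by (simp add: face_eq)
      then have "face G (face G d) = d" by (simp add: face_eq)
      then show ?thesis using face_long[OF d, of 2] by (simp add: numeral_2_eq_2)
    qed
  qed
  show ?thesis
    unfolding simple_map_def
  proof (intro conjI ballI impI)
    fix d assume d: "d \<in> darts G"
    show "opp G d \<notin> orbit (rot G) d"
      using opp_neq[OF d] no_loop[OF d] no_loop[of "opp G d"] d unfolding orbit_rot
      by (metis empty_iff insert_iff opp_in opp_opp rot_3)
  next
    fix d d' assume d: "d \<in> darts G" "d' \<in> darts G"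
      and *: "d' \<in> orbit (rot G) d \<and> opp G d' \<in> orbit (rot G) (opp G d)"
    from * consider "d' = d" | "d' = rot G d" | "d = rot G d'" unfolding orbit_rot by auto
    then show "d' = d"
    proof cases
      case 2 then show ?thesis using no_parallel d * by blast
    next
      case 3
      have "opp G d \<in> orbit (rot G) (opp G d')"
        using permutes_orbit_eq[OF rot_perm fin] * permutes_in_orbit[OF rot_perm fin] by metis
      then show ?thesis using no_parallel d 3 by blast
    qed
  qed
qed

end

section \<open>The dual of a fullerene\<close>

locale fuller =
  fixes F :: "'d cmap" assumes fullerene: "fullerene F"
begin

sublocale F: cubic F
proof
  show "combinatorial_map F" using fullerene by (simp add: fullerene_def plane_graph_def)
qed (use fullerene in \<open>auto simp: fullerene_def vertices_def faces_def\<close>)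

abbreviation "T \<equiv> dual F"

lemma dual_simps [simp]: "darts T = darts F" "opp T = opp F" "rot T = face F"
  by (simp_all add: dual_def)

lemma face_T: "face T d = opp F (rot F (opp F d))"
proof -
  have "inv (face F) (face F (opp F (rot F (opp F d)))) = opp F (rot F (opp F d))"
    by (simp only: permutes_inverses[OF F.face_perm])
  moreover have "face F (opp F (rot F (opp F d))) = opp F d" by (simp add: F.face_eq)
  ultimately show ?thesis by (simp add: face_def[of T])
qed

sublocale triangulation T
proof
  show "combinatorial_map T" using F.comb F.face_perm by (simp add: combinatorial_map_def)
qed (simp add: face_T)

lemma degree: "d \<in> darts T \<Longrightarrow> card (orbit (rot T) d) = 5 \<or> card (orbit (rot T) d) = 6"
  using F.face_card by simp

lemma rot_F: "rot F d = opp F (face T (opp F d))"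
  by (simp add: face_T)

lemma connected_F: "connected_map F"
  and euler_F: "card (vertices F) + card (faces F) = card (edges F) + 2"
  using fullerene by (auto simp: fullerene_def plane_graph_def)

end

lemma orbit_image:
  assumes "x \<in> A" "\<And>y. y \<in> A \<Longrightarrow> p y \<in> A" "\<And>y. y \<in> A \<Longrightarrow> h (p y) = q (h y)"
  shows "h ` orbit p x = orbit q (h x)"
proof -
  have *: "(p ^^ n) x \<in> A \<and> h ((p ^^ n) x) = (q ^^ n) (h x)" for n
    by (induction n) (use assms in auto)
  then show ?thesis unfolding orbit_altdef by (auto simp: image_def)
qed

section \<open>Undoing the leapfrog transformation\<close>

locale coloured = fuller F for F :: "'d cmap" +
  fixes \<sigma> :: "'d \<Rightarrow> int" assumes colouring: "colouring T \<sigma>"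
begin

definition col :: "'d \<Rightarrow> int" where "col d = \<sigma> d mod 3"

lemma col_face: "d \<in> darts F \<Longrightarrow> col (face T d) = (col d - 1) mod 3"
  and col_opp: "d \<in> darts F \<Longrightarrow> col (opp F d) = (1 - col d) mod 3"
  using colouring by (simp_all add: colouring_def col_def cong_def mod_diff_left_eq mod_diff_right_eq)

lemma col_rot: "d \<in> darts F \<Longrightarrow> col (face F d) = (- col d) mod 3"
  using colouring_rot[OF colouring, of d] by (simp add: col_def cong_def mod_minus_eq)

lemma col_cases: "col d = 0 \<or> col d = 1 \<or> col d = 2"
proof -
  have "0 \<le> col d" "col d < 3" by (simp_all add: col_def)
  then show ?thesis by linarith
qed

definition layer :: "int \<Rightarrow> 'd set" where "layer i = {d \<in> darts F. col d = i}"

lemma layer_darts: "layer i \<subseteq> darts F" by (auto simp: layer_def)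

lemma layer_finite: "finite (layer i)" using finite_darts by (simp add: layer_def)

lemma inj_face: "inj_on (face T) (darts F)"
  using face_inj by (auto intro: inj_onI)

lemma face_layer: "face T ` layer 0 = layer 2" "face T ` layer 2 = layer 1" "face T ` layer 1 = layer 0"
proof -
  have s: "face T ` layer 0 \<subseteq> layer 2" "face T ` layer 2 \<subseteq> layer 1" "face T ` layer 1 \<subseteq> layer 0"
    using face_in by (auto simp: layer_def col_face)
  have m: "face T x \<in> layer 2" if "x \<in> layer 0" for x using s(1) that by blast
  have m': "face T x \<in> layer 1" if "x \<in> layer 2" for x using s(2) that by blast
  have m'': "face T x \<in> layer 0" if "x \<in> layer 1" for x using s(3) that by blast
  have 3: "x = face T (face T (face T x))" if "x \<in> layer i" for x i using face_3[of x] that by (simp add: layer_def)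
  have "x \<in> face T ` layer 0" if "x \<in> layer 2" for x
    using imageI[OF m''[OF m'[OF that]], of "face T"] 3[OF that] by simp
  then show "face T ` layer 0 = layer 2" using s(1) by blast
  have "x \<in> face T ` layer 2" if "x \<in> layer 1" for x
    using imageI[OF m[OF m''[OF that]], of "face T"] 3[OF that] by simp
  then show "face T ` layer 2 = layer 1" using s(2) by blast
  have "x \<in> face T ` layer 1" if "x \<in> layer 0" for x
    using imageI[OF m'[OF m[OF that]], of "face T"] 3[OF that] by simp
  then show "face T ` layer 1 = layer 0" using s(3) by blast
qed

text \<open>Every triangle of \<open>T\<close> has one dart of each colour.\<close>

lemma card_layer: "card (layer 0) = card (layer 2)" "card (layer 1) = card (layer 2)"
  "card (darts F) = 3 * card (layer 2)"
proof -
  have i: "card (face T ` layer i) = card (layer i)" for i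
    by (rule card_image[OF inj_on_subset[OF inj_face layer_darts]])
  show 1: "card (layer 0) = card (layer 2)" "card (layer 1) = card (layer 2)"
    using i[of 0] i[of 2] i[of 1] by (simp_all add: face_layer)
  have D: "darts F = layer 0 \<union> (layer 1 \<union> layer 2)" using col_cases by (auto simp: layer_def)
  have "card (layer 0 \<union> (layer 1 \<union> layer 2)) = card (layer 0) + card (layer 1 \<union> layer 2)"
    using layer_finite by (intro card_Un_disjoint) (auto simp: layer_def)
  also have "card (layer 1 \<union> layer 2) = card (layer 1) + card (layer 2)"
    using layer_finite by (intro card_Un_disjoint) (auto simp: layer_def)
  finally have "card (darts F) = card (layer 0) + (card (layer 1) + card (layer 2))" unfolding D .
  then show "card (darts F) = 3 * card (layer 2)" using 1 by simp
qed

text \<open>The hexagons of colour other than \<open>0\<close> become the vertices of \<open>G\<close>.\<close>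

definition G :: "'d cmap" where
  "G = \<lparr>darts = layer 2, opp = (\<lambda>d. if d \<in> layer 2 then opp F d else d),
     rot = (\<lambda>d. if d \<in> layer 2 then face F (face F d) else d)\<rparr>"

lemma rot_6: assumes "d \<in> darts F" "col d \<noteq> 0"
  shows "card (orbit (face F) d) = 6" "(face F ^^ 6) d = d"
proof -
  have "card (orbit (rot T) d) \<noteq> 5"
  proof
    assume "card (orbit (rot T) d) = 5"
    then have "[\<sigma> d = 0] (mod 3)" using colouring_pentagon[OF colouring, of d] assms by simp
    then show False using assms by (simp add: col_def cong_def)
  qed
  then show 6: "card (orbit (face F) d) = 6" using degree[of d] assms by simp
  show "(face F ^^ 6) d = d" using orbit_card_funpow(1)[OF F.face_perm F.fin] 6 by metis
qed

lemma opp_layer: "d \<in> layer 2 \<Longrightarrow> opp F d \<in> layer 2"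
  by (auto simp: layer_def col_opp)

lemma rot_layer: "d \<in> layer 2 \<Longrightarrow> face F (face F d) \<in> layer 2"
  by (auto simp: layer_def col_rot)

lemma darts_G [simp]: "darts G = layer 2" by (simp add: G_def)

lemma comb_G: "combinatorial_map G"
  unfolding combinatorial_map_def
proof (intro conjI)
  show "finite (darts G)" using layer_finite by simp
  have "darts F \<noteq> {}" using F.comb by (simp add: combinatorial_map_def)
  then have "card (darts F) > 0" using F.fin by (simp add: card_gt_0_iff)
  then show "darts G \<noteq> {}" using card_layer(3) by auto
  show "opp G permutes darts G"
  proof (rule bij_imp_permutes)
    show "bij_betw (opp G) (darts G) (darts G)"
      by (rule bij_betw_byWitness[of _ "opp G"]) (auto simp: G_def opp_layer)
  qed (simp add: G_def)
  show "rot G permutes darts G"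
  proof (rule bij_imp_permutes)
    have 6: "face F (face F (face F (face F (face F (face F d))))) = d" if "d \<in> layer 2" for d
      using rot_6(2)[of d] that by (simp add: layer_def numeral_eq_Suc)
    show "bij_betw (rot G) (darts G) (darts G)"
      by (rule bij_betw_byWitness[of _ "\<lambda>d. rot G (rot G d)"]) (auto simp: G_def rot_layer 6)
  qed (simp add: G_def)
  show "\<forall>d\<in>darts G. opp G (opp G d) = d \<and> opp G d \<noteq> d"
    using F.opp_neq by (auto simp: G_def opp_layer layer_def col_opp)
qed

text \<open>\<open>face G\<close> runs along the link of a distinguished vertex. In \<open>T\<close>
  this means: turn to the side that leads to that vertex, cross it, and take the next side of the
  neighbouring triangle.\<close>

lemma face_G:
  assumes d: "d \<in> layer 2"
  shows "face G d = face T (opp F (face T d))" "face G d \<in> layer 2"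
proof -
  have D: "d \<in> darts F" "face T d \<in> darts F" "opp F (face T d) \<in> darts F" "face T (opp F (face T d)) \<in> darts F"
    using d layer_darts face_in[of d] face_in[of "opp F (face T d)"] by auto
  have L: "face T (opp F (face T d)) \<in> layer 2"
    using d D by (simp add: layer_def col_face col_opp)
  have "face F (face F (face T (opp F (face T d)))) = opp F d"
    using rot_face[of "opp F (face T d)"] rot_face[of d] opp_opp[of "face T d"] D by simp
  then have "rot G (face T (opp F (face T d))) = opp G d" using d L by (simp add: G_def)
  moreover have "rot G permutes darts G" using comb_G by (simp add: combinatorial_map_def)
  ultimately show "face G d = face T (opp F (face T d))" unfolding face_def[of G]
    by (metis permutes_inverses(2))
  then show "face G d \<in> layer 2" using L by simp
qed

text \<open>Faces of \<open>G\<close> correspond to the faces of \<open>F\<close> of colour \<open>0\<close>.\<close>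

definition to0 :: "'d \<Rightarrow> 'd" where "to0 d = face T (face T d)"

lemma to0: "inj_on to0 (darts F)" "to0 ` layer 2 = layer 0"
proof -
  show "inj_on to0 (darts F)" unfolding to0_def using face_inj face_in by (auto intro!: inj_onI)
  have "to0 ` layer 2 = face T ` face T ` layer 2" by (simp add: to0_def image_image)
  then show "to0 ` layer 2 = layer 0" by (simp add: face_layer)
qed

lemma to0_face: assumes "d \<in> layer 2" shows "to0 (face G d) = face F (to0 d)"
proof -
  have D: "d \<in> darts F" "opp F (face T d) \<in> darts F" using assms layer_darts face_in[of d] by auto
  have "to0 (face G d) = opp F (face T d)" using face_3[of "opp F (face T d)"] D by (simp add: to0_def face_G(1)[OF assms])
  also have "\<dots> = face F (to0 d)" using rot_face[of "face T d"] by (simp add: to0_def)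
  finally show ?thesis .
qed

lemma orbit_face_G: assumes "d \<in> layer 2"
  shows "to0 ` orbit (face G) d = orbit (face F) (to0 d)" "orbit (face G) d \<subseteq> layer 2"
proof -
  show "to0 ` orbit (face G) d = orbit (face F) (to0 d)"
    by (rule orbit_image[of _ "layer 2"]) (use assms face_G(2) to0_face in auto)
  show "orbit (face G) d \<subseteq> layer 2" using orbit_subset_closed[of d "layer 2"] assms face_G(2) by blast
qed

sublocale G: cubic G
proof
  show "combinatorial_map G" by (rule comb_G)
  fix d assume "d \<in> darts G"
  then have d: "d \<in> layer 2" by simp
  have D: "d \<in> darts F" "col d \<noteq> 0" using d by (auto simp: layer_def)
  \<comment> \<open>\<open>rot G\<close> is the square of \<open>face F\<close>, whose period at
    \<open>d\<close> is 6.\<close>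
  have s: "(rot G ^^ n) d = (face F ^^ (2 * n)) d \<and> (face F ^^ (2 * n)) d \<in> layer 2" for n
    by (induction n) (use d in \<open>auto simp: G_def rot_layer\<close>)
  show "card (orbit (rot G) d) = 3"
  proof (rule card_orbit_eqI)
    show "(rot G ^^ 3) d = d" using s[of 3] rot_6(2)[OF D] by simp
    show "(rot G ^^ j) d \<noteq> d" if "0 < j" "j < 3" for j
      using s[of j] orbit_card_funpow(2)[OF F.face_perm F.fin, of "2 * j" d] rot_6(1)[OF D] that by simp
  qed simp
  have "inj_on to0 (orbit (face G) d)"
    using orbit_face_G(2)[OF d] layer_darts to0(1) inj_on_subset by metis
  then have "card (orbit (face G) d) = card (orbit (face F) (to0 d))"
    using orbit_face_G(1)[OF d] card_image by metis
  moreover have "to0 d \<in> darts F" using D by (simp add: to0_def face_in[simplified])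
  ultimately show "card (orbit (face G) d) = 5 \<or> card (orbit (face G) d) = 6" using F.face_card by simp
qed

text \<open>Faces of \<open>F\<close> of colour 0 correspond to the faces of \<open>G\<close>. The
  others are hexagons, and their number is a third of \<open>card (layer 2)\<close>; substituting
  this in Euler's formula for \<open>F\<close> gives the one for \<open>G\<close>.\<close>

lemma euler_G: "card (vertices G) + card (faces G) = card (edges G) + 2"
proof -
  define A where "A = layer 1 \<union> layer 2"
  have DA: "darts F = layer 0 \<union> A" using col_cases by (auto simp: layer_def A_def)
  have A: "d \<in> A \<longleftrightarrow> d \<in> darts F \<and> col d \<noteq> 0" for d using col_cases[of d] by (auto simp: layer_def A_def)
  have cA: "face F d \<in> A" if "d \<in> A" for d using that col_cases[of d] by (auto simp: A col_rot)
  have c0: "face F d \<in> layer 0" if "d \<in> layer 0" for d using that by (auto simp: layer_def col_rot)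
  have "faces F = orbit (face F) ` layer 0 \<union> orbit (face F) ` A" unfolding faces_def DA by blast
  moreover have "orbit (face F) ` layer 0 \<inter> orbit (face F) ` A = {}"
  proof (rule ccontr)
    assume "orbit (face F) ` layer 0 \<inter> orbit (face F) ` A \<noteq> {}"
    then obtain x y where xy: "x \<in> layer 0" "y \<in> A" "orbit (face F) x = orbit (face F) y" by blast
    have "y \<in> layer 0"
      using orbit_subset_closed[of x "layer 0" "face F"] xy c0 permutes_in_orbit[OF F.face_perm F.fin] by blast
    then show False using xy(2) by (auto simp: A layer_def)
  qed
  ultimately have f: "card (faces F) = card (orbit (face F) ` layer 0) + card (orbit (face F) ` A)"
    using layer_finite by (simp add: card_Un_disjoint A_def)
  have "card A = card (layer 1) + card (layer 2)"
    unfolding A_def using layer_finite by (intro card_Un_disjoint) (auto simp: layer_def)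
  moreover have "6 * card (orbit (face F) ` A) = card A"
    by (rule card_orbit_classes[OF F.face_perm F.fin]) (use A cA rot_6(1) in auto)
  ultimately have h: "3 * card (orbit (face F) ` A) = card (layer 2)" using card_layer by simp
  have "(`) to0 ` faces G = orbit (face F) ` layer 0"
  proof -
    have "(`) to0 ` faces G = (\<lambda>d. orbit (face F) (to0 d)) ` layer 2"
      unfolding faces_def by (simp add: image_image orbit_face_G(1))
    also have "\<dots> = orbit (face F) ` to0 ` layer 2" by (simp add: image_image)
    finally show ?thesis by (simp add: to0(2))
  qed
  moreover have "inj_on ((`) to0) (faces G)"
  proof (rule inj_on_subset[OF inj_on_image_Pow[OF to0(1)]])
    show "faces G \<subseteq> Pow (darts F)" unfolding faces_def using orbit_face_G(2) layer_darts by fastforce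
  qed
  ultimately have g: "card (faces G) = card (orbit (face F) ` layer 0)" using card_image by metis
  show ?thesis
    using f g h card_layer(3) F.card_vertices G.card_vertices card_edges[OF F.comb] card_edges[OF comb_G] euler_F
    by simp
qed

text \<open>Every vertex of \<open>F\<close> has one dart of colour 2, since \<open>rot F\<close>
  raises the colour by 1; \<open>rep d\<close> is the one at the origin of \<open>d\<close>. Along
  \<open>rep\<close>, paths in \<open>F\<close> project to paths in \<open>G\<close>.\<close>

definition rep :: "'d \<Rightarrow> 'd" where
  "rep d = (if col d = 2 then d else if col d = 1 then rot F d else rot F (rot F d))"

lemma col_rot_F: assumes "d \<in> darts F" shows "col (rot F d) = (col d + 1) mod 3"
proof -
  have "face T (opp F d) \<in> darts F" using face_in[of "opp F d"] assms by simp
  then show ?thesis using assms col_cases[of d] by (auto simp: rot_F col_opp col_face)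
qed

abbreviation "moves \<equiv> {(x, y). x \<in> darts G \<and> (y = opp G x \<or> y = rot G x)}"

lemma moves_sym: "(x, y) \<in> moves\<^sup>* \<Longrightarrow> (y, x) \<in> moves\<^sup>*"
proof (induction rule: rtrancl_induct)
  case (step y z)
  then have y: "y \<in> darts G" "z = opp G y \<or> z = rot G y" by auto
  have "(z, y) \<in> moves\<^sup>*"
  proof (cases "z = opp G y")
    case True
    then have "(z, y) \<in> moves" using y G.opp_in G.opp_opp by auto
    then show ?thesis by blast
  next
    case False
    then have "(z, rot G z) \<in> moves" "(rot G z, y) \<in> moves" using y G.rot_in G.rot_3 by auto
    then show ?thesis by (meson r_into_rtrancl rtrancl_trans)
  qed
  then show ?case using step.IH by (rule rtrancl_trans)
qed simp

text \<open>The two triangles at \<open>d\<close> are neighbours around a distinguished vertex.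
  Their edges of colour 2 are consecutive in its link, so one reversal and one rotation of
  \<open>G\<close> connect them.\<close>

lemma rep_opp_0:
  assumes d: "d \<in> darts F" "col d = 0" shows "(rep (opp F d), rep d) \<in> moves\<^sup>*"
proof -
  have fd: "face T d \<in> darts F" "opp F d \<in> darts F" using face_in[of d] d by auto
  have L: "face T d \<in> layer 2" using d fd by (simp add: layer_def col_face)
  have r1: "rep (opp F d) = opp F (face T d)" using d by (simp add: rep_def col_opp rot_F)
  have r2: "rep d = opp F (face T (face T (opp F d)))" using d by (simp add: rep_def rot_F)
  have 1: "(rep (opp F d), face T d) \<in> moves" using L opp_layer[OF L] by (simp add: r1 G_def)
  have "face F (face F (face T d)) = rep d"
    using rot_face[of d] opp_face_face[of "opp F d"] fd r2 by simp
  then have 2: "(face T d, rep d) \<in> moves" using L by (simp add: G_def)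
  show ?thesis using 1 2 by (meson r_into_rtrancl rtrancl_trans)
qed

lemma rep_step:
  assumes d: "d \<in> darts F" and e: "e = opp F d \<or> e = rot F d" shows "(rep d, rep e) \<in> moves\<^sup>*"
proof (cases "e = rot F d")
  case True
  have "rep (rot F d) = rep d" using d col_cases[of d] by (auto simp: rep_def col_rot_F)
  then show ?thesis using True by simp
next
  case False
  then have e: "e = opp F d" using assms by simp
  consider "col d = 0" | "col d = 1" | "col d = 2" using col_cases by blast
  then show ?thesis
  proof cases
    case 1
    then show ?thesis using rep_opp_0[OF d] moves_sym e by blast
  next
    case 2
    then have "col (opp F d) = 0" using d by (simp add: col_opp)
    then show ?thesis using rep_opp_0[of "opp F d"] d e by simp
  next
    case 3
    then have "d \<in> layer 2" "rep d = d" "rep e = opp F d" using d e by (auto simp: rep_def layer_def col_opp)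
    then have "(rep d, rep e) \<in> moves" by (simp add: G_def)
    then show ?thesis by blast
  qed
qed

lemma connected_G: "connected_map G"
  unfolding connected_map_def
proof (intro ballI)
  fix x y assume x: "x \<in> darts G" and y: "y \<in> darts G"
  have "(x, y) \<in> {(x, y). x \<in> darts F \<and> (y = opp F x \<or> y = rot F x)}\<^sup>*"
    using connected_F x y layer_darts by (auto simp: connected_map_def)
  then have "(rep x, rep y) \<in> moves\<^sup>*"
  proof (induction rule: rtrancl_induct)
    case (step y z)
    then have "(rep y, rep z) \<in> moves\<^sup>*" using rep_step by blast
    then show ?case using step.IH by (meson rtrancl_trans)
  qed simp
  moreover have "rep x = x" "rep y = y" using x y by (auto simp: rep_def layer_def)
  ultimately show "(x, y) \<in> moves\<^sup>*" by simp
qed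

lemma fullerene_G: "fullerene G"
proof -
  have "plane_graph G"
    unfolding plane_graph_def using comb_G connected_G G.simple[OF connected_G euler_G] euler_G by blast
  then show ?thesis
    unfolding fullerene_def vertices_def faces_def using G.vertex_card G.face_card by blast
qed

end

section \<open>The rhombus of the leapfrog transformation\<close>

definition patch :: "complex set" where
  "patch = interior (convex hull {0, 1 + omega, omega * (1 + omega)})"

definition rhombus :: "complex set" where
  "rhombus = interior (convex hull {0, (1 + omega) / omega, 1 + omega, omega * (1 + omega)})"

lemma goldberg_coxeter_1_1:
  "goldberg_coxeter 1 1 G F \<longleftrightarrow> card (darts F) = 3 * card (darts G) \<and>
     (\<exists>\<Psi>. \<forall>d\<in>darts (dual G).
        unfolds (dual F) rhombus (\<Psi> d) \<and>
        (\<forall>\<delta>\<in>ldarts. ltri \<delta> \<inter> rhombus \<noteq> {} \<longrightarrow>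
           \<Psi> (opp (dual G) d) (move (-1) (1 + omega) \<delta>) = \<Psi> d \<delta>) \<and>
        (\<forall>\<delta>\<in>ldarts. ltri \<delta> \<inter> patch \<noteq> {} \<longrightarrow>
           \<Psi> (face (dual G) d) (move (1 / omega\<^sup>2) (- (1 + omega) / omega\<^sup>2) \<delta>) = \<Psi> d \<delta>))"
proof -
  have e: "(1::nat)\<^sup>2 + 1 * 1 + 1\<^sup>2 = 3" "of_nat 1 + of_nat 1 * omega = 1 + omega" "((1::nat), (1::nat)) \<noteq> (0, 0)"
    by simp_all
  show ?thesis unfolding goldberg_coxeter_def Let_def patch_def rhombus_def e(1,2) using e(3) by blast
qed

lemma omega_div: "(1 + omega) / omega = 2 - omega" "1 / omega\<^sup>2 = - omega"
  "- (1 + omega) / omega\<^sup>2 = 2 * omega - 1" "omega * (1 + omega) = 2 * omega - 1"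
proof -
  have w: "omega\<^sup>2 * - omega = 1" by (simp add: power2_eq_square omega_mult_self left_diff_distrib)
  have "1 / omega\<^sup>2 = (omega\<^sup>2 * - omega) / omega\<^sup>2" by (simp only: w)
  also have "\<dots> = - omega" by simp
  finally show *: "1 / omega\<^sup>2 = - omega" .
  have "- (1 + omega) / omega\<^sup>2 = - (1 + omega) * (1 / omega\<^sup>2)" by simp
  then show "- (1 + omega) / omega\<^sup>2 = 2 * omega - 1" unfolding * by (simp add: omega_mult_self algebra_simps)
  show "(1 + omega) / omega = 2 - omega" "omega * (1 + omega) = 2 * omega - 1"
    by (simp_all add: field_simps omega_mult_self)
qed

lemma patch_subset_rhombus: "patch \<subseteq> rhombus"
  unfolding patch_def rhombus_def by (intro interior_mono hull_mono) auto

lemma open_rhombus: "open rhombus"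
  by (simp add: rhombus_def)

lemma linear_coords: "linear (\<lambda>z. a * xc z + b * yc z)"
  by (rule linearI) (simp_all add: algebra_simps)

text \<open>The bounding lines are those of the four sides; linear bounds pass from the corners to
  the convex hull.\<close>

lemma rhombus_bounds:
  assumes "z \<in> rhombus"
  shows "0 \<le> xc z + 2 * yc z" "xc z + 2 * yc z \<le> 3" "0 \<le> 2 * xc z + yc z" "2 * xc z + yc z \<le> 3"
proof -
  define S where "S = (\<lambda>z. 1 * xc z + 2 * yc z) -` {0..3} \<inter> (\<lambda>z. 2 * xc z + 1 * yc z) -` {0..3}"
  have "convex S" unfolding S_def by (intro convex_Int convex_linear_vimage linear_coords convex_closed_interval)
  then have "convex hull {0, (1 + omega) / omega, 1 + omega, omega * (1 + omega)} \<subseteq> S"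
    by (intro hull_minimal) (auto simp: S_def omega_div)
  then have "z \<in> S" using assms interior_subset unfolding rhombus_def by blast
  then show "0 \<le> xc z + 2 * yc z" "xc z + 2 * yc z \<le> 3" "0 \<le> 2 * xc z + yc z" "2 * xc z + yc z \<le> 3"
    by (auto simp: S_def)
qed

lemma patch_bounds:
  assumes "z \<in> patch" shows "xc z \<le> yc z"
proof -
  define S where "S = (\<lambda>z. 1 * xc z + (-1) * yc z) -` {..0}"
  have "convex S" unfolding S_def by (intro convex_linear_vimage linear_coords) auto
  then have "convex hull {0, 1 + omega, omega * (1 + omega)} \<subseteq> S"
    by (intro hull_minimal) (auto simp: S_def omega_div)
  then have "z \<in> S" using assms interior_subset unfolding patch_def by blast
  then show ?thesis by (auto simp: S_def)
qed

lemma patchI: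
  assumes "0 < 2 * xc z + yc z" "xc z + 2 * yc z < 3" "xc z < yc z" shows "z \<in> patch"
proof -
  define S where "S = {z. 0 < 2 * xc z + yc z} \<inter> {z. xc z + 2 * yc z < 3} \<inter> {z. xc z < yc z}"
  have "open S" unfolding S_def by (intro open_Int open_Collect_less continuous_intros)
  moreover have "S \<subseteq> convex hull {0, 1 + omega, omega * (1 + omega)}"
  proof
    fix z assume z: "z \<in> S"
    define a b where "a = (2 * xc z + yc z) / 3" and "b = (yc z - xc z) / 3"
    have "z = 0 + a *\<^sub>R (1 + omega - 0) + b *\<^sub>R (omega * (1 + omega) - 0)"
      by (simp add: coord_eq_iff a_def b_def field_simps)
    moreover have "0 \<le> a" "0 \<le> b" "a + b \<le> 1" using z by (auto simp: S_def a_def b_def field_simps)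
    ultimately show "z \<in> convex hull {0, 1 + omega, omega * (1 + omega)}"
      unfolding convex_hull_3_alt by blast
  qed
  ultimately show ?thesis using assms unfolding patch_def by (auto simp: S_def intro: interiorI)
qed

text \<open>The points 1 and \<open>omega\<close> are the centres of the two patches, and each patch
  is contained in the hexagon of the six triangles around its centre. The integer bounds leave only
  these triangles.\<close>

lemma rhombus_star:
  assumes d: "\<delta> \<in> ldarts" and m: "ltri \<delta> \<inter> rhombus \<noteq> {}" shows "1 \<in> ctri \<delta> \<or> omega \<in> ctri \<delta>"
proof -
  obtain z where z: "z \<in> ltri \<delta>" "z \<in> rhombus" using m by blast
  note b = rhombus_bounds[OF z(2)]
  from d show ?thesis
  proof (cases rule: ldarts_cases)
    case (up m n)
    then have c: "ctri \<delta> = ctri (lat m n, 1)" "z \<in> ltri (lat m n, 1)" using z by auto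
    have "of_int m < xc z" "of_int n < yc z" "xc z + yc z < of_int m + of_int n + 1" using c(2) by (auto simp: ltri_up)
    then have "real_of_int (m + 2 * n) < 3" "real_of_int (m + 2 * n) > - 2" "real_of_int (2 * m + n) < 3" "real_of_int (2 * m + n) > - 2"
      using b by simp_all
    then have "m + 2 * n < 3" "m + 2 * n > - 2" "2 * m + n < 3" "2 * m + n > - 2" by linarith+
    then have "(m \<le> 1 \<and> n \<le> 0 \<and> 0 \<le> m + n) \<or> (m \<le> 0 \<and> n \<le> 1 \<and> 0 \<le> m + n)" by presburger
    then show ?thesis unfolding c(1) by (auto simp: ctri_up)
  next
    case (down m n)
    then have c: "ctri \<delta> = ctri (lat m n, -1)" "z \<in> ltri (lat m n, -1)" using z by auto
    have "xc z < of_int m" "yc z < of_int n" "of_int m + of_int n - 1 < xc z + yc z" using c(2) by (auto simp: ltri_down)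
    then have "real_of_int (m + 2 * n) < 5" "real_of_int (m + 2 * n) > 0" "real_of_int (2 * m + n) < 5" "real_of_int (2 * m + n) > 0"
      using b by simp_all
    then have "m + 2 * n < 5" "m + 2 * n > 0" "2 * m + n < 5" "2 * m + n > 0" by linarith+
    then have "(1 \<le> m \<and> 0 \<le> n \<and> m + n \<le> 2) \<or> (0 \<le> m \<and> 1 \<le> n \<and> m + n \<le> 2)" by presburger
    then show ?thesis unfolding c(1) by (auto simp: ctri_down)
  qed
qed

lemma patch_star:
  assumes d: "\<delta> \<in> ldarts" and m: "ltri \<delta> \<inter> patch \<noteq> {}" shows "omega \<in> ctri \<delta>"
proof -
  obtain z where z: "z \<in> ltri \<delta>" "z \<in> patch" using m by blast
  note b = rhombus_bounds[OF subsetD[OF patch_subset_rhombus z(2)]] patch_bounds[OF z(2)]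
  from d show ?thesis
  proof (cases rule: ldarts_cases)
    case (up m n)
    then have c: "ctri \<delta> = ctri (lat m n, 1)" "z \<in> ltri (lat m n, 1)" using z by auto
    have "of_int m < xc z" "of_int n < yc z" "xc z + yc z < of_int m + of_int n + 1" using c(2) by (auto simp: ltri_up)
    then have "real_of_int (m + 2 * n) < 3" "real_of_int (2 * m + n) > - 2" "real_of_int (n - m) > - 1"
      using b by simp_all
    then have "m + 2 * n < 3" "2 * m + n > - 2" "n - m > - 1" by linarith+
    then have "m \<le> 0 \<and> n \<le> 1 \<and> 0 \<le> m + n" by presburger
    then show ?thesis unfolding c(1) by (auto simp: ctri_up)
  next
    case (down m n)
    then have c: "ctri \<delta> = ctri (lat m n, -1)" "z \<in> ltri (lat m n, -1)" using z by auto
    have "xc z < of_int m" "yc z < of_int n" "of_int m + of_int n - 1 < xc z + yc z" using c(2) by (auto simp: ltri_down)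
    then have "real_of_int (m + 2 * n) < 5" "real_of_int (2 * m + n) > 0" "real_of_int (n - m) > - 1"
      using b by simp_all
    then have "m + 2 * n < 5" "2 * m + n > 0" "n - m > - 1" by linarith+
    then have "0 \<le> m \<and> 1 \<le> n \<and> m + n \<le> 2" by presburger
    then show ?thesis unfolding c(1) by (auto simp: ctri_down)
  qed
qed

lemma star_vertex:
  assumes "t \<in> eisenstein" "(p, u) \<in> ldarts" "t \<in> ctri (p, u)"
  shows "t = p \<or> t = p + u \<or> t = p + omega * u"
proof -
  obtain v where "(p, u) \<in> {(t, v), lface (t, v), lface (lface (t, v))}" using star_lattice[OF assms] by blast
  then consider "p = t" | "p = t + v" "u = omega\<^sup>2 * v" | "p = t + omega * v" "u = - omega * v"
    by (auto simp: lface_2) (auto simp: lface.simps)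
  then show ?thesis
  proof cases
    case 2
    then have "omega * u = - v" by (simp add: omega_square omega_mult_self left_diff_distrib right_diff_distrib)
    then show ?thesis using 2 by simp
  qed simp_all
qed

text \<open>Since 1 and \<open>omega\<close> are at distance 1, they cannot be the two corners
  opposite to a common edge. This excludes the mixed cases in \<open>Psi_unfolds\<close>.\<close>

lemma opposite_vertices:
  assumes "a \<in> eisenstein" "b \<in> eisenstein" "\<delta> \<in> ldarts"
    "a \<in> ctri \<delta>" "a \<notin> ctri (lopp \<delta>)" "b \<in> ctri (lopp \<delta>)" "b \<notin> ctri \<delta>"
  shows "norm (a - b) = sqrt 3"
proof -
  obtain p u where pu: "\<delta> = (p, u)" by (cases \<delta>)
  have "p \<in> ctri \<delta>" "p + u \<in> ctri \<delta>" "p \<in> ctri (lopp \<delta>)" "p + u \<in> ctri (lopp \<delta>)"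
    by (simp_all add: pu ctri.simps hull_inc)
  then have "a = p + omega * u" "b = p + u + omega * (- u)"
    using star_vertex[of a p u] star_vertex[of b "p + u" "- u"] lopp_ldarts[OF assms(3)] assms pu by auto
  then have "a - b = (2 * omega - 1) * u" by (simp add: algebra_simps)
  moreover have "2 * omega - 1 = Complex 0 (sqrt 3)" by (simp add: omega_eq complex_eq_iff)
  moreover have "norm u = 1" using assms(3) pu units_norm by simp
  ultimately show ?thesis by (simp add: norm_mult complex_norm)
qed

lemma norm_omega_1: "norm (omega - 1) = 1"
  using units_norm[of "omega - 1"] by (simp add: units_eq)

text \<open>
  The dart of the dual of \<open>G\<close> running from \<open>0\<close> to \<open>1 + \<omega>\<close> crosses the edge from \<open>1\<close> to \<open>\<omega>\<close>, i.e. from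
  the centre of the patch on its right to the centre of the patch on its left.
\<close>

definition dA :: ldart where "dA = (1, omega\<^sup>2)"
definition dB :: ldart where "dB = (omega, - omega\<^sup>2)"

lemma dA_dB: "lopp dA = dB" "lopp dB = dA" "dA \<in> ldarts" "dB \<in> ldarts" "dA = lface (0, 1)" "dB = lface (1 + omega, -1)"
  "lface dA = (omega, - omega)" "lface (lface dB) = (1 + omega, -1)"
  "move (-1) (1 + omega) dA = dB" "move (-1) (1 + omega) dB = dA"
proof -
  show "lopp dA = dB" "lopp dB = dA" by (simp_all add: dA_def dB_def omega_square)
  show A: "dA = lface (0, 1)" and B: "dB = lface (1 + omega, -1)"
    by (simp_all add: dA_def dB_def lface.simps omega_square)
  show "dA \<in> ldarts" "dB \<in> ldarts" unfolding A B by auto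
  show "lface dA = (omega, - omega)" by (simp add: A lface_2)
  show "lface (lface dB) = (1 + omega, -1)" by (simp add: B)
  show "move (-1) (1 + omega) dA = dB" "move (-1) (1 + omega) dB = dA"
    by (simp_all add: dA_def dB_def omega_square)
qed

lemma ctri_dA_dB: "1 \<in> ctri dA" "omega \<in> ctri dA" "1 \<in> ctri dB" "omega \<in> ctri dB"
  unfolding dA_dB(5,6) by (simp_all add: ctri_up ctri_down)

text \<open>\<open>h\<close> is the midpoint of the edge from 1 to \<open>omega\<close>. It is off
  the lattice and its star is common to the stars of both centres, so developments around the two
  centres can be compared there.\<close>

lemma both_centres:
  assumes "\<delta> \<in> ldarts" defines "h \<equiv> (1 / 2) *\<^sub>R (1 + omega)"
  shows "h \<in> ctri \<delta> \<longleftrightarrow> 1 \<in> ctri \<delta> \<and> omega \<in> ctri \<delta>" "h \<notin> eisenstein"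
proof -
  have hc: "xc h = 1 / 2" "yc h = 1 / 2" by (simp_all add: h_def)
  have nz: "(1::real) / 2 \<noteq> of_int i" for i :: int
  proof
    assume "(1::real) / 2 = of_int i"
    then have "2 * i = 1" by linarith
    then show False by presburger
  qed
  then show "h \<notin> eisenstein" by (auto simp: eisenstein_iff hc elim!: Ints_cases)
  have "1 \<in> ctri \<delta> \<and> omega \<in> ctri \<delta>" if "h \<in> ctri \<delta>"
    using assms(1)
  proof (cases rule: ldarts_cases)
    case (up m n)
    then have c: "ctri \<delta> = ctri (lat m n, 1)" by auto
    have "of_int m \<le> (1::real) / 2" "of_int n \<le> (1::real) / 2" "(1::real) \<le> of_int m + of_int n + 1"
      using that unfolding c ctri_up by (simp_all add: hc)
    then have "m \<le> 0" "n \<le> 0" "0 \<le> m + n" by linarith+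
    then show ?thesis unfolding c by (simp add: ctri_up)
  next
    case (down m n)
    then have c: "ctri \<delta> = ctri (lat m n, -1)" by auto
    have "(1::real) / 2 \<le> of_int m" "(1::real) / 2 \<le> of_int n" "of_int m + of_int n - 1 \<le> (1::real)"
      using that unfolding c ctri_down by (simp_all add: hc)
    then have "1 \<le> m" "1 \<le> n" "m + n \<le> 2" by linarith+
    then show ?thesis unfolding c by (simp add: ctri_down)
  qed
  moreover have "h \<in> ctri \<delta>" if "1 \<in> ctri \<delta>" "omega \<in> ctri \<delta>"
    using convexD_alt[OF convex_ctri that, of "1 / 2"] by (simp add: h_def scaleR_add_right)
  ultimately show "h \<in> ctri \<delta> \<longleftrightarrow> 1 \<in> ctri \<delta> \<and> omega \<in> ctri \<delta>" by blast
qed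

lemma meets:
  "ltri dA \<inter> patch \<noteq> {}" "ltri dB \<inter> patch \<noteq> {}" "ledge dA \<inter> patch \<noteq> {}" "ledge (lface dA) \<inter> patch \<noteq> {}"
proof -
  have "of_real (1 / 5) + of_real (2 / 5) * omega \<in> ltri dA \<inter> patch" 
    unfolding dA_dB(5) ltri_lface by (auto simp: ltri_up intro!: patchI simp del: of_real_divide)
  then show "ltri dA \<inter> patch \<noteq> {}" by blast
  have "of_real (2 / 5) + of_real (4 / 5) * omega \<in> ltri dB \<inter> patch" 
    unfolding dA_dB(6) ltri_lface by (auto simp: ltri_down intro!: patchI simp del: of_real_divide)
  then show "ltri dB \<inter> patch \<noteq> {}" by blast
  have om: "omega\<^sup>2 \<noteq> 0" by simp
  \<comment> \<open>The parameter exceeds 1/2 because the first half of this edge lies in the other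
    patch, beyond the diagonal \<open>xc = yc\<close>.\<close>
  have "1 + of_real (3 / 4) * omega\<^sup>2 \<in> ledge dA"
    unfolding dA_def ledge_iff using om by (intro conjI exI[of _ "3 / 4"]) auto
  moreover have "1 + of_real (3 / 4) * omega\<^sup>2 \<in> patch"
    unfolding omega_square by (rule patchI) (simp_all del: of_real_divide)
  ultimately show "ledge dA \<inter> patch \<noteq> {}" by blast
  have "omega + of_real (1 / 2) * (- omega) \<in> ledge (lface dA)"
    unfolding dA_dB(7) ledge_iff by (intro conjI exI[of _ "1 / 2"]) auto
  moreover have "omega + of_real (1 / 2) * (- omega) \<in> patch"
    by (rule patchI) (simp_all del: of_real_divide mult_minus_right)
  ultimately show "ledge (lface dA) \<inter> patch \<noteq> {}" by blast
qed

section \<open>Development around hexagons\<close>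

context triangulation
begin

lemma link_move:
  assumes c: "c \<in> eisenstein_units" "s \<in> eisenstein" and l: "((\<delta>, e), (\<delta>', e')) \<in> link T t"
  shows "((move c s \<delta>, e), (move c s \<delta>', e')) \<in> link T (aff c s t)"
  using l unfolding link_def
proof (induction "(\<delta>', e')" arbitrary: \<delta>' e' rule: rtrancl_induct)
  case (step y)
  obtain \<epsilon> x where y: "y = (\<epsilon>, x)" by (cases y)
  have "((\<epsilon>, x), (\<delta>', e')) \<in> lstep T t" using step y by simp
  then have "((move c s \<epsilon>, x), (move c s \<delta>', e')) \<in> lstep T (aff c s t)"
    using move_ldarts[OF c] unfolding lstep_def by (auto simp: ctri_move move_lface simp flip: move_lopp)
  then show ?case using step(3)[OF y] by (rule rtrancl_into_rtrancl[rotated])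
qed simp

text \<open>Two turns inside the triangle and one crossing lead to the next dart around
  \<open>t\<close>.\<close>

lemma link_rot:
  assumes "(t, v) \<in> ldarts" "x \<in> darts T"
  shows "(((t, v), x), ((t, omega * v), rot T x)) \<in> link T t"
proof -
  have c: "t \<in> ctri (t, w)" for w by (simp add: ctri.simps hull_inc)
  have f: "(((t, v), x), (lface (lface (t, v)), face T (face T x))) \<in> link T t"
    using link_trans[OF link_face(1)[OF assms c] link_face(1)] assms c by auto
  have "lopp (lface (lface (t, v))) = (t, omega * v)" by (simp add: lface_2)
  then have "((lface (lface (t, v)), face T (face T x)), ((t, omega * v), rot T x)) \<in> link T t"
    using link_opp[of "lface (lface (t, v))" "face T (face T x)" t] assms c opp_face_face[OF assms(2)]
    by (metis ctri_lface face_in lface_ldarts)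
  then show ?thesis using f link_trans by blast
qed

end

context coloured
begin

text \<open>Development around the origin of \<open>\<delta>0\<close>, turned into a function. It is
  well defined for \<open>g\<close> of colour 2, because the vertex at the origin of such a dart has
  degree 6.\<close>

definition dev :: "ldart \<Rightarrow> 'd \<Rightarrow> ldart \<Rightarrow> 'd" where
  "dev \<delta>0 g \<delta> = (THE e. ((\<delta>0, g), (\<delta>, e)) \<in> link T (fst \<delta>0))"

lemma dev:
  assumes d0: "\<delta>0 = (c, u)" "\<delta>0 \<in> ldarts" and g: "g \<in> layer 2"
  shows "\<delta> \<in> ldarts \<Longrightarrow> c \<in> ctri \<delta> \<Longrightarrow> ((\<delta>0, g), (\<delta>, dev \<delta>0 g \<delta>)) \<in> link T c"
    and "((\<delta>0, g), (\<delta>, e)) \<in> link T c \<Longrightarrow> dev \<delta>0 g \<delta> = e"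
proof -
  have cu: "c \<in> eisenstein" "u \<in> eisenstein_units" "c \<in> ctri \<delta>0" using d0 by (auto simp: ctri.simps hull_inc)
  have gT: "g \<in> darts T" "(rot T ^^ 6) g = g" using g rot_6(2)[of g] by (auto simp: layer_def)
  have u: "x = y" if "((\<delta>0, g), (\<delta>, x)) \<in> link T c" "((\<delta>0, g), (\<delta>, y)) \<in> link T c" for x y
    using link_unique_from[OF cu(1,2) gT] that d0 by blast
  show "((\<delta>0, g), (\<delta>, dev \<delta>0 g \<delta>)) \<in> link T c" if d: "\<delta> \<in> ldarts" "c \<in> ctri \<delta>"
  proof -
    have "\<exists>e. ((\<delta>0, g), (\<delta>, e)) \<in> link T c" using link_exists[OF d0(2) d(1) cu(3) d(2) gT(1)] .
    then have "\<exists>!e. ((\<delta>0, g), (\<delta>, e)) \<in> link T c" using u by blast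
    then show ?thesis unfolding dev_def d0 fst_conv by (rule theI')
  qed
  show "dev \<delta>0 g \<delta> = e" if "((\<delta>0, g), (\<delta>, e)) \<in> link T c"
    unfolding dev_def using that u d0 by (intro the_equality) auto
qed

text \<open>Development around the centre 1 where possible, and around the centre
  \<open>omega\<close> otherwise; \<open>Psi_omega\<close> shows that the choice does not matter
  where both apply.\<close>

definition Psi :: "'d \<Rightarrow> ldart \<Rightarrow> 'd" where
  "Psi g \<delta> = (if 1 \<in> ctri \<delta> then dev dA g \<delta> else dev dB (opp F g) \<delta>)"

lemma Psi_1:
  assumes g: "g \<in> layer 2" and d: "\<delta> \<in> ldarts" "1 \<in> ctri \<delta>"
  shows "((dA, g), (\<delta>, Psi g \<delta>)) \<in> link T 1" "((dA, g), (\<delta>, e)) \<in> link T 1 \<Longrightarrow> Psi g \<delta> = e"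
  using dev[OF dA_def dA_dB(3) g] d by (simp_all add: Psi_def)

lemma Psi_omega:
  assumes g: "g \<in> layer 2" and d: "\<delta> \<in> ldarts" "omega \<in> ctri \<delta>"
  shows "((dB, opp F g), (\<delta>, Psi g \<delta>)) \<in> link T omega"
    "((dB, opp F g), (\<delta>, e)) \<in> link T omega \<Longrightarrow> Psi g \<delta> = e"
proof -
  note dv = dev[OF dB_def dA_dB(4) opp_layer[OF g]]
  have "dev dA g \<delta> = dev dB (opp F g) \<delta>" if 1: "1 \<in> ctri \<delta>"
  proof -
    \<comment> \<open>Both developments restrict to the one at the midpoint \<open>h\<close>, where
      they start from the same label of \<open>dA\<close>.\<close>
    define h where "h = (1 / 2) *\<^sub>R (1 + omega)"
    have gT: "g \<in> darts T" using g layer_darts by auto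
    have h: "h \<in> ctri \<delta>" "h \<in> ctri dA"
      unfolding h_def using both_centres(1) d 1 ctri_dA_dB dA_dB by blast+
    have n: "near 1 {h}" "near omega {h}" unfolding near_def h_def using both_centres(1) by blast+
    obtain e where e: "((dA, g), (\<delta>, e)) \<in> link T h" using link_exists[OF dA_dB(3) d(1) h(2,1) gT] by blast
    have "dev dA g \<delta> = e" using dev(2)[OF dA_def dA_dB(3) g] link_near[OF n(1) e] by blast
    moreover have "((dB, opp F g), (dA, g)) \<in> link T omega"
      using link_opp[of dB "opp F g" omega] gT dA_dB ctri_dA_dB by simp
    then have "((dB, opp F g), (\<delta>, e)) \<in> link T omega" using link_near[OF n(2) e] link_trans by blast
    then have "dev dB (opp F g) \<delta> = e" using dv(2) by blast
    ultimately show ?thesis by simp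
  qed
  then have *: "Psi g \<delta> = dev dB (opp F g) \<delta>" by (simp add: Psi_def)
  show "((dB, opp F g), (\<delta>, Psi g \<delta>)) \<in> link T omega" unfolding * using dv(1) d by blast
  show "((dB, opp F g), (\<delta>, e)) \<in> link T omega \<Longrightarrow> Psi g \<delta> = e" unfolding * using dv(2) by blast
qed

lemma Psi_unfolds:
  assumes g: "g \<in> layer 2" shows "unfolds T rhombus (Psi g)"
  unfolding unfolds_def
proof (intro ballI impI conjI)
  have gT: "g \<in> darts T" "opp F g \<in> darts T" using g layer_darts by auto
  fix \<delta> assume d: "\<delta> \<in> ldarts" "ltri \<delta> \<inter> rhombus \<noteq> {}"
  have *: "Psi g \<delta> \<in> darts T \<and> Psi g (lface \<delta>) = face T (Psi g \<delta>)"
    using rhombus_star[OF d]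
  proof
    assume 1: "1 \<in> ctri \<delta>"
    note l = Psi_1(1)[OF g d(1) 1]
    have D: "Psi g \<delta> \<in> darts T" using link_closed[OF l dA_dB(3) gT(1) ctri_dA_dB(1)] by blast
    have "Psi g (lface \<delta>) = face T (Psi g \<delta>)"
      by (rule Psi_1(2)[OF g _ _ link_trans[OF l link_face(1)]]) (use d 1 D in auto)
    then show ?thesis using D by blast
  next
    assume 1: "omega \<in> ctri \<delta>"
    note l = Psi_omega(1)[OF g d(1) 1]
    have D: "Psi g \<delta> \<in> darts T" using link_closed[OF l dA_dB(4) gT(2) ctri_dA_dB(4)] by blast
    have "Psi g (lface \<delta>) = face T (Psi g \<delta>)"
      by (rule Psi_omega(2)[OF g _ _ link_trans[OF l link_face(1)]]) (use d 1 D in auto)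
    then show ?thesis using D by blast
  qed
  then show "Psi g \<delta> \<in> darts T" "Psi g (lface \<delta>) = face T (Psi g \<delta>)" by auto
  assume "ledge \<delta> \<inter> rhombus \<noteq> {}"
  then have m: "ltri (lopp \<delta>) \<inter> rhombus \<noteq> {}"
    using ltri_meets[OF lopp_ldarts[OF d(1)] open_rhombus] ledge_subset_ctri by blast
  consider "1 \<in> ctri \<delta>" "1 \<in> ctri (lopp \<delta>)" | "omega \<in> ctri \<delta>" "omega \<in> ctri (lopp \<delta>)"
    | "1 \<in> ctri \<delta>" "1 \<notin> ctri (lopp \<delta>)" "omega \<in> ctri (lopp \<delta>)" "omega \<notin> ctri \<delta>"
    | "omega \<in> ctri \<delta>" "omega \<notin> ctri (lopp \<delta>)" "1 \<in> ctri (lopp \<delta>)" "1 \<notin> ctri \<delta>"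
    using rhombus_star[OF d] rhombus_star[OF lopp_ldarts[OF d(1)] m] by blast
  then show "Psi g (lopp \<delta>) = opp T (Psi g \<delta>)"
  proof cases
    case 1
    show ?thesis
      by (rule Psi_1(2)[OF g _ _ link_trans[OF Psi_1(1)[OF g d(1) 1(1)] link_opp]]) (use d 1 * in auto)
  next
    case 2
    show ?thesis
      by (rule Psi_omega(2)[OF g _ _ link_trans[OF Psi_omega(1)[OF g d(1) 2(1)] link_opp]]) (use d 2 * in auto)
  next
    case 3
    then show ?thesis using opposite_vertices[of 1 omega \<delta>] d norm_omega_1 by (simp add: norm_minus_commute)
  next
    case 4
    then show ?thesis using opposite_vertices[of omega 1 \<delta>] d norm_omega_1 by simp
  qed
qed

lemma Psi_opp:
  assumes g: "g \<in> layer 2" and d: "\<delta> \<in> ldarts" "ltri \<delta> \<inter> rhombus \<noteq> {}"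
  shows "Psi (opp F g) (move (-1) (1 + omega) \<delta>) = Psi g \<delta>"
proof -
  have c: "-1 \<in> eisenstein_units" "1 + omega \<in> eisenstein" by auto
  have m: "move (-1) (1 + omega) \<delta> \<in> ldarts" using move_ldarts[OF c d(1)] .
  have a: "aff (-1) (1 + omega) 1 = omega" "aff (-1) (1 + omega) omega = 1" by (simp_all add: aff_def)
  from rhombus_star[OF d] show ?thesis
  proof
    assume 1: "1 \<in> ctri \<delta>"
    have "omega \<in> ctri (move (-1) (1 + omega) \<delta>)" unfolding ctri_move using 1 a(1) by (metis imageI)
    moreover have "((dB, g), (move (-1) (1 + omega) \<delta>, Psi g \<delta>)) \<in> link T omega"
      using link_move[OF c Psi_1(1)[OF g d(1) 1]] unfolding a dA_dB(9) .
    ultimately show ?thesis using Psi_omega(2)[OF opp_layer[OF g] m] by simp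
  next
    assume 1: "omega \<in> ctri \<delta>"
    have "1 \<in> ctri (move (-1) (1 + omega) \<delta>)" unfolding ctri_move using 1 a(2) by (metis imageI)
    moreover have "((dA, opp F g), (move (-1) (1 + omega) \<delta>, Psi g \<delta>)) \<in> link T 1"
      using link_move[OF c Psi_omega(1)[OF g d(1) 1]] unfolding a dA_dB(10) .
    ultimately show ?thesis using Psi_1(2)[OF opp_layer[OF g] m] by simp
  qed
qed

text \<open>The motion is a rotation about \<open>omega\<close>. It takes \<open>dB\<close> to the
  dart of direction -1; two turns around \<open>omega\<close> lead back to \<open>dB\<close>, and
  two turns in \<open>T\<close> are one rotation in \<open>G\<close>.\<close>

lemma Psi_face:
  assumes g: "g \<in> layer 2" and d: "\<delta> \<in> ldarts" "ltri \<delta> \<inter> patch \<noteq> {}"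
  shows "Psi (opp F (face F (face F (opp F g)))) (move (- omega) (2 * omega - 1) \<delta>) = Psi g \<delta>"
proof -
  define g' where "g' = opp F (face F (face F (opp F g)))"
  have g': "g' \<in> layer 2" unfolding g'_def by (intro opp_layer rot_layer g)
  have gT: "opp F g \<in> darts T" using g layer_darts by auto
  have c: "- omega \<in> eisenstein_units" "2 * omega - 1 \<in> eisenstein" by (auto simp: eisenstein_iff)
  have m: "move (- omega) (2 * omega - 1) \<delta> \<in> ldarts" using move_ldarts[OF c d(1)] .
  have o: "omega \<in> ctri \<delta>" by (rule patch_star[OF d])
  have a: "aff (- omega) (2 * omega - 1) omega = omega" by (simp add: aff_def omega_mult_self)
  have b: "move (- omega) (2 * omega - 1) dB = (omega, - 1)"
    by (simp add: dB_def omega_square omega_mult_self algebra_simps)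
  have o': "omega \<in> ctri (move (- omega) (2 * omega - 1) \<delta>)" unfolding ctri_move using o a by (metis imageI)
  have "(((omega, -1), opp F g), (move (- omega) (2 * omega - 1) \<delta>, Psi g \<delta>)) \<in> link T omega"
    using link_move[OF c Psi_omega(1)[OF g d(1) o]] unfolding a b .
  moreover have "(((omega, -1), opp F g), (dB, opp F g')) \<in> link T omega"
  proof -
    have 1: "(((omega, -1), opp F g), ((omega, omega * -1), rot T (opp F g))) \<in> link T omega"
      by (rule link_rot) (use gT in auto)
    have 2: "(((omega, omega * -1), rot T (opp F g)), ((omega, omega * (omega * -1)), rot T (rot T (opp F g)))) \<in> link T omega"
      by (rule link_rot) (use gT rot_in in auto)
    have "(omega, omega * (omega * -1)) = dB" by (simp add: dB_def power2_eq_square)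
    moreover have "rot T (rot T (opp F g)) = opp F g'" by (simp add: g'_def)
    ultimately show ?thesis using link_trans[OF 1 2] by simp
  qed
  ultimately have "((dB, opp F g'), (move (- omega) (2 * omega - 1) \<delta>, Psi g \<delta>)) \<in> link T omega"
    using link_sym link_trans by blast
  then show ?thesis using Psi_omega(2)[OF g' m o'] unfolding g'_def by blast
qed

lemma leapfrog: "leapfrog_fullerene F"
proof -
  interpret GF: fuller G using fullerene_G by unfold_locales
  have "goldberg_coxeter 1 1 G F"
    unfolding goldberg_coxeter_1_1
  proof (intro conjI exI[of _ Psi] ballI impI)
    show "card (darts F) = 3 * card (darts G)" using card_layer(3) by simp
    fix g assume "g \<in> darts (dual G)"
    then have g: "g \<in> layer 2" by simp
    show "unfolds (dual F) rhombus (Psi g)" by (rule Psi_unfolds[OF g])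
    fix \<delta> assume d: "\<delta> \<in> ldarts"
    show "Psi (opp (dual G) g) (move (-1) (1 + omega) \<delta>) = Psi g \<delta>" if "ltri \<delta> \<inter> rhombus \<noteq> {}"
    proof -
      have "opp (dual G) g = opp F g" using g by (simp add: dual_def) (simp add: G_def)
      then show ?thesis using Psi_opp[OF g d that] by simp
    qed
    have "face (dual G) g = opp F (face F (face F (opp F g)))"
      unfolding GF.face_T using g opp_layer[OF g] rot_layer[OF opp_layer[OF g]] by (simp add: G_def)
    then show "Psi (face (dual G) g) (move (1 / omega\<^sup>2) (- (1 + omega) / omega\<^sup>2) \<delta>) = Psi g \<delta>"
      if "ltri \<delta> \<inter> patch \<noteq> {}"
      unfolding omega_div using Psi_face[OF g d that] by simp
  qed
  then show ?thesis unfolding leapfrog_fullerene_def using fullerene fullerene_G by blast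
qed

end

section \<open>Colouring a leapfrog fullerene\<close>

locale leapfrogged = F: fuller F + G: fuller G for F G :: "'d cmap" +
  fixes \<Psi>
  assumes card: "card (darts F) = 3 * card (darts G)"
    and unf: "\<And>g. g \<in> darts G \<Longrightarrow> unfolds (dual F) rhombus (\<Psi> g)"
    and opp: "\<And>g \<delta>. g \<in> darts G \<Longrightarrow> \<delta> \<in> ldarts \<Longrightarrow> ltri \<delta> \<inter> rhombus \<noteq> {} \<Longrightarrow>
      \<Psi> (opp G g) (move (-1) (1 + omega) \<delta>) = \<Psi> g \<delta>"
    and face: "\<And>g \<delta>. g \<in> darts G \<Longrightarrow> \<delta> \<in> ldarts \<Longrightarrow> ltri \<delta> \<inter> patch \<noteq> {} \<Longrightarrow>
      \<Psi> (face (dual G) g) (move (- omega) (2 * omega - 1) \<delta>) = \<Psi> g \<delta>"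
begin

definition cross :: "'d \<Rightarrow> 'd" where "cross g = \<Psi> g dA"

lemma unf_rules:
  assumes "g \<in> darts G" "\<delta> \<in> ldarts" "ltri \<delta> \<inter> rhombus \<noteq> {}"
  shows "\<Psi> g \<delta> \<in> darts F" "\<Psi> g (lface \<delta>) = face (dual F) (\<Psi> g \<delta>)"
    "ledge \<delta> \<inter> rhombus \<noteq> {} \<Longrightarrow> \<Psi> g (lopp \<delta>) = opp F (\<Psi> g \<delta>)"
  using unf[OF assms(1)] assms(2,3) unfolding unfolds_def by auto

lemma meets_rhombus: "ltri dA \<inter> rhombus \<noteq> {}" "ltri dB \<inter> rhombus \<noteq> {}"
  "ledge dA \<inter> rhombus \<noteq> {}" "ledge (lface dA) \<inter> rhombus \<noteq> {}"
  using meets patch_subset_rhombus by blast+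

lemma cross_in: "g \<in> darts G \<Longrightarrow> cross g \<in> darts F"
  unfolding cross_def using unf_rules(1) dA_dB(3) meets_rhombus(1) by blast

lemma cross_opp: assumes g: "g \<in> darts G" shows "opp F (cross g) = cross (opp G g)"
proof -
  have "opp F (cross g) = \<Psi> g dB"
    using unf_rules(3)[OF g dA_dB(3) meets_rhombus(1,3)] by (simp add: cross_def dA_dB(1))
  also have "\<dots> = cross (opp G g)"
    using opp[OF g dA_dB(4) meets_rhombus(2)] by (simp only: cross_def dA_dB(10))
  finally show ?thesis .
qed

text \<open>Neighbouring triangles around the centre of a patch share an edge from this centre to a
  corner of the patch. They belong to consecutive sides of the patch, here \<open>g\<close> and its
  successor.\<close>

lemma cross_face:
  assumes g: "g \<in> darts G"
  shows "opp F (face (dual F) (cross (face (dual G) g))) = face (dual F) (face (dual F) (cross (opp G g)))"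
proof -
  have g1: "face (dual G) g \<in> darts G" using G.face_in[of g] g by simp
  have "opp F (face (dual F) (cross (face (dual G) g))) = opp F (\<Psi> (face (dual G) g) (lface dA))"
    using unf_rules(2)[OF g1 dA_dB(3) meets_rhombus(1)] by (simp add: cross_def)
  also have "\<dots> = \<Psi> (face (dual G) g) (lopp (lface dA))"
    using unf_rules(3)[OF g1, of "lface dA"] meets_rhombus dA_dB(3) by simp
  also have "lopp (lface dA) = move (- omega) (2 * omega - 1) (lface (lface dB))"
    by (simp add: dA_dB(7,8) omega_mult_self algebra_simps)
  also have "\<Psi> (face (dual G) g) (move (- omega) (2 * omega - 1) (lface (lface dB))) = \<Psi> g (lface (lface dB))"
    using face[OF g, of "lface (lface dB)"] meets dA_dB(4) by simp
  also have "\<dots> = face (dual F) (face (dual F) (\<Psi> g dB))"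
    using unf_rules(2)[OF g dA_dB(4) meets_rhombus(2)] unf_rules(2)[OF g, of "lface dB"] meets_rhombus(2) dA_dB(4) by simp
  also have "\<Psi> g dB = cross (opp G g)"
    using opp[OF g dA_dB(4) meets_rhombus(2)] by (simp only: cross_def dA_dB(10))
  finally show ?thesis .
qed

section \<open>Every dart of \<open>F\<close> arises exactly once from a dart of
  \<open>G\<close>\<close>

abbreviation "f \<equiv> face (dual F)"

definition covered :: "'d set" where
  "covered = (\<lambda>(g, i). (f ^^ i) (cross g)) ` (darts G \<times> {0, 1, 2})"

lemma coveredI: "g \<in> darts G \<Longrightarrow> cross g \<in> covered" "g \<in> darts G \<Longrightarrow> f (cross g) \<in> covered"
  "g \<in> darts G \<Longrightarrow> f (f (cross g)) \<in> covered"
proof -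
  have "(f ^^ i) (cross g) \<in> covered" if "g \<in> darts G" "i \<in> {0, 1, 2}" for i
    unfolding covered_def by (rule image_eqI[of _ _ "(g, i)"]) (use that in auto)
  from this[of 0] this[of 1] this[of 2]
  show "g \<in> darts G \<Longrightarrow> cross g \<in> covered" "g \<in> darts G \<Longrightarrow> f (cross g) \<in> covered"
    "g \<in> darts G \<Longrightarrow> f (f (cross g)) \<in> covered" by (simp_all add: numeral_2_eq_2)
qed

lemma coveredE:
  assumes "x \<in> covered"
  obtains g where "g \<in> darts G" "x = cross g" | g where "g \<in> darts G" "x = f (cross g)"
    | g where "g \<in> darts G" "x = f (f (cross g))"
  using assms by (auto simp: covered_def numeral_2_eq_2)

lemma face_G_in: "g \<in> darts G \<Longrightarrow> face (dual G) g \<in> darts G"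
  using G.face_in[of g] by simp

lemma face_G_surj: "g \<in> darts G \<Longrightarrow> \<exists>g'\<in>darts G. g = face (dual G) g'"
  using G.face_3[of g] face_G_in by (metis G.dual_simps(1))

lemma covered_face: "x \<in> covered \<Longrightarrow> f x \<in> covered"
  by (erule coveredE) (use coveredI F.face_3 cross_in in auto)

lemma covered_opp: assumes "x \<in> covered" shows "opp F x \<in> covered"
  using assms
proof (cases rule: coveredE)
  case (1 g) then show ?thesis using cross_opp coveredI(1) by simp
next
  case (2 g)
  obtain g' where "g' \<in> darts G" "g = face (dual G) g'" using face_G_surj 2 by blast
  then show ?thesis using cross_face 2 coveredI(3) by simp
next
  case (3 g)
  then have o: "opp G g \<in> darts G" by simp
  then have "x = opp F (f (cross (face (dual G) (opp G g))))" using cross_face[OF o] 3 by simp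
  then show ?thesis using coveredI(2) face_G_in[OF o] by simp
qed

lemma covered_all: "covered = darts F"
proof
  show "covered \<subseteq> darts F"
    using F.face_in cross_in by (auto elim!: coveredE)
  obtain g where g: "g \<in> darts G" using G.F.comb by (auto simp: combinatorial_map_def)
  show "darts F \<subseteq> covered"
  proof
    fix x assume "x \<in> darts F"
    then have "(cross g, x) \<in> {(x, y). x \<in> darts F \<and> (y = opp F x \<or> y = rot F x)}\<^sup>*"
      using F.connected_F cross_in[OF g] by (auto simp: connected_map_def)
    then show "x \<in> covered"
    proof (induction rule: rtrancl_induct)
      case base then show ?case using coveredI(1) g by blast
    next
      case (step y z)
      then show ?case using covered_opp covered_face F.rot_F by auto
    qed
  qed
qed

text \<open>All darts of \<open>F\<close> are reached, by connectedness, and there are as many of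
  them as indices, so none is reached twice. The number of darts in \<open>goldberg_coxeter\<close>
  is used here.\<close>

lemma covered_inj: "inj_on (\<lambda>(g, i). (f ^^ i) (cross g)) (darts G \<times> {0, 1, 2})"
proof (rule eq_card_imp_inj_on)
  have "card (darts G \<times> {0::nat, 1, 2}) = card (darts G) * 3" by (simp add: card_cartesian_product)
  then show "card ((\<lambda>(g, i). (f ^^ i) (cross g)) ` (darts G \<times> {0, 1, 2})) = card (darts G \<times> {0::nat, 1, 2})"
    using covered_all card unfolding covered_def by simp
qed (use G.F.fin in simp)

text \<open>To the left of a dart \<open>cross g\<close> the third vertex is a corner of the patch,
  hence distinguished, so the colour is 2; each application of \<open>f\<close> lowers it by
  1.\<close>

definition position :: "'d \<Rightarrow> int" where
  "position x = 2 - int (snd (the_inv_into (darts G \<times> {0, 1, 2}) (\<lambda>(g, i). (f ^^ i) (cross g)) x))"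

lemma position:
  assumes "g \<in> darts G"
  shows "position (cross g) = 2" "position (f (cross g)) = 1" "position (f (f (cross g))) = 0"
  using the_inv_into_f_f[OF covered_inj, of "(g, 0)"] the_inv_into_f_f[OF covered_inj, of "(g, 1)"]
    the_inv_into_f_f[OF covered_inj, of "(g, 2)"] assms
  by (simp_all add: position_def numeral_2_eq_2)

lemma position_colouring: "colouring (dual F) position"
  unfolding colouring_def
proof (intro ballI conjI)
  fix x assume "x \<in> darts (dual F)"
  then have x: "x \<in> covered" using covered_all by simp
  show "[position (face (dual F) x) = position x - 1] (mod 3)"
    using x
  proof (cases rule: coveredE)
    case (3 g)
    then have "f x = cross g" using F.face_3[of "cross g"] cross_in by simp
    then show ?thesis using position 3 by (simp add: cong_def)
  qed (simp_all add: position)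
  show "[position (opp (dual F) x) = 1 - position x] (mod 3)"
    using x
  proof (cases rule: coveredE)
    case (1 g)
    then show ?thesis using cross_opp[of g] position[of g] position[of "opp G g"] by (simp add: cong_def)
  next
    case (2 g)
    obtain g' where g': "g' \<in> darts G" "g = face (dual G) g'" using face_G_surj 2 by blast
    then have "opp F x = f (f (cross (opp G g')))" using cross_face[OF g'(1)] 2 by simp
    then show ?thesis using position[OF 2(1)] position[of "opp G g'"] 2 g' by simp
  next
    case (3 g)
    then have o: "opp G g \<in> darts G" by simp
    have "x = opp F (f (cross (face (dual G) (opp G g))))" using cross_face[OF o] 3 by simp
    then have "opp F x = f (cross (face (dual G) (opp G g)))" by simp
    then show ?thesis using position[OF 3(1)] position[OF face_G_in[OF o]] 3 by simp
  qed
qed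

end

theorem leapfrog_iff_colouring:
  assumes F: "fullerene F" shows "leapfrog_fullerene F \<longleftrightarrow> (\<exists>\<sigma>. colouring (dual F) \<sigma>)"
proof
  assume "leapfrog_fullerene F"
  then obtain G where G: "fullerene G" "goldberg_coxeter 1 1 G F" by (auto simp: leapfrog_fullerene_def)
  obtain \<Psi> where P: "\<And>d. d \<in> darts (dual G) \<Longrightarrow> unfolds (dual F) rhombus (\<Psi> d) \<and>
        (\<forall>\<delta>\<in>ldarts. ltri \<delta> \<inter> rhombus \<noteq> {} \<longrightarrow>
           \<Psi> (opp (dual G) d) (move (-1) (1 + omega) \<delta>) = \<Psi> d \<delta>) \<and>
        (\<forall>\<delta>\<in>ldarts. ltri \<delta> \<inter> patch \<noteq> {} \<longrightarrow>
           \<Psi> (face (dual G) d) (move (1 / omega\<^sup>2) (- (1 + omega) / omega\<^sup>2) \<delta>) = \<Psi> d \<delta>)"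
    and c: "card (darts F) = 3 * card (darts G)"
    using G(2) unfolding goldberg_coxeter_1_1 by blast
  have "leapfrogged F G \<Psi>"
  proof (intro leapfrogged.intro leapfrogged_axioms.intro)
    show "fuller F" "fuller G" using F G by (simp_all add: fuller_def)
    show "card (darts F) = 3 * card (darts G)" by (rule c)
    fix g assume "g \<in> darts G"
    then have g: "g \<in> darts (dual G)" by (simp add: dual_def)
    show "unfolds (dual F) rhombus (\<Psi> g)" using P[OF g] by blast
    fix \<delta> assume d: "\<delta> \<in> ldarts"
    have "opp (dual G) g = opp G g" by (simp add: dual_def)
    then show "\<Psi> (opp G g) (move (-1) (1 + omega) \<delta>) = \<Psi> g \<delta>" if "ltri \<delta> \<inter> rhombus \<noteq> {}"
      using P[OF g] d that by metis
    show "\<Psi> (face (dual G) g) (move (- omega) (2 * omega - 1) \<delta>) = \<Psi> g \<delta>" if "ltri \<delta> \<inter> patch \<noteq> {}"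
      using P[OF g] d that unfolding omega_div by blast
  qed
  then show "\<exists>\<sigma>. colouring (dual F) \<sigma>" using leapfrogged.position_colouring by blast
next
  assume "\<exists>\<sigma>. colouring (dual F) \<sigma>"
  then obtain \<sigma> where "colouring (dual F) \<sigma>" by blast
  then have "coloured F \<sigma>" using F by (simp add: coloured_def coloured_axioms_def fuller_def)
  then show "leapfrog_fullerene F" by (rule coloured.leapfrog)
qed

theorem theorem2:
  fixes F :: "'d cmap" and M :: "'d tile set"
  assumes "fullerene F" and "master_polyhedron F M"
  shows "leapfrog_fullerene F \<longleftrightarrow>
    (\<forall>v\<in>master_edges M. \<forall>a' b'. coxeter_coordinates v a' b' \<longrightarrow> [a' = b'] (mod 3))"
proof -
  interpret fuller F using assms(1) by unfold_locales
  interpret tiled "dual F" M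
    using assms(2) degree by unfold_locales (auto simp: master_polyhedron_def)
  show ?thesis unfolding leapfrog_iff_colouring[OF assms(1)] by (rule colouring_iff_side_vectors)
qed

end
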